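(* Let $\mathcal{E}$ be a locally small Boolean topos with a local state classifier (for example, an arbitrary Boolean Grothendieck topos). Then there exists an internal parameterization of the quotients of $\mathcal{E}$ (a bijective correspondence between quotients of $\mathcal{E}$ and internal semilattice homomorphisms $\Xi\to\Omega$ from the local state classifier $\Xi$ to the subobject classifier $\Omega$ of $\mathcal{E}$). In particular, the number of quotients of $\mathcal{E}$ is small.
   Context: "Topos" means elementary topos. "Small" means being in bijection with a (small) set. Local state classifier: for a category $\mathcal{C}$, let $\mathcal{C}_{\mathrm{mono}}$ be the subcategory with the same objects and all monomorphisms of $\mathcal{C}$. A local state classifier of $\mathcal{C}$ is a colimit $\Xi$ (if it exists) of the (possibly large) inclusion functor $\mathcal{C}_{\mathrm{mono}}\to\mathcal{C}$, with colimit cocone $\{\xi_X\colon X\to\Xi\}_{X\in\mathrm{ob}(\mathcal{C})}$. A quotient of $\mathcal{E}$ is a connected geometric morphism $f\colon\mathcal{E}\to\mathcal{F}$ to some topos $\mathcal{F}$, i.e. one whose inverse image functor $f^*$ is fully faithful; two quotients are identified when the essential images of their inverse image functors coincide. Internal semilattice: an object $A$ with morphisms $\top\colon\mathbf{1}\to A$, $\wedge\colon A\times A\to A$ satisfying $x\wedge\top=\top\wedge x=x$, associativity, commutativity and $x\wedge x=x$; homomorphisms preserve $\top$ and $\wedge$. Semilattice structure on $\Xi$: since $\mathcal{E}$ is cartesian closed, $\{\xi_X\times\xi_Y\colon X\times Y\to\Xi\times\Xi\}_{X,Y}$ is a colimit cocone of the functor $\mathcal{E}_{\mathrm{mono}}\times\mathcal{E}_{\mathrm{mono}}\to\mathcal{E}$,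 $(X,Y)\mapsto X\times Y$. Put $\top=\xi_{\mathbf{1}}$ and let $\wedge\colon\Xi\times\Xi\to\Xi$ be the unique morphism with $\wedge\circ(\xi_X\times\xi_Y)=\xi_{X\times Y}$ for all $X,Y$. The object $\Omega$ has its usual semilattice structure ($\top=\mathrm{true}$, $\wedge$ the characteristic morphism of $\mathrm{true}\times\mathrm{true}$). The correspondence meant: a homomorphism $h\colon\Xi\to\Omega$, classifying a subobject $k\colon F\rightarrowtail\Xi$, corresponds to the quotient given by the full subcategory of those $X\in\mathrm{ob}(\mathcal{E})$ for which $\xi_X$ factors through $k$. *)

theory Defs
  imports Main "HOL-Library.Equipollence"
begin

section \<open>Categories and functors\<close>

record ('o, 'm) category =
  Obj :: "'o set"
  Arr :: "'m set"
  Dom :: "'m \<Rightarrow> 'o"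
  Cod :: "'m \<Rightarrow> 'o"
  Idn :: "'o \<Rightarrow> 'm"
  Comp :: "'m \<Rightarrow> 'm \<Rightarrow> 'm" (infixl "\<cdot>\<index>" 70)

text \<open>Composition is written in the usual order: \<open>g \<cdot> f\<close> is \<open>g\<close> after \<open>f\<close>.
  Objects and arrows are carved out of the types \<open>'o\<close> and \<open>'m\<close> as arbitrary sets.\<close>

definition hom :: "('o, 'm) category \<Rightarrow> 'o \<Rightarrow> 'o \<Rightarrow> 'm set" where
  "hom C X Y = {f \<in> Arr C. Dom C f = X \<and> Cod C f = Y}"

definition category :: "('o, 'm) category \<Rightarrow> bool" where
  "category C \<longleftrightarrow>
     (\<forall>f\<in>Arr C. Dom C f \<in> Obj C \<and> Cod C f \<in> Obj C) \<and>
     (\<forall>X\<in>Obj C. Idn C X \<in> hom C X X) \<and>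
     (\<forall>X Y Z f g. f \<in> hom C X Y \<and> g \<in> hom C Y Z \<longrightarrow> g \<cdot>\<^bsub>C\<^esub> f \<in> hom C X Z) \<and>
     (\<forall>X Y f. f \<in> hom C X Y \<longrightarrow> f \<cdot>\<^bsub>C\<^esub> Idn C X = f \<and> Idn C Y \<cdot>\<^bsub>C\<^esub> f = f) \<and>
     (\<forall>W X Y Z f g h. f \<in> hom C W X \<and> g \<in> hom C X Y \<and> h \<in> hom C Y Z \<longrightarrow>
        h \<cdot>\<^bsub>C\<^esub> (g \<cdot>\<^bsub>C\<^esub> f) = (h \<cdot>\<^bsub>C\<^esub> g) \<cdot>\<^bsub>C\<^esub> f)"

definition monic :: "('o, 'm) category \<Rightarrow> 'm \<Rightarrow> bool" where
  "monic C m \<longleftrightarrow> m \<in> Arr C \<and>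
     (\<forall>X f g. f \<in> hom C X (Dom C m) \<and> g \<in> hom C X (Dom C m) \<and>
        m \<cdot>\<^bsub>C\<^esub> f = m \<cdot>\<^bsub>C\<^esub> g \<longrightarrow> f = g)"

definition isomorphic :: "('o, 'm) category \<Rightarrow> 'o \<Rightarrow> 'o \<Rightarrow> bool" where
  "isomorphic C X Y \<longleftrightarrow>
     (\<exists>f\<in>hom C X Y. \<exists>g\<in>hom C Y X. g \<cdot>\<^bsub>C\<^esub> f = Idn C X \<and> f \<cdot>\<^bsub>C\<^esub> g = Idn C Y)"

record ('o, 'm, 'p, 'n) cfunctor =
  fobj :: "'o \<Rightarrow> 'p"
  fmap :: "'m \<Rightarrow> 'n"

definition cfunctor ::
  "('o, 'm) category \<Rightarrow> ('p, 'n) category \<Rightarrow> ('o, 'm, 'p, 'n) cfunctor \<Rightarrow> bool" where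
  "cfunctor C D F \<longleftrightarrow>
     (\<forall>X\<in>Obj C. fobj F X \<in> Obj D) \<and>
     (\<forall>X Y f. f \<in> hom C X Y \<longrightarrow> fmap F f \<in> hom D (fobj F X) (fobj F Y)) \<and>
     (\<forall>X\<in>Obj C. fmap F (Idn C X) = Idn D (fobj F X)) \<and>
     (\<forall>X Y Z f g. f \<in> hom C X Y \<and> g \<in> hom C Y Z \<longrightarrow>
        fmap F (g \<cdot>\<^bsub>C\<^esub> f) = fmap F g \<cdot>\<^bsub>D\<^esub> fmap F f)"

definition fully_faithful ::
  "('o, 'm) category \<Rightarrow> ('p, 'n) category \<Rightarrow> ('o, 'm, 'p, 'n) cfunctor \<Rightarrow> bool" where
  "fully_faithful C D F \<longleftrightarrow>
     (\<forall>X\<in>Obj C. \<forall>Y\<in>Obj C. bij_betw (fmap F) (hom C X Y) (hom D (fobj F X) (fobj F Y)))"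

definition essential_image ::
  "('o, 'm) category \<Rightarrow> ('p, 'n) category \<Rightarrow> ('o, 'm, 'p, 'n) cfunctor \<Rightarrow> 'p set" where
  "essential_image C D F = {Y \<in> Obj D. \<exists>X\<in>Obj C. isomorphic D (fobj F X) Y}"

definition left_adjoint ::
  "('o, 'm) category \<Rightarrow> ('p, 'n) category \<Rightarrow>
   ('o, 'm, 'p, 'n) cfunctor \<Rightarrow> ('p, 'n, 'o, 'm) cfunctor \<Rightarrow> bool" where
  "left_adjoint C D L R \<longleftrightarrow> cfunctor C D L \<and> cfunctor D C R \<and>
     (\<exists>\<phi>. (\<forall>X\<in>Obj C. \<forall>Y\<in>Obj D.
              bij_betw (\<phi> X Y) (hom D (fobj L X) Y) (hom C X (fobj R Y))) \<and>
          (\<forall>X\<in>Obj C. \<forall>X'\<in>Obj C. \<forall>Y\<in>Obj D. \<forall>Y'\<in>Obj D.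
             \<forall>a\<in>hom C X' X. \<forall>b\<in>hom D Y Y'. \<forall>g\<in>hom D (fobj L X) Y.
               \<phi> X' Y' (b \<cdot>\<^bsub>D\<^esub> g \<cdot>\<^bsub>D\<^esub> fmap L a) = fmap R b \<cdot>\<^bsub>C\<^esub> \<phi> X Y g \<cdot>\<^bsub>C\<^esub> a))"


section \<open>Finite limits\<close>

text \<open>A finite diagram is given by finitely many vertices \<open>i \<in> I\<close> carrying objects \<open>D i\<close>,
  and finitely many edges \<open>(i, a, j) \<in> K\<close> carrying arrows \<open>a\<close> from \<open>D i\<close> to \<open>D j\<close>.
  A functor from a finite category is the case in which the edges are the images of all
  arrows of that category; its cones are the cones of this diagram.\<close>

definition finite_diagram ::
  "('o, 'm) category \<Rightarrow> nat set \<Rightarrow> (nat \<Rightarrow> 'o) \<Rightarrow> (nat \<times> 'm \<times> nat) set \<Rightarrow> bool" where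
  "finite_diagram C I D K \<longleftrightarrow> finite I \<and> finite K \<and> (\<forall>i\<in>I. D i \<in> Obj C) \<and>
     (\<forall>(i, a, j)\<in>K. i \<in> I \<and> j \<in> I \<and> a \<in> hom C (D i) (D j))"

definition cone ::
  "('o, 'm) category \<Rightarrow> nat set \<Rightarrow> (nat \<Rightarrow> 'o) \<Rightarrow> (nat \<times> 'm \<times> nat) set \<Rightarrow>
   'o \<Rightarrow> (nat \<Rightarrow> 'm) \<Rightarrow> bool" where
  "cone C I D K X p \<longleftrightarrow> X \<in> Obj C \<and> (\<forall>i\<in>I. p i \<in> hom C X (D i)) \<and>
     (\<forall>(i, a, j)\<in>K. a \<cdot>\<^bsub>C\<^esub> p i = p j)"

definition limit_cone ::
  "('o, 'm) category \<Rightarrow> nat set \<Rightarrow> (nat \<Rightarrow> 'o) \<Rightarrow> (nat \<times> 'm \<times> nat) set \<Rightarrow>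
   'o \<Rightarrow> (nat \<Rightarrow> 'm) \<Rightarrow> bool" where
  "limit_cone C I D K X p \<longleftrightarrow> cone C I D K X p \<and>
     (\<forall>Y q. cone C I D K Y q \<longrightarrow>
        (\<exists>!u. u \<in> hom C Y X \<and> (\<forall>i\<in>I. p i \<cdot>\<^bsub>C\<^esub> u = q i)))"

definition has_finite_limits :: "('o, 'm) category \<Rightarrow> bool" where
  "has_finite_limits C \<longleftrightarrow>
     (\<forall>I D K. finite_diagram C I D K \<longrightarrow> (\<exists>X p. limit_cone C I D K X p))"

definition preserves_finite_limits ::
  "('o, 'm) category \<Rightarrow> ('p, 'n) category \<Rightarrow> ('o, 'm, 'p, 'n) cfunctor \<Rightarrow> bool" where
  "preserves_finite_limits C C' F \<longleftrightarrow>
     (\<forall>I D K X p. finite_diagram C I D K \<and> limit_cone C I D K X p \<longrightarrow>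
        limit_cone C' I (\<lambda>i. fobj F (D i)) ((\<lambda>(i, a, j). (i, fmap F a, j)) ` K)
          (fobj F X) (\<lambda>i. fmap F (p i)))"

definition terminal :: "('o, 'm) category \<Rightarrow> 'o \<Rightarrow> bool" where
  "terminal C T \<longleftrightarrow> T \<in> Obj C \<and> (\<forall>X\<in>Obj C. \<exists>!f. f \<in> hom C X T)"

definition is_product :: "('o, 'm) category \<Rightarrow> 'o \<Rightarrow> 'o \<Rightarrow> 'o \<Rightarrow> 'm \<Rightarrow> 'm \<Rightarrow> bool" where
  "is_product C X Y Q p q \<longleftrightarrow> p \<in> hom C Q X \<and> q \<in> hom C Q Y \<and>
     (\<forall>Z. \<forall>f\<in>hom C Z X. \<forall>g\<in>hom C Z Y.
        \<exists>!u. u \<in> hom C Z Q \<and> p \<cdot>\<^bsub>C\<^esub> u = f \<and> q \<cdot>\<^bsub>C\<^esub> u = g)"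

text \<open>\<open>is_pullback C f g p q\<close>: the square \<open>f \<cdot> p = g \<cdot> q\<close> is a pullback.\<close>

definition is_pullback :: "('o, 'm) category \<Rightarrow> 'm \<Rightarrow> 'm \<Rightarrow> 'm \<Rightarrow> 'm \<Rightarrow> bool" where
  "is_pullback C f g p q \<longleftrightarrow>
     f \<in> Arr C \<and> g \<in> Arr C \<and> p \<in> Arr C \<and> q \<in> Arr C \<and>
     Cod C f = Cod C g \<and> Cod C p = Dom C f \<and> Cod C q = Dom C g \<and> Dom C p = Dom C q \<and>
     f \<cdot>\<^bsub>C\<^esub> p = g \<cdot>\<^bsub>C\<^esub> q \<and>
     (\<forall>Z. \<forall>x\<in>hom C Z (Dom C f). \<forall>y\<in>hom C Z (Dom C g).
        f \<cdot>\<^bsub>C\<^esub> x = g \<cdot>\<^bsub>C\<^esub> y \<longrightarrow>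
        (\<exists>!u. u \<in> hom C Z (Dom C p) \<and> p \<cdot>\<^bsub>C\<^esub> u = x \<and> q \<cdot>\<^bsub>C\<^esub> u = y))"

text \<open>A choice of a terminal object and of binary products.\<close>

record ('o, 'm) products =
  One :: 'o
  Prod :: "'o \<Rightarrow> 'o \<Rightarrow> 'o"
  Pr1 :: "'o \<Rightarrow> 'o \<Rightarrow> 'm"
  Pr2 :: "'o \<Rightarrow> 'o \<Rightarrow> 'm"

definition finite_products :: "('o, 'm) category \<Rightarrow> ('o, 'm) products \<Rightarrow> bool" where
  "finite_products C P \<longleftrightarrow> terminal C (One P) \<and>
     (\<forall>X\<in>Obj C. \<forall>Y\<in>Obj C. is_product C X Y (Prod P X Y) (Pr1 P X Y) (Pr2 P X Y))"

definition bang :: "('o, 'm) category \<Rightarrow> ('o, 'm) products \<Rightarrow> 'o \<Rightarrow> 'm" where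
  "bang C P X = (THE f. f \<in> hom C X (One P))"

definition pair :: "('o, 'm) category \<Rightarrow> ('o, 'm) products \<Rightarrow> 'm \<Rightarrow> 'm \<Rightarrow> 'm" where
  "pair C P f g = (THE u. u \<in> hom C (Dom C f) (Prod P (Cod C f) (Cod C g)) \<and>
     Pr1 P (Cod C f) (Cod C g) \<cdot>\<^bsub>C\<^esub> u = f \<and> Pr2 P (Cod C f) (Cod C g) \<cdot>\<^bsub>C\<^esub> u = g)"

definition prod_map :: "('o, 'm) category \<Rightarrow> ('o, 'm) products \<Rightarrow> 'm \<Rightarrow> 'm \<Rightarrow> 'm" where
  "prod_map C P f g = pair C P
     (f \<cdot>\<^bsub>C\<^esub> Pr1 P (Dom C f) (Dom C g)) (g \<cdot>\<^bsub>C\<^esub> Pr2 P (Dom C f) (Dom C g))"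


section \<open>Boolean toposes\<close>

definition cartesian_closed :: "('o, 'm) category \<Rightarrow> bool" where
  "cartesian_closed C \<longleftrightarrow> (\<exists>P. finite_products C P \<and>
     (\<forall>A\<in>Obj C. \<forall>B\<in>Obj C. \<exists>V\<in>Obj C. \<exists>ev\<in>hom C (Prod P V A) B.
        \<forall>Z\<in>Obj C. \<forall>f\<in>hom C (Prod P Z A) B.
          \<exists>!g. g \<in> hom C Z V \<and> ev \<cdot>\<^bsub>C\<^esub> prod_map C P g (Idn C A) = f))"

text \<open>\<open>classifies C T tr c m\<close>: the arrow \<open>c\<close> is a characteristic morphism of the
  monomorphism \<open>m\<close>, where \<open>T\<close> is the terminal object from which \<open>tr\<close> starts.\<close>

definition classifies :: "('o, 'm) category \<Rightarrow> 'o \<Rightarrow> 'm \<Rightarrow> 'm \<Rightarrow> 'm \<Rightarrow> bool" where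
  "classifies C T tr c m \<longleftrightarrow> monic C m \<and> (\<exists>t\<in>hom C (Dom C m) T. is_pullback C c tr m t)"

definition subobject_classifier ::
  "('o, 'm) category \<Rightarrow> 'o \<Rightarrow> 'o \<Rightarrow> 'm \<Rightarrow> bool" where
  "subobject_classifier C T Om tr \<longleftrightarrow> terminal C T \<and> Om \<in> Obj C \<and> tr \<in> hom C T Om \<and>
     (\<forall>m. monic C m \<longrightarrow> (\<exists>!c. c \<in> hom C (Cod C m) Om \<and> classifies C T tr c m))"

definition char_morphism :: "('o, 'm) category \<Rightarrow> 'o \<Rightarrow> 'o \<Rightarrow> 'm \<Rightarrow> 'm \<Rightarrow> 'm" where
  "char_morphism C T Om tr m =
     (THE c. c \<in> hom C (Cod C m) Om \<and> classifies C T tr c m)"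

definition topos :: "('o, 'm) category \<Rightarrow> bool" where
  "topos C \<longleftrightarrow> category C \<and> has_finite_limits C \<and> cartesian_closed C \<and>
     (\<exists>T Om tr. subobject_classifier C T Om tr)"

definition subobjects :: "('o, 'm) category \<Rightarrow> 'o \<Rightarrow> 'm set" where
  "subobjects C X = {m. monic C m \<and> Cod C m = X}"

definition factors_through :: "('o, 'm) category \<Rightarrow> 'm \<Rightarrow> 'm \<Rightarrow> bool" where
  "factors_through C f m \<longleftrightarrow> (\<exists>u\<in>hom C (Dom C f) (Dom C m). f = m \<cdot>\<^bsub>C\<^esub> u)"

text \<open>\<open>m\<close> and \<open>n\<close> are complements in the lattice of subobjects of \<open>X\<close>, which is ordered by
  \<open>factors_through C\<close>: their meet is the least and their join the greatest subobject.\<close>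

definition complements :: "('o, 'm) category \<Rightarrow> 'o \<Rightarrow> 'm \<Rightarrow> 'm \<Rightarrow> bool" where
  "complements C X m n \<longleftrightarrow>
     (\<forall>a\<in>subobjects C X. factors_through C a m \<and> factors_through C a n \<longrightarrow>
        (\<forall>b\<in>subobjects C X. factors_through C a b)) \<and>
     (\<forall>a\<in>subobjects C X. factors_through C m a \<and> factors_through C n a \<longrightarrow>
        (\<forall>b\<in>subobjects C X. factors_through C b a))"

text \<open>The subobject lattices of a topos are Heyting algebras, hence they are Boolean algebras
  as soon as complements exist.\<close>

definition boolean :: "('o, 'm) category \<Rightarrow> bool" where
  "boolean C \<longleftrightarrow> (\<forall>X\<in>Obj C. \<forall>m\<in>subobjects C X. \<exists>n\<in>subobjects C X. complements C X m n)"


section \<open>Size\<close>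

text \<open>\<open>U\<close> is the collection of sets that are regarded as small, for instance a Grothendieck
  universe. Being closed under subsets is the only property of a universe that matters here.\<close>

definition subset_closed :: "'u set set \<Rightarrow> bool" where
  "subset_closed U \<longleftrightarrow> (\<forall>B\<in>U. \<forall>A. A \<subseteq> B \<longrightarrow> A \<in> U)"

definition small :: "'u set set \<Rightarrow> 'a set \<Rightarrow> bool" where
  "small U A \<longleftrightarrow> (\<exists>B\<in>U. A \<approx> B)"

definition locally_small :: "'u set set \<Rightarrow> ('o, 'm) category \<Rightarrow> bool" where
  "locally_small U C \<longleftrightarrow> (\<forall>X\<in>Obj C. \<forall>Y\<in>Obj C. small U (hom C X Y))"


section \<open>Local state classifiers\<close>

definition cocone ::
  "('i, 'k) category \<Rightarrow> ('o, 'm) category \<Rightarrow> ('i, 'k, 'o, 'm) cfunctor \<Rightarrow>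
   'o \<Rightarrow> ('i \<Rightarrow> 'm) \<Rightarrow> bool" where
  "cocone J C D X c \<longleftrightarrow> X \<in> Obj C \<and> (\<forall>j\<in>Obj J. c j \<in> hom C (fobj D j) X) \<and>
     (\<forall>i j a. a \<in> hom J i j \<longrightarrow> c j \<cdot>\<^bsub>C\<^esub> fmap D a = c i)"

definition colimit_cocone ::
  "('i, 'k) category \<Rightarrow> ('o, 'm) category \<Rightarrow> ('i, 'k, 'o, 'm) cfunctor \<Rightarrow>
   'o \<Rightarrow> ('i \<Rightarrow> 'm) \<Rightarrow> bool" where
  "colimit_cocone J C D X c \<longleftrightarrow> cocone J C D X c \<and>
     (\<forall>Y d. cocone J C D Y d \<longrightarrow>
        (\<exists>!u. u \<in> hom C X Y \<and> (\<forall>j\<in>Obj J. u \<cdot>\<^bsub>C\<^esub> c j = d j)))"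

definition mono_subcategory :: "('o, 'm) category \<Rightarrow> ('o, 'm) category" where
  "mono_subcategory C = C\<lparr>Arr := {m. monic C m}\<rparr>"

definition local_state_classifier :: "('o, 'm) category \<Rightarrow> 'o \<Rightarrow> ('o \<Rightarrow> 'm) \<Rightarrow> bool" where
  "local_state_classifier C Xi xi \<longleftrightarrow>
     colimit_cocone (mono_subcategory C) C \<lparr>fobj = (\<lambda>X. X), fmap = (\<lambda>m. m)\<rparr> Xi xi"


section \<open>Internal semilattices\<close>

definition internal_semilattice ::
  "('o, 'm) category \<Rightarrow> ('o, 'm) products \<Rightarrow> 'o \<Rightarrow> 'm \<Rightarrow> 'm \<Rightarrow> bool" where
  "internal_semilattice C P A t w \<longleftrightarrow>
     A \<in> Obj C \<and> t \<in> hom C (One P) A \<and> w \<in> hom C (Prod P A A) A \<and>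
     w \<cdot>\<^bsub>C\<^esub> pair C P (Idn C A) (t \<cdot>\<^bsub>C\<^esub> bang C P A) = Idn C A \<and>
     w \<cdot>\<^bsub>C\<^esub> pair C P (t \<cdot>\<^bsub>C\<^esub> bang C P A) (Idn C A) = Idn C A \<and>
     w \<cdot>\<^bsub>C\<^esub> prod_map C P w (Idn C A) =
       w \<cdot>\<^bsub>C\<^esub> prod_map C P (Idn C A) w \<cdot>\<^bsub>C\<^esub>
         pair C P (Pr1 P A A \<cdot>\<^bsub>C\<^esub> Pr1 P (Prod P A A) A)
           (pair C P (Pr2 P A A \<cdot>\<^bsub>C\<^esub> Pr1 P (Prod P A A) A) (Pr2 P (Prod P A A) A)) \<and>
     w \<cdot>\<^bsub>C\<^esub> pair C P (Pr2 P A A) (Pr1 P A A) = w \<and>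
     w \<cdot>\<^bsub>C\<^esub> pair C P (Idn C A) (Idn C A) = Idn C A"

definition semilattice_hom ::
  "('o, 'm) category \<Rightarrow> ('o, 'm) products \<Rightarrow>
   'o \<Rightarrow> 'm \<Rightarrow> 'm \<Rightarrow> 'o \<Rightarrow> 'm \<Rightarrow> 'm \<Rightarrow> 'm \<Rightarrow> bool" where
  "semilattice_hom C P A t w A' t' w' h \<longleftrightarrow>
     internal_semilattice C P A t w \<and> internal_semilattice C P A' t' w' \<and>
     h \<in> hom C A A' \<and> h \<cdot>\<^bsub>C\<^esub> t = t' \<and> h \<cdot>\<^bsub>C\<^esub> w = w' \<cdot>\<^bsub>C\<^esub> prod_map C P h h"

definition lsc_meet ::
  "('o, 'm) category \<Rightarrow> ('o, 'm) products \<Rightarrow> 'o \<Rightarrow> ('o \<Rightarrow> 'm) \<Rightarrow> 'm" where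
  "lsc_meet C P Xi xi = (THE w. w \<in> hom C (Prod P Xi Xi) Xi \<and>
     (\<forall>X\<in>Obj C. \<forall>Y\<in>Obj C. w \<cdot>\<^bsub>C\<^esub> prod_map C P (xi X) (xi Y) = xi (Prod P X Y)))"

definition omega_meet ::
  "('o, 'm) category \<Rightarrow> ('o, 'm) products \<Rightarrow> 'o \<Rightarrow> 'm \<Rightarrow> 'm" where
  "omega_meet C P Om tr = char_morphism C (One P) Om tr (prod_map C P tr tr)"

definition lsc_homs ::
  "('o, 'm) category \<Rightarrow> ('o, 'm) products \<Rightarrow> 'o \<Rightarrow> 'm \<Rightarrow> 'o \<Rightarrow> ('o \<Rightarrow> 'm) \<Rightarrow> 'm set" where
  "lsc_homs C P Om tr Xi xi = {h.
     semilattice_hom C P Xi (xi (One P)) (lsc_meet C P Xi xi) Om tr (omega_meet C P Om tr) h}"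


section \<open>Quotients\<close>

text \<open>A geometric morphism from a given topos, together with its codomain.\<close>

record ('o, 'm, 'p, 'n) geometric =
  target :: "('p, 'n) category"
  inverse_image :: "('p, 'n, 'o, 'm) cfunctor"
  direct_image :: "('o, 'm, 'p, 'n) cfunctor"

definition geometric_morphism ::
  "('o, 'm) category \<Rightarrow> ('o, 'm, 'p, 'n) geometric \<Rightarrow> bool" where
  "geometric_morphism C f \<longleftrightarrow> topos (target f) \<and>
     left_adjoint (target f) C (inverse_image f) (direct_image f) \<and>
     preserves_finite_limits (target f) C (inverse_image f)"

definition is_quotient :: "('o, 'm) category \<Rightarrow> ('o, 'm, 'p, 'n) geometric \<Rightarrow> bool" where
  "is_quotient C f \<longleftrightarrow>
     geometric_morphism C f \<and> fully_faithful (target f) C (inverse_image f)"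

definition quotient_image :: "('o, 'm) category \<Rightarrow> ('o, 'm, 'p, 'n) geometric \<Rightarrow> 'o set" where
  "quotient_image C f = essential_image (target f) C (inverse_image f)"

text \<open>The codomains of the quotients forming the classes below live on the same types as
  \<open>C\<close> itself. This loses no quotient up to identification, since the codomain of a connected
  geometric morphism is equivalent to the full subcategory of \<open>C\<close> on the essential image.\<close>

definition same_quotient ::
  "('o, 'm) category \<Rightarrow>
   (('o, 'm, 'o, 'm) geometric \<times> ('o, 'm, 'o, 'm) geometric) set" where
  "same_quotient C =
     {(f, g). is_quotient C f \<and> is_quotient C g \<and> quotient_image C f = quotient_image C g}"

definition quotients :: "('o, 'm) category \<Rightarrow> ('o, 'm, 'o, 'm) geometric set set" where
  "quotients C = {f. is_quotient C f} // same_quotient C"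

text \<open>The objects \<open>X\<close> such that \<open>xi X\<close> factors through the subobject of \<open>Xi\<close> classified by
  \<open>h\<close>.\<close>

definition classified_objects ::
  "('o, 'm) category \<Rightarrow> 'o \<Rightarrow> 'm \<Rightarrow> ('o \<Rightarrow> 'm) \<Rightarrow> 'm \<Rightarrow> 'o set" where
  "classified_objects C T tr xi h =
     {X \<in> Obj C. \<exists>k. classifies C T tr h k \<and> factors_through C (xi X) k}"

definition corresponding_quotient ::
  "('o, 'm) category \<Rightarrow> 'o \<Rightarrow> 'm \<Rightarrow> ('o \<Rightarrow> 'm) \<Rightarrow> 'm \<Rightarrow>
   ('o, 'm, 'o, 'm) geometric set" where
  "corresponding_quotient C T tr xi h =
     {f. is_quotient C f \<and> quotient_image C f = classified_objects C T tr xi h}"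

end

theory Submission imports Defs begin

text \<open>Both quotients and semilattice homomorphisms are encoded by the same kind of class of objects.
Call a class \<open>Q\<close> of objects hyperconnected if it contains the terminal object, is closed under
binary products and subobjects, and if every object \<open>X\<close> has a universal arrow \<open>r\<close> into it from an
object of \<open>Q\<close> (a coreflection). Then \<open>r\<close> is monic, because the kernel pair of \<open>r\<close> is a subobject of
a product of objects of \<open>Q\<close> and hence itself in \<open>Q\<close>, where \<open>r\<close> separates arrows. So \<open>r\<close> is the
largest subobject of \<open>X\<close> that lies in \<open>Q\<close>.

From homomorphisms to classes. For a homomorphism \<open>h: \<Xi> \<rightarrow> \<Omega>\<close> let \<open>Q\<close> consist of the \<open>X\<close> with
\<open>h \<cdot> \<xi>\<^sub>X = true\<close>. For \<open>g: Y \<rightarrow> X\<close> the graph of \<open>g\<close> is a monomorphism \<open>Y \<rightarrow> Y \<times> X\<close>, so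
\<open>\<xi>\<^sub>Y = \<xi>\<^sub>Y \<and> \<xi>\<^sub>X \<cdot> g\<close>; hence if \<open>Y\<close> is in \<open>Q\<close>, then \<open>h \<cdot> \<xi>\<^sub>X\<close> is true along \<open>g\<close>. Therefore the subobject of \<open>X\<close>
classified by \<open>h \<cdot> \<xi>\<^sub>X\<close> is the coreflection of \<open>X\<close>, and \<open>Q\<close> is hyperconnected
(\<open>hyperconnected_objects\<close>). In particular \<open>Q\<close> determines every \<open>h \<cdot> \<xi>\<^sub>X\<close> and so \<open>h\<close>.
Conversely, the characteristic morphisms of the coreflections of a hyperconnected class are
compatible with monomorphisms and so glue to an arrow \<open>\<Xi> \<rightarrow> \<Omega>\<close>, which is a homomorphism
(\<open>hyperconnected_class_has_hom\<close>).

From classes to quotients. The full subcategory on a hyperconnected class is a topos: limits are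
those of \<open>E\<close>, exponentials and the subobject classifier are the coreflections of those of \<open>E\<close>. Its
inclusion, with the coreflector as right adjoint, is a quotient with image \<open>Q\<close>
(\<open>quotient_is_quotient\<close>, \<open>quotient_image_eq\<close>).

From quotients to classes. The image of any connected inverse image functor is coreflective and
closed under finite limits (\<open>image_coreflection\<close>, \<open>image_limit\<close>). That it is closed under
subobjects is where Booleanness enters. In a Boolean topos \<open>\<Omega>\<close> is the coproduct \<open>1 + 1\<close> with
injections true and false (\<open>eq_by_cases\<close>, \<open>copairing\<close>). Both points lift to the coreflection of
\<open>\<Omega>\<close>, so their copairing splits the coreflection and \<open>\<Omega>\<close> belongs to the image; and a subobject of \<open>Y\<close> is
the equalizer of two arrows \<open>Y \<rightarrow> \<Omega>\<close> (\<open>hyperconnectedI\<close>).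

Smallness follows because the homomorphisms form a subset of the small set of arrows \<open>\<Xi> \<rightarrow> \<Omega>\<close>.\<close>

section \<open>Arrows and generalized elements\<close>

text \<open>Typing is handled by rewriting: membership in a hom-set splits into conditions on \<open>Arr\<close>, \<open>Dom\<close> and
\<open>Cod\<close>, which the simplifier discharges, and composites are normalized to right-nested form.\<close>

lemma mem_hom_iff [simp]: "f \<in> hom C X Y \<longleftrightarrow> f \<in> Arr C \<and> Dom C f = X \<and> Cod C f = Y"
  by (simp add: hom_def)

locale cat =
  fixes C :: "('o, 'm) category" (structure)
  assumes category: "category C"
begin

lemma dom_obj [simp]: "f \<in> Arr C \<Longrightarrow> Dom C f \<in> Obj C"
  and cod_obj [simp]: "f \<in> Arr C \<Longrightarrow> Cod C f \<in> Obj C"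
  using category unfolding category_def by auto

lemma idn_typing [simp]:
  assumes "X \<in> Obj C"
  shows "Idn C X \<in> Arr C" "Dom C (Idn C X) = X" "Cod C (Idn C X) = X"
  using category assms unfolding category_def by auto

lemma comp_typing [simp]:
  assumes "f \<in> Arr C" "g \<in> Arr C" "Dom C g = Cod C f"
  shows "g \<cdot> f \<in> Arr C" "Dom C (g \<cdot> f) = Dom C f" "Cod C (g \<cdot> f) = Cod C g"
proof -
  have "f \<in> hom C (Dom C f) (Cod C f)" "g \<in> hom C (Cod C f) (Cod C g)"
    using assms by auto
  then have "g \<cdot> f \<in> hom C (Dom C f) (Cod C g)"
    using category unfolding category_def by blast
  then show "g \<cdot> f \<in> Arr C" "Dom C (g \<cdot> f) = Dom C f" "Cod C (g \<cdot> f) = Cod C g"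
    by auto
qed

lemma comp_idn [simp]:
  shows "f \<in> Arr C \<Longrightarrow> Dom C f = X \<Longrightarrow> f \<cdot> Idn C X = f"
    and "f \<in> Arr C \<Longrightarrow> Cod C f = X \<Longrightarrow> Idn C X \<cdot> f = f"
  using category unfolding category_def by auto

lemma comp_assoc [simp]:
  assumes "f \<in> Arr C" "g \<in> Arr C" "h \<in> Arr C" "Dom C g = Cod C f" "Dom C h = Cod C g"
  shows "(h \<cdot> g) \<cdot> f = h \<cdot> (g \<cdot> f)"
proof -
  have "f \<in> hom C (Dom C f) (Cod C f)" "g \<in> hom C (Cod C f) (Cod C g)"
    "h \<in> hom C (Cod C g) (Cod C h)"
    using assms by auto
  then show ?thesis
    using category unfolding category_def by metis
qed

text \<open>In right-nested form \<open>r \<cdot> u\<close> is no longer a subterm of \<open>r \<cdot> (u \<cdot> v)\<close>, so an equation for \<open>r \<cdot> u\<close> has to be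
applied through associativity.\<close>

lemma comp_eq_extend:
  assumes "r \<cdot> u = g" "v \<in> Arr C" "u \<in> Arr C" "r \<in> Arr C" "Dom C u = Cod C v" "Dom C r = Cod C u"
  shows "r \<cdot> (u \<cdot> v) = g \<cdot> v"
  using assms by (metis comp_assoc)

lemma monic_arr [simp]: "monic C m \<Longrightarrow> m \<in> Arr C"
  by (simp add: monic_def)

lemma monicD:
  assumes "monic C m" "m \<cdot> f = m \<cdot> g" "f \<in> Arr C" "g \<in> Arr C"
    "Dom C f = Dom C g" "Cod C f = Dom C m" "Cod C g = Dom C m"
  shows "f = g"
  using assms unfolding monic_def by (auto simp del: comp_assoc)

lemma monicI:
  assumes "m \<in> Arr C"
    and "\<And>f g. f \<in> Arr C \<Longrightarrow> g \<in> Arr C \<Longrightarrow> Dom C f = Dom C g \<Longrightarrow> Cod C f = Dom C m \<Longrightarrow>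
      Cod C g = Dom C m \<Longrightarrow> m \<cdot> f = m \<cdot> g \<Longrightarrow> f = g"
  shows "monic C m"
  using assms unfolding monic_def by auto

lemma monic_idn: "X \<in> Obj C \<Longrightarrow> monic C (Idn C X)"
  by (rule monicI) auto

lemma monic_comp:
  assumes "monic C m" "monic C n" "Dom C n = Cod C m"
  shows "monic C (n \<cdot> m)"
proof (rule monicI)
  show "n \<cdot> m \<in> Arr C" using assms by simp
  fix f g
  assume *: "f \<in> Arr C" "g \<in> Arr C" "Dom C f = Dom C g" "Cod C f = Dom C (n \<cdot> m)"
    "Cod C g = Dom C (n \<cdot> m)" "(n \<cdot> m) \<cdot> f = (n \<cdot> m) \<cdot> g"
  then have "n \<cdot> (m \<cdot> f) = n \<cdot> (m \<cdot> g)" using assms by simp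
  then have "m \<cdot> f = m \<cdot> g"
    using * assms by - (rule monicD[of n], auto)
  then show "f = g"
    using * assms by - (rule monicD[of m], auto)
qed

lemma monic_cancel:
  assumes "monic C (n \<cdot> m)" "m \<in> Arr C" "n \<in> Arr C" "Dom C n = Cod C m"
  shows "monic C m"
proof (rule monicI)
  fix f g
  assume *: "f \<in> Arr C" "g \<in> Arr C" "Dom C f = Dom C g" "Cod C f = Dom C m"
    "Cod C g = Dom C m" "m \<cdot> f = m \<cdot> g"
  then have "(n \<cdot> m) \<cdot> f = (n \<cdot> m) \<cdot> g" using assms by simp
  then show "f = g"
    by (rule monicD[OF assms(1)]) (use * assms in auto)
qed (use assms in auto)

lemma monic_split:
  assumes "n \<cdot> m = Idn C (Dom C m)" "m \<in> Arr C" "n \<in> Arr C" "Dom C n = Cod C m"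
  shows "monic C m"
  by (rule monic_cancel[of n]) (use assms monic_idn in auto)

lemma factors_throughI:
  "m \<cdot> u = f \<Longrightarrow> m \<in> Arr C \<Longrightarrow> u \<in> Arr C \<Longrightarrow> Cod C u = Dom C m \<Longrightarrow> factors_through C f m"
  unfolding factors_through_def by auto

lemma factors_throughE:
  assumes "factors_through C f m"
  obtains u where "u \<in> Arr C" "Dom C u = Dom C f" "Cod C u = Dom C m" "m \<cdot> u = f"
  using assms unfolding factors_through_def by auto

lemma factors_through_self: "m \<in> Arr C \<Longrightarrow> factors_through C m m"
  by (rule factors_throughI[of m "Idn C (Dom C m)"]) auto

lemma factors_through_comp:
  assumes "factors_through C f m" "m \<in> Arr C" "u \<in> Arr C" "Cod C u = Dom C f"
  shows "factors_through C (f \<cdot> u) m"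
  using assms(1)
proof (rule factors_throughE)
  fix v assume "v \<in> Arr C" "Dom C v = Dom C f" "Cod C v = Dom C m" "m \<cdot> v = f"
  then show ?thesis
    using assms by (intro factors_throughI[of m "v \<cdot> u"]) auto
qed

lemma factors_through_trans:
  assumes "factors_through C f m" "factors_through C m n" "m \<in> Arr C" "n \<in> Arr C"
  shows "factors_through C f n"
proof -
  obtain u where "u \<in> Arr C" "Cod C u = Dom C m" "m \<cdot> u = f"
    using assms(1) by (rule factors_throughE)
  then show ?thesis using factors_through_comp[OF assms(2,4), of u] by simp
qed

text \<open>Since the terminal leg of the pullback square carries no information, the square says only which
generalized elements \<open>v\<close> of the codomain are sent to true: those that factor through \<open>m\<close>.\<close>

lemma classifies_iff:
  assumes T: "terminal C T" and tr: "tr \<in> hom C T Om"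
  shows "classifies C T tr c m \<longleftrightarrow> monic C m \<and> c \<in> hom C (Cod C m) Om \<and>
    (\<forall>v\<in>Arr C. Cod C v = Cod C m \<longrightarrow>
       (\<exists>t\<in>hom C (Dom C v) T. c \<cdot> v = tr \<cdot> t) \<longleftrightarrow> factors_through C v m)"
    (is "_ \<longleftrightarrow> ?R")
proof
  assume "classifies C T tr c m"
  then obtain t where m: "monic C m" and t: "t \<in> hom C (Dom C m) T"
    and pb: "is_pullback C c tr m t"
    unfolding classifies_def by blast
  have pb': "c \<in> Arr C" "Cod C c = Cod C tr" "Cod C m = Dom C c" "c \<cdot> m = tr \<cdot> t"
    and univ: "\<forall>Z. \<forall>x\<in>hom C Z (Dom C c). \<forall>y\<in>hom C Z (Dom C tr). c \<cdot> x = tr \<cdot> y \<longrightarrow>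
      (\<exists>!u. u \<in> hom C Z (Dom C m) \<and> m \<cdot> u = x \<and> t \<cdot> u = y)"
    using pb unfolding is_pullback_def by blast+
  have c: "c \<in> Arr C" "Cod C c = Om" "Dom C c = Cod C m" "c \<cdot> m = tr \<cdot> t"
    using pb' tr by auto
  have "(\<exists>t\<in>hom C (Dom C v) T. c \<cdot> v = tr \<cdot> t) \<longleftrightarrow> factors_through C v m"
    if v: "v \<in> Arr C" "Cod C v = Cod C m" for v
  proof
    assume "\<exists>t\<in>hom C (Dom C v) T. c \<cdot> v = tr \<cdot> t"
    then obtain y where y: "y \<in> hom C (Dom C v) T" "c \<cdot> v = tr \<cdot> y" by blast
    have "v \<in> hom C (Dom C v) (Dom C c)" "y \<in> hom C (Dom C v) (Dom C tr)"
      using v y c tr by auto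
    then have "\<exists>!u. u \<in> hom C (Dom C v) (Dom C m) \<and> m \<cdot> u = v \<and> t \<cdot> u = y"
      using univ y(2) by blast
    then show "factors_through C v m"
      unfolding factors_through_def by blast
  next
    assume "factors_through C v m"
    then obtain u where u: "u \<in> Arr C" "Dom C u = Dom C v" "Cod C u = Dom C m" "m \<cdot> u = v"
      by (rule factors_throughE)
    have "c \<cdot> v = tr \<cdot> (t \<cdot> u)"
      using u(1,3) c t tr m comp_eq_extend[OF c(4), of u] by (simp add: u(4))
    then show "\<exists>t\<in>hom C (Dom C v) T. c \<cdot> v = tr \<cdot> t"
      using u t by (intro bexI[of _ "t \<cdot> u"]) auto
  qed
  then show ?R using m c by simp
next
  assume R: ?R
  then have m: "monic C m" and c: "c \<in> Arr C" "Dom C c = Cod C m" "Cod C c = Om" by auto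
  from R m factors_through_self[of m] obtain t where t: "t \<in> hom C (Dom C m) T" "c \<cdot> m = tr \<cdot> t"
    by (metis monic_arr)
  have "is_pullback C c tr m t"
    unfolding is_pullback_def
  proof (intro conjI allI ballI impI)
    fix Z x y
    assume x: "x \<in> hom C Z (Dom C c)" and y: "y \<in> hom C Z (Dom C tr)" and eq: "c \<cdot> x = tr \<cdot> y"
    have "y \<in> hom C (Dom C x) T" using x y tr by auto
    moreover have "x \<in> Arr C" "Cod C x = Cod C m" using x c by auto
    ultimately have "factors_through C x m" using R eq by blast
    then obtain u where u: "u \<in> Arr C" "Dom C u = Dom C x" "Cod C u = Dom C m" "m \<cdot> u = x"
      by (rule factors_throughE)
    have "t \<cdot> u = y"
    proof -
      have "Z \<in> Obj C" using x by auto
      then show ?thesis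
        using T t u x y tr unfolding terminal_def mem_hom_iff by (metis comp_typing)
    qed
    then show "\<exists>!u. u \<in> hom C Z (Dom C m) \<and> m \<cdot> u = x \<and> t \<cdot> u = y"
      using u x m by (intro ex1I[of _ u]) (auto dest: monicD[of m])
  qed (use m c t tr in auto)
  then show "classifies C T tr c m"
    using m t unfolding classifies_def by blast
qed

end

section \<open>Finite products\<close>

locale finprod = cat +
  fixes P :: "('o, 'm) products"
  assumes fin_prod: "finite_products C P"
begin

lemma terminal_One: "terminal C (One P)"
  using fin_prod unfolding finite_products_def by blast

lemma One_obj [simp]: "One P \<in> Obj C"
  using terminal_One unfolding terminal_def by blast

lemma bang_typing [simp]:
  assumes "X \<in> Obj C"
  shows "bang C P X \<in> Arr C" "Dom C (bang C P X) = X" "Cod C (bang C P X) = One P"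
proof -
  have "\<exists>!f. f \<in> hom C X (One P)"
    using terminal_One assms unfolding terminal_def by blast
  from theI'[OF this]
  show "bang C P X \<in> Arr C" "Dom C (bang C P X) = X" "Cod C (bang C P X) = One P"
    unfolding bang_def by auto
qed

lemma to_One_eq:
  assumes "f \<in> Arr C" "g \<in> Arr C" "Cod C f = One P" "Cod C g = One P" "Dom C f = Dom C g"
  shows "f = g"
proof -
  have "\<exists>!k. k \<in> hom C (Dom C f) (One P)"
    using terminal_One assms unfolding terminal_def by auto
  then show ?thesis using assms by auto
qed

lemma bang_comp [simp]: "u \<in> Arr C \<Longrightarrow> Cod C u = X \<Longrightarrow> bang C P X \<cdot> u = bang C P (Dom C u)"
  by (rule to_One_eq) auto

lemma bang_One [simp]: "bang C P (One P) = Idn C (One P)"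
  by (rule to_One_eq) auto

lemma product:
  "X \<in> Obj C \<Longrightarrow> Y \<in> Obj C \<Longrightarrow> is_product C X Y (Prod P X Y) (Pr1 P X Y) (Pr2 P X Y)"
  using fin_prod unfolding finite_products_def by blast

lemma Pr_typing [simp]:
  assumes "X \<in> Obj C" "Y \<in> Obj C"
  shows "Pr1 P X Y \<in> Arr C" "Dom C (Pr1 P X Y) = Prod P X Y" "Cod C (Pr1 P X Y) = X"
    "Pr2 P X Y \<in> Arr C" "Dom C (Pr2 P X Y) = Prod P X Y" "Cod C (Pr2 P X Y) = Y"
  using product[OF assms] unfolding is_product_def by auto

lemma Prod_obj [simp]: "X \<in> Obj C \<Longrightarrow> Y \<in> Obj C \<Longrightarrow> Prod P X Y \<in> Obj C"
  using Pr_typing dom_obj by metis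

lemma pair_ex1:
  assumes "f \<in> Arr C" "g \<in> Arr C" "Dom C g = Dom C f"
  shows "\<exists>!u. u \<in> hom C (Dom C f) (Prod P (Cod C f) (Cod C g)) \<and>
     Pr1 P (Cod C f) (Cod C g) \<cdot> u = f \<and> Pr2 P (Cod C f) (Cod C g) \<cdot> u = g"
  using product[of "Cod C f" "Cod C g"] assms unfolding is_product_def by (auto 0 3)

lemma pair_typing [simp]:
  assumes "f \<in> Arr C" "g \<in> Arr C" "Dom C g = Dom C f"
  shows "pair C P f g \<in> Arr C" "Dom C (pair C P f g) = Dom C f"
    "Cod C (pair C P f g) = Prod P (Cod C f) (Cod C g)"
  using theI'[OF pair_ex1[OF assms]] unfolding pair_def by auto

lemma Pr_pair [simp]:
  assumes "f \<in> Arr C" "g \<in> Arr C" "Dom C g = Dom C f" "Cod C f = X" "Cod C g = Y"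
  shows "Pr1 P X Y \<cdot> pair C P f g = f" "Pr2 P X Y \<cdot> pair C P f g = g"
  using theI'[OF pair_ex1[OF assms(1-3)]] assms(4,5) unfolding pair_def by auto

lemma pair_eqI:
  assumes "u \<in> Arr C" "v \<in> Arr C" "Dom C u = Dom C v" "Cod C u = Prod P X Y" "Cod C v = Prod P X Y"
    "X \<in> Obj C" "Y \<in> Obj C"
    "Pr1 P X Y \<cdot> u = Pr1 P X Y \<cdot> v" "Pr2 P X Y \<cdot> u = Pr2 P X Y \<cdot> v"
  shows "u = v"
proof -
  have "\<exists>!w. w \<in> hom C (Dom C u) (Prod P X Y) \<and> Pr1 P X Y \<cdot> w = Pr1 P X Y \<cdot> u \<and>
      Pr2 P X Y \<cdot> w = Pr2 P X Y \<cdot> u"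
    using pair_ex1[of "Pr1 P X Y \<cdot> u" "Pr2 P X Y \<cdot> u"] assms by simp
  then show ?thesis using assms by (metis mem_hom_iff)
qed

lemma pair_comp [simp]:
  assumes "f \<in> Arr C" "g \<in> Arr C" "Dom C g = Dom C f" "u \<in> Arr C" "Cod C u = Dom C f"
  shows "pair C P f g \<cdot> u = pair C P (f \<cdot> u) (g \<cdot> u)"
proof -
  have "Pr1 P (Cod C f) (Cod C g) \<cdot> (pair C P f g \<cdot> u) = f \<cdot> u"
    "Pr2 P (Cod C f) (Cod C g) \<cdot> (pair C P f g \<cdot> u) = g \<cdot> u"
    using assms comp_eq_extend[of "Pr1 P (Cod C f) (Cod C g)" "pair C P f g" f u]
      comp_eq_extend[of "Pr2 P (Cod C f) (Cod C g)" "pair C P f g" g u]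
    by auto
  then show ?thesis
    using assms by - (rule pair_eqI[of _ _ "Cod C f" "Cod C g"], auto)
qed

lemma pair_Pr [simp]:
  assumes "u \<in> Arr C" "Cod C u = Prod P X Y" "X \<in> Obj C" "Y \<in> Obj C"
  shows "pair C P (Pr1 P X Y \<cdot> u) (Pr2 P X Y \<cdot> u) = u"
  using assms by - (rule pair_eqI[of _ _ X Y], auto)

lemma pair_Pr_idn [simp]:
  assumes "X \<in> Obj C" "Y \<in> Obj C"
  shows "pair C P (Pr1 P X Y) (Pr2 P X Y) = Idn C (Prod P X Y)"
  using assms by - (rule pair_eqI[of _ _ X Y], auto)

lemma pair_inject:
  assumes "pair C P a b = pair C P c d" "a \<in> Arr C" "b \<in> Arr C" "c \<in> Arr C" "d \<in> Arr C"
    "Dom C b = Dom C a" "Dom C d = Dom C c" "Cod C a = Cod C c" "Cod C b = Cod C d"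
  shows "a = c" "b = d"
  using assms by (metis Pr_pair(1), metis Pr_pair(2))

text \<open>For an identity \<open>f\<close> this is the graph of \<open>g\<close>.\<close>

lemma monic_pair1:
  assumes "monic C f" "g \<in> Arr C" "Dom C g = Dom C f"
  shows "monic C (pair C P f g)"
  by (rule monic_cancel[of "Pr1 P (Cod C f) (Cod C g)"]) (use assms in auto)

lemma monic_prod:
  assumes "monic C m" "monic C n"
  shows "monic C (pair C P (m \<cdot> Pr1 P (Dom C m) (Dom C n)) (n \<cdot> Pr2 P (Dom C m) (Dom C n)))"
    (is "monic C ?mn")
proof (rule monicI)
  have mn: "m \<in> Arr C" "n \<in> Arr C" using assms by auto
  show "?mn \<in> Arr C" using mn by simp
  fix f g
  assume *: "f \<in> Arr C" "g \<in> Arr C" "Dom C f = Dom C g" "Cod C f = Dom C ?mn"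
    "Cod C g = Dom C ?mn" "?mn \<cdot> f = ?mn \<cdot> g"
  let ?p = "Pr1 P (Dom C m) (Dom C n)" and ?q = "Pr2 P (Dom C m) (Dom C n)"
  have fg: "Cod C f = Prod P (Dom C m) (Dom C n)" "Cod C g = Prod P (Dom C m) (Dom C n)"
    using * mn by auto
  have eq: "pair C P (m \<cdot> (?p \<cdot> f)) (n \<cdot> (?q \<cdot> f)) = pair C P (m \<cdot> (?p \<cdot> g)) (n \<cdot> (?q \<cdot> g))"
    using * fg mn by simp
  have "m \<cdot> (?p \<cdot> f) = m \<cdot> (?p \<cdot> g)" "n \<cdot> (?q \<cdot> f) = n \<cdot> (?q \<cdot> g)"
    using pair_inject[OF eq] * fg mn by auto
  then have "?p \<cdot> f = ?p \<cdot> g" "?q \<cdot> f = ?q \<cdot> g"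
    using * fg mn monicD[OF assms(1), of "?p \<cdot> f" "?p \<cdot> g"]
      monicD[OF assms(2), of "?q \<cdot> f" "?q \<cdot> g"] by auto
  then show "f = g" using * fg mn by - (rule pair_eqI[of f g "Dom C m" "Dom C n"], auto)
qed

end

section \<open>The subobject classifier and exponentials\<close>

locale topos_cat = finprod E P for E :: "('o, 'm) category" (structure) and P +
  fixes Om :: 'o and tr :: 'm
  assumes topos: "topos E"
    and classifier: "subobject_classifier E (One P) Om tr"
begin

lemma Om_obj [simp]: "Om \<in> Obj E"
  and tr_typing [simp]: "tr \<in> Arr E" "Dom E tr = One P" "Cod E tr = Om"
  using classifier unfolding subobject_classifier_def by auto

text \<open>Truth at stage \<open>X\<close>. Statements about arrows into \<open>\<Omega>\<close> are proved by asking at which generalized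
elements they become true.\<close>

definition true_at :: "'o \<Rightarrow> 'm" where
  "true_at X = tr \<cdot> bang E P X"

lemma true_at_typing [simp]:
  assumes "X \<in> Obj E"
  shows "true_at X \<in> Arr E" "Dom E (true_at X) = X" "Cod E (true_at X) = Om"
  using assms unfolding true_at_def by auto

lemma true_at_comp [simp]: "u \<in> Arr E \<Longrightarrow> Cod E u = X \<Longrightarrow> true_at X \<cdot> u = true_at (Dom E u)"
  unfolding true_at_def by (auto simp: cod_obj)

lemma true_at_One: "true_at (One P) = tr"
  unfolding true_at_def by simp

lemma tr_comp: "t \<in> Arr E \<Longrightarrow> Cod E t = One P \<Longrightarrow> tr \<cdot> t = true_at (Dom E t)"
  using to_One_eq[of t "bang E P (Dom E t)"] unfolding true_at_def by simp

lemma classifies_true_iff: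
  "classifies E (One P) tr c m \<longleftrightarrow> monic E m \<and> c \<in> hom E (Cod E m) Om \<and>
    (\<forall>v\<in>Arr E. Cod E v = Cod E m \<longrightarrow> c \<cdot> v = true_at (Dom E v) \<longleftrightarrow> factors_through E v m)"
proof -
  have "(\<exists>t\<in>hom E (Dom E v) (One P). c \<cdot> v = tr \<cdot> t) \<longleftrightarrow> c \<cdot> v = true_at (Dom E v)"
    if "v \<in> Arr E" for v
  proof
    assume "\<exists>t\<in>hom E (Dom E v) (One P). c \<cdot> v = tr \<cdot> t"
    then show "c \<cdot> v = true_at (Dom E v)" using tr_comp by auto
  next
    assume "c \<cdot> v = true_at (Dom E v)"
    then show "\<exists>t\<in>hom E (Dom E v) (One P). c \<cdot> v = tr \<cdot> t"
      using that by (intro bexI[of _ "bang E P (Dom E v)"]) (auto simp: true_at_def)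
  qed
  then show ?thesis
    using classifies_iff[OF terminal_One, of tr Om c m] by auto
qed

lemma classifiesD:
  assumes "classifies E (One P) tr c m"
  shows "monic E m" "c \<in> Arr E" "Cod E c = Om" "Dom E c = Cod E m"
    and "v \<in> Arr E \<Longrightarrow> Cod E v = Dom E c \<Longrightarrow> c \<cdot> v = true_at (Dom E v) \<longleftrightarrow> factors_through E v m"
  using assms unfolding classifies_true_iff by auto

text \<open>The equalizer is the vertex over \<open>0\<close> of the limit of the diagram of two parallel edges from \<open>0\<close> to \<open>1\<close>.\<close>

lemma equalizer_exists:
  assumes f: "f \<in> Arr E" and g: "g \<in> Arr E" "Dom E g = Dom E f" "Cod E g = Cod E f"
  obtains e where "monic E e" "Cod E e = Dom E f" "f \<cdot> e = g \<cdot> e"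
    "\<And>v. v \<in> Arr E \<Longrightarrow> Cod E v = Dom E f \<Longrightarrow> f \<cdot> v = g \<cdot> v \<Longrightarrow> factors_through E v e"
proof -
  let ?D = "\<lambda>i::nat. if i = 0 then Dom E f else Cod E f"
  let ?K = "{(0::nat, f, 1::nat), (0, g, 1)}"
  have "finite_diagram E {0, 1} ?D ?K"
    using f g unfolding finite_diagram_def by auto
  then obtain X p where lim: "limit_cone E {0, 1} ?D ?K X p"
    using topos unfolding topos_def has_finite_limits_def by blast
  then have cone: "cone E {0, 1} ?D ?K X p"
    and univ: "\<And>Y q. cone E {0, 1} ?D ?K Y q \<Longrightarrow>
      \<exists>!u. u \<in> hom E Y X \<and> (\<forall>i\<in>{0, 1}. p i \<cdot> u = q i)"
    unfolding limit_cone_def by blast+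
  have p: "p 0 \<in> Arr E" "Dom E (p 0) = X" "Cod E (p 0) = Dom E f"
    "f \<cdot> p 0 = p 1" "g \<cdot> p 0 = p 1" "p 1 \<in> Arr E" "Dom E (p 1) = X" "X \<in> Obj E"
    using cone unfolding cone_def by auto
  have ex: "\<exists>!u. u \<in> hom E (Dom E v) X \<and> p 0 \<cdot> u = v"
    if v: "v \<in> Arr E" "Cod E v = Dom E f" "f \<cdot> v = g \<cdot> v" for v
  proof -
    let ?q = "\<lambda>i::nat. if i = 0 then v else f \<cdot> v"
    have "cone E {0, 1} ?D ?K (Dom E v) ?q"
      using v f g unfolding cone_def by auto
    from univ[OF this] obtain u where u: "u \<in> hom E (Dom E v) X" "p 0 \<cdot> u = v"
      and uniq: "\<And>w. w \<in> hom E (Dom E v) X \<and> p 0 \<cdot> w = v \<and> p 1 \<cdot> w = f \<cdot> v \<Longrightarrow> w = u"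
      by auto
    have "w = u" if w: "w \<in> hom E (Dom E v) X" "p 0 \<cdot> w = v" for w
    proof -
      have "f \<cdot> (p 0 \<cdot> w) = p 1 \<cdot> w"
        using w p f by (intro comp_eq_extend[OF p(4)]) auto
      then show ?thesis using uniq[of w] w by simp
    qed
    then show ?thesis using u by blast
  qed
  have "monic E (p 0)"
  proof (rule monicI)
    fix a b
    assume *: "a \<in> Arr E" "b \<in> Arr E" "Dom E a = Dom E b" "Cod E a = Dom E (p 0)"
      "Cod E b = Dom E (p 0)" "p 0 \<cdot> a = p 0 \<cdot> b"
    have "f \<cdot> (p 0 \<cdot> a) = p 1 \<cdot> a"
      by (rule comp_eq_extend[OF p(4)]) (use * p f in auto)
    moreover have "g \<cdot> (p 0 \<cdot> a) = p 1 \<cdot> a"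
      by (rule comp_eq_extend[OF p(5)]) (use * p g in auto)
    ultimately have "\<exists>!u. u \<in> hom E (Dom E (p 0 \<cdot> a)) X \<and> p 0 \<cdot> u = p 0 \<cdot> a"
      using * p by (intro ex) auto
    then show "a = b" using * p by auto
  qed (use p in auto)
  moreover have "factors_through E v (p 0)"
    if "v \<in> Arr E" "Cod E v = Dom E f" "f \<cdot> v = g \<cdot> v" for v
    using ex[OF that] p unfolding factors_through_def by metis
  ultimately show ?thesis
    using that[of "p 0"] p by auto
qed

text \<open>The subobject \<open>{x. c x}\<close>: the equalizer of \<open>c\<close> and truth.\<close>

lemma comprehension:
  assumes "c \<in> Arr E" "Cod E c = Om"
  obtains m where "monic E m" "Cod E m = Dom E c" "classifies E (One P) tr c m"
proof -
  obtain m where m: "monic E m" "Cod E m = Dom E c" "c \<cdot> m = true_at (Dom E c) \<cdot> m"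
    and fac: "\<And>v. v \<in> Arr E \<Longrightarrow> Cod E v = Dom E c \<Longrightarrow> c \<cdot> v = true_at (Dom E c) \<cdot> v \<Longrightarrow>
      factors_through E v m"
    by (rule equalizer_exists[of c "true_at (Dom E c)"]) (use assms in auto)
  have "c \<cdot> v = true_at (Dom E v)"
    if v: "v \<in> Arr E" "Cod E v = Dom E c" "factors_through E v m" for v
    using v(3)
  proof (rule factors_throughE)
    fix u assume u: "u \<in> Arr E" "Dom E u = Dom E v" "Cod E u = Dom E m" "m \<cdot> u = v"
    have "c \<cdot> (m \<cdot> u) = (true_at (Dom E c) \<cdot> m) \<cdot> u"
      using u m assms by (intro comp_eq_extend) auto
    also have "\<dots> = true_at (Dom E u)" using u(1,3) m assms by simp
    finally show ?thesis using u by simp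
  qed
  then have "classifies E (One P) tr c m"
    unfolding classifies_true_iff using m fac assms by auto
  then show ?thesis using that m by blast
qed

lemma char_classifies:
  assumes "monic E m"
  shows "char_morphism E (One P) Om tr m \<in> hom E (Cod E m) Om"
    and "classifies E (One P) tr (char_morphism E (One P) Om tr m) m"
proof -
  have "\<exists>!c. c \<in> hom E (Cod E m) Om \<and> classifies E (One P) tr c m"
    using classifier assms unfolding subobject_classifier_def by blast
  from theI'[OF this]
  show "char_morphism E (One P) Om tr m \<in> hom E (Cod E m) Om"
    and "classifies E (One P) tr (char_morphism E (One P) Om tr m) m"
    unfolding char_morphism_def by auto
qed

text \<open>If \<open>a\<close> and \<open>b\<close> are true at the same generalized elements, they classify the same subobject, and a
subobject has only one characteristic morphism.\<close>

lemma omega_ext: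
  assumes "a \<in> Arr E" "b \<in> Arr E" "Cod E a = Om" "Cod E b = Om" "Dom E b = Dom E a"
    and iff: "\<And>v. v \<in> Arr E \<Longrightarrow> Cod E v = Dom E a \<Longrightarrow>
      a \<cdot> v = true_at (Dom E v) \<longleftrightarrow> b \<cdot> v = true_at (Dom E v)"
  shows "a = b"
proof -
  obtain m where m: "monic E m" "Cod E m = Dom E a" "classifies E (One P) tr a m"
    using comprehension assms by blast
  then have "classifies E (One P) tr b m"
    using iff assms unfolding classifies_true_iff by auto
  moreover have "\<exists>!c. c \<in> hom E (Cod E m) Om \<and> classifies E (One P) tr c m"
    using classifier m unfolding subobject_classifier_def by blast
  ultimately show ?thesis using m assms by auto
qed

abbreviation chi :: "'m \<Rightarrow> 'm" where
  "chi \<equiv> char_morphism E (One P) Om tr"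

lemma chi_typing [simp]:
  assumes "monic E m"
  shows "chi m \<in> Arr E" "Dom E (chi m) = Cod E m" "Cod E (chi m) = Om"
  using char_classifies[OF assms] by auto

lemma chi_true_iff:
  "monic E m \<Longrightarrow> v \<in> Arr E \<Longrightarrow> Cod E v = Cod E m \<Longrightarrow>
    chi m \<cdot> v = true_at (Dom E v) \<longleftrightarrow> factors_through E v m"
  using char_classifies[of m] unfolding classifies_true_iff by blast

lemma chi_self: "monic E m \<Longrightarrow> chi m \<cdot> m = true_at (Dom E m)"
  by (simp add: chi_true_iff factors_through_self)

abbreviation meet :: 'm where
  "meet \<equiv> omega_meet E P Om tr"

lemma tr_monic: "monic E tr"
  by (rule monicI) (auto intro: to_One_eq)

text \<open>The arrow \<open>true \<times> true\<close> is a point of \<open>\<Omega> \<times> \<Omega>\<close> up to isomorphism, so an element factors through it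
exactly when both of its components are true.\<close>

lemma meet_typing [simp]:
  "meet \<in> Arr E" "Dom E meet = Prod P Om Om" "Cod E meet = Om"
  and meet_true_iff [simp]: "v \<in> Arr E \<Longrightarrow> Cod E v = Prod P Om Om \<Longrightarrow> Dom E v = W \<Longrightarrow>
    meet \<cdot> v = true_at W \<longleftrightarrow> Pr1 P Om Om \<cdot> v = true_at W \<and> Pr2 P Om Om \<cdot> v = true_at W"
proof -
  let ?tt = "prod_map E P tr tr"
  have tt: "?tt = pair E P (tr \<cdot> Pr1 P (One P) (One P)) (tr \<cdot> Pr2 P (One P) (One P))"
    by (simp add: prod_map_def)
  have mono: "monic E ?tt"
    using monic_prod[OF tr_monic tr_monic] tt by simp
  have dc: "Dom E ?tt = Prod P (One P) (One P)" "Cod E ?tt = Prod P Om Om" "?tt \<in> Arr E"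
    using tt by auto
  show "meet \<in> Arr E" "Dom E meet = Prod P Om Om" "Cod E meet = Om"
    using mono dc unfolding omega_meet_def by auto
  show "meet \<cdot> v = true_at W \<longleftrightarrow> Pr1 P Om Om \<cdot> v = true_at W \<and> Pr2 P Om Om \<cdot> v = true_at W"
    if v: "v \<in> Arr E" "Cod E v = Prod P Om Om" and W: "Dom E v = W"
  proof -
    have "W \<in> Obj E" using v W by auto
    have "factors_through E v ?tt \<longleftrightarrow>
      Pr1 P Om Om \<cdot> v = true_at W \<and> Pr2 P Om Om \<cdot> v = true_at W" (is "_ \<longleftrightarrow> ?R")
    proof
      assume "factors_through E v ?tt"
      then obtain u where u: "u \<in> Arr E" "Dom E u = Dom E v" "Cod E u = Dom E ?tt" "?tt \<cdot> u = v"
        by (rule factors_throughE)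
      have "Cod E u = Prod P (One P) (One P)" "Dom E u = W" using u dc W by auto
      then have "?tt \<cdot> u = pair E P (true_at W) (true_at W)"
        using u(1) unfolding tt by (simp add: tr_comp)
      then have "v = pair E P (true_at W) (true_at W)" using u(4) by simp
      then show ?R using \<open>W \<in> Obj E\<close> by simp
    next
      assume R: ?R
      show "factors_through E v ?tt"
      proof (rule factors_throughI)
        let ?u = "pair E P (bang E P W) (bang E P W)"
        have "?tt \<cdot> ?u = pair E P (true_at W) (true_at W)"
          using \<open>W \<in> Obj E\<close> unfolding tt by (simp add: true_at_def)
        also have "\<dots> = v"
          using pair_Pr[OF v] R by simp
        finally show "?tt \<cdot> ?u = v" .
      qed (use dc \<open>W \<in> Obj E\<close> in auto)
    qed
    then show ?thesis
      using chi_true_iff[OF mono, of v] v W dc unfolding omega_meet_def by simp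
  qed
qed

lemma omega_semilattice: "internal_semilattice E P Om tr meet"
proof -
  have 1: "meet \<cdot> pair E P (Idn E Om) (tr \<cdot> bang E P Om) = Idn E Om"
    by (rule omega_ext) (auto simp: tr_comp)
  have 2: "meet \<cdot> pair E P (tr \<cdot> bang E P Om) (Idn E Om) = Idn E Om"
    by (rule omega_ext) (auto simp: tr_comp)
  have 3: "meet \<cdot> prod_map E P meet (Idn E Om) = meet \<cdot> prod_map E P (Idn E Om) meet \<cdot>
         pair E P (Pr1 P Om Om \<cdot> Pr1 P (Prod P Om Om) Om)
           (pair E P (Pr2 P Om Om \<cdot> Pr1 P (Prod P Om Om) Om) (Pr2 P (Prod P Om Om) Om))"
    by (rule omega_ext) (auto simp: prod_map_def)
  have 4: "meet \<cdot> pair E P (Pr2 P Om Om) (Pr1 P Om Om) = meet"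
    by (rule omega_ext) auto
  have 5: "meet \<cdot> pair E P (Idn E Om) (Idn E Om) = Idn E Om"
    by (rule omega_ext) auto
  show ?thesis
    unfolding internal_semilattice_def using 1 2 3 4 5 by simp
qed

text \<open>Cartesian closedness supplies exponentials for some choice of products; the canonical
isomorphisms between two choices of products carry the evaluation over to the given one.\<close>

lemma exponential_exists:
  assumes A: "A \<in> Obj E" and B: "B \<in> Obj E"
  obtains V ev where "V \<in> Obj E" "ev \<in> hom E (Prod P V A) B"
    "\<And>Z f. Z \<in> Obj E \<Longrightarrow> f \<in> hom E (Prod P Z A) B \<Longrightarrow>
      \<exists>!g. g \<in> hom E Z V \<and> ev \<cdot> pair E P (g \<cdot> Pr1 P Z A) (Pr2 P Z A) = f"
proof -
  obtain P' where P': "finite_products E P'"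
    and exp: "\<forall>A\<in>Obj E. \<forall>B\<in>Obj E. \<exists>V\<in>Obj E. \<exists>ev\<in>hom E (Prod P' V A) B.
        \<forall>Z\<in>Obj E. \<forall>f\<in>hom E (Prod P' Z A) B.
          \<exists>!g. g \<in> hom E Z V \<and> ev \<cdot> prod_map E P' g (Idn E A) = f"
    using topos unfolding topos_def cartesian_closed_def by blast
  interpret P': finprod E P' using P' by unfold_locales
  obtain V ev where V: "V \<in> Obj E" and ev: "ev \<in> Arr E" "Dom E ev = Prod P' V A" "Cod E ev = B"
    and univ: "\<And>Z f. Z \<in> Obj E \<Longrightarrow> f \<in> hom E (Prod P' Z A) B \<Longrightarrow>
      \<exists>!g. g \<in> hom E Z V \<and> ev \<cdot> prod_map E P' g (Idn E A) = f"
    using exp A B by (metis mem_hom_iff)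
  let ?a = "\<lambda>Z. pair E P' (Pr1 P Z A) (Pr2 P Z A)"
  let ?b = "\<lambda>Z. pair E P (Pr1 P' Z A) (Pr2 P' Z A)"
  have main: "\<exists>!g. g \<in> hom E Z V \<and> (ev \<cdot> ?a V) \<cdot> pair E P (g \<cdot> Pr1 P Z A) (Pr2 P Z A) = f"
    if Z: "Z \<in> Obj E" and f: "f \<in> hom E (Prod P Z A) B" for Z f
  proof -
    have "(ev \<cdot> ?a V) \<cdot> pair E P (g \<cdot> Pr1 P Z A) (Pr2 P Z A) = f \<longleftrightarrow>
        ev \<cdot> prod_map E P' g (Idn E A) = f \<cdot> ?b Z" (is "?L \<longleftrightarrow> ?R")
      if g: "g \<in> hom E Z V" for g
    proof -
      have l: "(ev \<cdot> ?a V) \<cdot> pair E P (g \<cdot> Pr1 P Z A) (Pr2 P Z A) =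
          ev \<cdot> pair E P' (g \<cdot> Pr1 P Z A) (Pr2 P Z A)"
        using g ev A V Z by simp
      have r: "ev \<cdot> prod_map E P' g (Idn E A) = ev \<cdot> pair E P' (g \<cdot> Pr1 P' Z A) (Pr2 P' Z A)"
        using g ev A V Z by (simp add: prod_map_def)
      show ?thesis
      proof
        assume ?L
        then have "f \<cdot> ?b Z = (ev \<cdot> pair E P' (g \<cdot> Pr1 P Z A) (Pr2 P Z A)) \<cdot> ?b Z"
          using l by simp
        then show ?R using r g ev A V Z by simp
      next
        assume ?R
        then have "(f \<cdot> ?b Z) \<cdot> ?a Z = (ev \<cdot> pair E P' (g \<cdot> Pr1 P' Z A) (Pr2 P' Z A)) \<cdot> ?a Z"
          using r by simp
        then show ?L using l f g ev A V Z by simp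
      qed
    qed
    moreover have "f \<cdot> ?b Z \<in> hom E (Prod P' Z A) B" using f Z A by auto
    ultimately show ?thesis
      using univ[OF Z, of "f \<cdot> ?b Z"] by metis
  qed
  show ?thesis
    by (rule that[OF V _ main]) (use V ev A B in auto)
qed

text \<open>The kernel pair, as a subobject \<open>e\<close> of \<open>Y \<times> Y\<close>, is the universal pair of arrows that \<open>r\<close> identifies.
In a class closed under products and subobjects this \<open>e\<close> stays in the class, which is how the
hypothesis gets verified.\<close>

lemma monic_if_kernel_pair_trivial:
  assumes r: "r \<in> Arr E" "Dom E r = Y"
    and triv: "\<And>e. monic E e \<Longrightarrow> Cod E e = Prod P Y Y \<Longrightarrow>
      r \<cdot> (Pr1 P Y Y \<cdot> e) = r \<cdot> (Pr2 P Y Y \<cdot> e) \<Longrightarrow> Pr1 P Y Y \<cdot> e = Pr2 P Y Y \<cdot> e"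
  shows "monic E r"
proof (rule monicI[OF r(1)])
  fix f g
  assume fg: "f \<in> Arr E" "g \<in> Arr E" "Dom E f = Dom E g" "Cod E f = Dom E r"
    "Cod E g = Dom E r" "r \<cdot> f = r \<cdot> g"
  have Y: "Y \<in> Obj E" using r by auto
  let ?p = "Pr1 P Y Y" and ?q = "Pr2 P Y Y"
  obtain e where e: "monic E e" "Cod E e = Dom E (r \<cdot> ?p)" "(r \<cdot> ?p) \<cdot> e = (r \<cdot> ?q) \<cdot> e"
    and fac: "\<And>v. v \<in> Arr E \<Longrightarrow> Cod E v = Dom E (r \<cdot> ?p) \<Longrightarrow> (r \<cdot> ?p) \<cdot> v = (r \<cdot> ?q) \<cdot> v \<Longrightarrow>
      factors_through E v e"
    by (rule equalizer_exists[of "r \<cdot> ?p" "r \<cdot> ?q"]) (use r Y in auto)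
  have e': "e \<in> Arr E" "Cod E e = Prod P Y Y"
    using e r Y by auto
  have "r \<cdot> (?p \<cdot> e) = r \<cdot> (?q \<cdot> e)" using e' e(3) r Y by simp
  then have pq: "?p \<cdot> e = ?q \<cdot> e" using triv e(1) e' by blast
  have "factors_through E (pair E P f g) e"
    using fg r Y by (intro fac) auto
  then obtain k where k: "k \<in> Arr E" "Cod E k = Dom E e" "e \<cdot> k = pair E P f g"
    by (rule factors_throughE)
  have "f = ?p \<cdot> pair E P f g" "g = ?q \<cdot> pair E P f g"
    using fg r by auto
  moreover have "?p \<cdot> (e \<cdot> k) = ?q \<cdot> (e \<cdot> k)"
    using comp_eq_extend[OF pq, of k] k e' Y by simp
  ultimately show "f = g" using k by simp
qed

end

section \<open>Hyperconnected classes of objects\<close>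

text \<open>A universal arrow from the full subcategory on \<open>Q\<close> to the object \<open>X\<close>, i.e. the value at \<open>X\<close> of the counit of
a coreflector.\<close>

definition coreflection :: "('o, 'm) category \<Rightarrow> 'o set \<Rightarrow> 'o \<Rightarrow> 'm \<Rightarrow> bool" where
  "coreflection C Q X r \<longleftrightarrow> r \<in> Arr C \<and> Cod C r = X \<and> Dom C r \<in> Q \<and>
     (\<forall>g\<in>Arr C. Dom C g \<in> Q \<longrightarrow> Cod C g = X \<longrightarrow>
        (\<exists>!u. u \<in> hom C (Dom C g) (Dom C r) \<and> r \<cdot>\<^bsub>C\<^esub> u = g))"

lemma coreflection_factors:
  assumes "coreflection C Q X r" "g \<in> Arr C" "Dom C g \<in> Q" "Cod C g = X"
  shows "factors_through C g r"
proof -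
  have "\<exists>!u. u \<in> hom C (Dom C g) (Dom C r) \<and> r \<cdot>\<^bsub>C\<^esub> u = g"
    using assms unfolding coreflection_def by blast
  then show ?thesis unfolding factors_through_def by blast
qed

text \<open>These are the essential images of the inverse image functors of hyperconnected geometric
morphisms: connected ones whose image is closed under subobjects.\<close>

definition hyperconnected_class ::
  "('o, 'm) category \<Rightarrow> ('o, 'm) products \<Rightarrow> 'o set \<Rightarrow> bool" where
  "hyperconnected_class C P Q \<longleftrightarrow> Q \<subseteq> Obj C \<and> One P \<in> Q \<and>
     (\<forall>X\<in>Q. \<forall>Y\<in>Q. Prod P X Y \<in> Q) \<and>
     (\<forall>m. monic C m \<longrightarrow> Cod C m \<in> Q \<longrightarrow> Dom C m \<in> Q) \<and>
     (\<forall>X\<in>Obj C. \<exists>r. coreflection C Q X r)"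

definition full_subcategory :: "('o, 'm) category \<Rightarrow> 'o set \<Rightarrow> ('o, 'm) category" where
  "full_subcategory C Q = C\<lparr>Obj := Q, Arr := {f \<in> Arr C. Dom C f \<in> Q \<and> Cod C f \<in> Q}\<rparr>"

abbreviation inclusion :: "('o, 'm, 'o, 'm) cfunctor" where
  "inclusion \<equiv> \<lparr>fobj = (\<lambda>X. X), fmap = (\<lambda>f. f)\<rparr>"

lemma full_subcategory_simps [simp]:
  "Obj (full_subcategory C Q) = Q"
  "f \<in> Arr (full_subcategory C Q) \<longleftrightarrow> f \<in> Arr C \<and> Dom C f \<in> Q \<and> Cod C f \<in> Q"
  "Dom (full_subcategory C Q) = Dom C" "Cod (full_subcategory C Q) = Cod C"
  "Idn (full_subcategory C Q) = Idn C"
  "Comp (full_subcategory C Q) = Comp C"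
  unfolding full_subcategory_def by auto

locale hyperconnected = topos_cat +
  fixes Q :: "'a set"
  assumes Q: "hyperconnected_class E P Q"
begin

lemma Q_obj [simp]: "X \<in> Q \<Longrightarrow> X \<in> Obj E"
  and Q_One [simp]: "One P \<in> Q"
  and Q_Prod [simp]: "X \<in> Q \<Longrightarrow> Y \<in> Q \<Longrightarrow> Prod P X Y \<in> Q"
  and Q_sub: "monic E m \<Longrightarrow> Cod E m \<in> Q \<Longrightarrow> Dom E m \<in> Q"
  and coreflection_exists: "X \<in> Obj E \<Longrightarrow> \<exists>r. coreflection E Q X r"
  using Q unfolding hyperconnected_class_def by auto

text \<open>The kernel pair of \<open>r\<close> lies in \<open>Q\<close>, and arrows from objects of \<open>Q\<close> are separated by \<open>r\<close>.\<close>

lemma coreflection_monic: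
  assumes "coreflection E Q X r"
  shows "monic E r"
proof (rule monic_if_kernel_pair_trivial)
  have r: "r \<in> Arr E" "Cod E r = X" "Dom E r \<in> Q"
    and uniq: "\<And>g. g \<in> Arr E \<Longrightarrow> Dom E g \<in> Q \<Longrightarrow> Cod E g = X \<Longrightarrow>
      \<exists>!u. u \<in> hom E (Dom E g) (Dom E r) \<and> r \<cdot> u = g"
    using assms unfolding coreflection_def by blast+
  show "r \<in> Arr E" by fact
  fix e
  let ?Y = "Dom E r"
  let ?p = "Pr1 P ?Y ?Y" and ?q = "Pr2 P ?Y ?Y"
  assume e: "monic E e" "Cod E e = Prod P ?Y ?Y" and eq: "r \<cdot> (?p \<cdot> e) = r \<cdot> (?q \<cdot> e)"
  have e': "e \<in> Arr E" "Dom E e \<in> Q"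
    using e r Q_sub[OF e(1)] by auto
  have "\<exists>!u. u \<in> hom E (Dom E e) ?Y \<and> r \<cdot> u = r \<cdot> (?p \<cdot> e)"
    using uniq[of "r \<cdot> (?p \<cdot> e)"] e' e r by simp
  moreover have "?p \<cdot> e \<in> hom E (Dom E e) ?Y" "?q \<cdot> e \<in> hom E (Dom E e) ?Y"
    using e' e r by auto
  ultimately show "?p \<cdot> e = ?q \<cdot> e" using eq by metis
qed simp

definition counit :: "'a \<Rightarrow> 'b" where
  "counit X = (SOME r. coreflection E Q X r)"

lemma counit: "X \<in> Obj E \<Longrightarrow> coreflection E Q X (counit X)"
  unfolding counit_def by (rule someI_ex) (rule coreflection_exists)

lemma counit_typing [simp]:
  assumes "X \<in> Obj E"
  shows "counit X \<in> Arr E" "Cod E (counit X) = X" "Dom E (counit X) \<in> Q" "monic E (counit X)"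
  using counit[OF assms] coreflection_monic[OF counit[OF assms]] unfolding coreflection_def by auto

definition lift :: "'b \<Rightarrow> 'b" where
  "lift g = (THE u. u \<in> hom E (Dom E g) (Dom E (counit (Cod E g))) \<and> counit (Cod E g) \<cdot> u = g)"

lemma lift_typing [simp]:
  assumes "g \<in> Arr E" "Dom E g \<in> Q"
  shows "lift g \<in> Arr E" "Dom E (lift g) = Dom E g"
    "Cod E (lift g) = Dom E (counit (Cod E g))"
    and counit_lift [simp]: "Cod E g = X \<Longrightarrow> counit X \<cdot> lift g = g"
proof -
  have "\<exists>!u. u \<in> hom E (Dom E g) (Dom E (counit (Cod E g))) \<and> counit (Cod E g) \<cdot> u = g"
    using counit[of "Cod E g"] assms unfolding coreflection_def by auto
  from theI'[OF this]
  show "lift g \<in> Arr E" "Dom E (lift g) = Dom E g"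
    "Cod E (lift g) = Dom E (counit (Cod E g))"
    and "Cod E g = X \<Longrightarrow> counit X \<cdot> lift g = g"
    unfolding lift_def by auto
qed

lemma lift_unique:
  assumes "counit X \<cdot> u = g" "u \<in> Arr E" "Cod E u = Dom E (counit X)" "X \<in> Obj E" "Dom E u \<in> Q"
  shows "lift g = u"
proof (rule monicD[of "counit X"])
  have g: "g \<in> Arr E" "Dom E g = Dom E u" "Cod E g = X"
    using assms(2-) by (auto simp flip: assms(1))
  show "counit X \<cdot> lift g = counit X \<cdot> u" using g assms by simp
  show "lift g \<in> Arr E" "Dom E (lift g) = Dom E u" "Cod E (lift g) = Dom E (counit X)"
    using g assms by auto
qed (use assms in auto)

lemma counit_lift_comp [simp]:
  assumes "g \<in> Arr E" "Dom E g \<in> Q" "Cod E g = X" "v \<in> Arr E" "Cod E v = Dom E g"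
  shows "counit X \<cdot> (lift g \<cdot> v) = g \<cdot> v"
  by (rule comp_eq_extend) (use assms in auto)

definition sub :: "('a, 'b) category" where
  "sub = full_subcategory E Q"

lemma sub_simps [simp]:
  "Obj sub = Q" "f \<in> Arr sub \<longleftrightarrow> f \<in> Arr E \<and> Dom E f \<in> Q \<and> Cod E f \<in> Q"
  "Dom sub = Dom E" "Cod sub = Cod E" "Idn sub = Idn E" "Comp sub = Comp E"
  unfolding sub_def by simp_all

lemma sub_hom: "X \<in> Q \<Longrightarrow> Y \<in> Q \<Longrightarrow> hom sub X Y = hom E X Y"
  by auto

sublocale sub: cat sub
proof
  show "category sub"
    unfolding category_def by auto
qed

text \<open>A finite family of arrows from \<open>X\<close> to objects of \<open>Q\<close> factors through a single arrow \<open>q\<close> from \<open>X\<close> to an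
iterated product in \<open>Q\<close>. The projections of a limit are jointly monic, which makes \<open>q\<close> monic.\<close>

lemma limit_in_Q:
  assumes "finite_diagram E I D K" "limit_cone E I D K X p" "\<And>i. i \<in> I \<Longrightarrow> D i \<in> Q"
  shows "X \<in> Q"
proof -
  have fin: "finite I" and K: "\<And>i a j. (i, a, j) \<in> K \<Longrightarrow> i \<in> I \<and> j \<in> I \<and> a \<in> hom E (D i) (D j)"
    using assms(1) unfolding finite_diagram_def by blast+
  have X: "X \<in> Obj E" and p: "\<And>i. i \<in> I \<Longrightarrow> p i \<in> hom E X (D i)"
    and edge: "\<And>i a j. (i, a, j) \<in> K \<Longrightarrow> a \<cdot> p i = p j"
    and univ: "\<And>Y q. cone E I D K Y q \<Longrightarrow> \<exists>!u. u \<in> hom E Y X \<and> (\<forall>i\<in>I. p i \<cdot> u = q i)"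
    using assms(2) unfolding limit_cone_def cone_def by blast+
  have "\<exists>q. q \<in> Arr E \<and> Dom E q = X \<and> Cod E q \<in> Q \<and>
      (\<forall>i\<in>J. \<exists>s\<in>Arr E. Dom E s = Cod E q \<and> p i = s \<cdot> q)" if "finite J" "J \<subseteq> I" for J
    using that
  proof (induction J rule: finite_induct)
    case empty
    show ?case by (rule exI[of _ "bang E P X"]) (use X in auto)
  next
    case (insert j J)
    then obtain q where q: "q \<in> Arr E" "Dom E q = X" "Cod E q \<in> Q"
      and s: "\<And>i. i \<in> J \<Longrightarrow> \<exists>s\<in>Arr E. Dom E s = Cod E q \<and> p i = s \<cdot> q"
      by auto
    have j: "p j \<in> Arr E" "Dom E (p j) = X" "Cod E (p j) = D j" "D j \<in> Q"
      using p[of j] assms(3)[of j] insert.prems by auto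
    let ?q = "pair E P q (p j)"
    have "\<exists>s\<in>Arr E. Dom E s = Cod E ?q \<and> p i = s \<cdot> ?q" if i: "i \<in> insert j J" for i
    proof (cases "i = j")
      case True
      then show ?thesis
        using q j by (intro bexI[of _ "Pr2 P (Cod E q) (D j)"]) auto
    next
      case False
      then obtain t where "t \<in> Arr E" "Dom E t = Cod E q" "p i = t \<cdot> q"
        using s i by blast
      then show ?thesis
        using q j by (intro bexI[of _ "t \<cdot> Pr1 P (Cod E q) (D j)"]) auto
    qed
    then show ?case
      using q j by (intro exI[of _ ?q]) auto
  qed
  from this[OF fin subset_refl] obtain q where q: "q \<in> Arr E" "Dom E q = X" "Cod E q \<in> Q"
    and s: "\<And>i. i \<in> I \<Longrightarrow> \<exists>s\<in>Arr E. Dom E s = Cod E q \<and> p i = s \<cdot> q"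
    by auto
  have "monic E q"
  proof (rule monicI)
    fix f g
    assume fg: "f \<in> Arr E" "g \<in> Arr E" "Dom E f = Dom E g" "Cod E f = Dom E q"
      "Cod E g = Dom E q" "q \<cdot> f = q \<cdot> g"
    have eq: "p i \<cdot> f = p i \<cdot> g" if "i \<in> I" for i
    proof -
      obtain t where t: "t \<in> Arr E" "Dom E t = Cod E q" "p i = t \<cdot> q" using s \<open>i \<in> I\<close> by blast
      then show ?thesis using fg q by simp
    qed
    have "cone E I D K (Dom E f) (\<lambda>i. p i \<cdot> f)"
      unfolding cone_def
    proof (intro conjI ballI)
      fix i assume "i \<in> I" then show "p i \<cdot> f \<in> hom E (Dom E f) (D i)"
        using p[of i] fg q by auto
    next
      fix e assume e: "e \<in> K"
      obtain i a j where ija: "e = (i, a, j)" by (cases e)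
      show "case e of (i, a, j) \<Rightarrow> a \<cdot> (p i \<cdot> f) = p j \<cdot> f"
        unfolding ija prod.case
        by (rule comp_eq_extend[OF edge])
          (use e K[of i a j] p[of i] fg q in \<open>auto simp: ija\<close>)
    qed (use fg in auto)
    from univ[OF this] show "f = g"
      using fg q eq by (metis mem_hom_iff)
  qed (use q in auto)
  then show ?thesis using Q_sub[of q] q by simp
qed

text \<open>A limit taken in \<open>E\<close> has its vertex in \<open>Q\<close> and hence is a limit in the subcategory. Limits are unique
up to isomorphism, so every limit in the subcategory is isomorphic to that one.\<close>

lemma sub_limit_iff:
  assumes "finite_diagram sub I D K"
  shows "limit_cone sub I D K X p \<longleftrightarrow> limit_cone E I D K X p"
    and "\<exists>X p. limit_cone sub I D K X p"
proof -
  have D: "\<And>i. i \<in> I \<Longrightarrow> D i \<in> Q" and diagram: "finite_diagram E I D K"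
    using assms unfolding finite_diagram_def by auto
  have cone_iff: "cone sub I D K Y q \<longleftrightarrow> cone E I D K Y q" if "Y \<in> Q" for Y q
    unfolding cone_def using that D by auto
  have cone_sub: "cone sub I D K Y q \<longleftrightarrow> Y \<in> Q \<and> cone E I D K Y q" for Y q
    using cone_iff[of Y q] unfolding cone_def by auto
  have down: "limit_cone sub I D K X p" if lim: "limit_cone E I D K X p" for X p
  proof -
    have "X \<in> Q" using limit_in_Q[OF diagram lim D] .
    then show ?thesis
      using lim unfolding limit_cone_def cone_sub by (simp del: mem_hom_iff add: sub_hom)
  qed
  obtain Z z where Z: "limit_cone E I D K Z z"
    using topos diagram unfolding topos_def has_finite_limits_def by blast
  then show "\<exists>X p. limit_cone sub I D K X p" using down by blast
  have "Z \<in> Q" using limit_in_Q[OF diagram Z D] .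
  have "limit_cone E I D K X p" if lim: "limit_cone sub I D K X p"
  proof -
    have X: "X \<in> Q" and cX: "cone E I D K X p"
      using lim unfolding limit_cone_def cone_sub by auto
    have p: "p i \<in> Arr E" "Dom E (p i) = X" if "i \<in> I" for i
      using cX that unfolding cone_def by auto
    have z: "z i \<in> Arr E" "Dom E (z i) = Z" if "i \<in> I" for i
      using Z that unfolding limit_cone_def cone_def by auto
    have univX: "\<And>Y q. Y \<in> Q \<Longrightarrow> cone E I D K Y q \<Longrightarrow>
        \<exists>!u. u \<in> hom sub Y X \<and> (\<forall>i\<in>I. p i \<cdot> u = q i)"
      using lim unfolding limit_cone_def cone_sub by (simp del: mem_hom_iff)
    have univZ: "\<And>Y q. cone E I D K Y q \<Longrightarrow> \<exists>!u. u \<in> hom E Y Z \<and> (\<forall>i\<in>I. z i \<cdot> u = q i)"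
      and cZ: "cone E I D K Z z"
      using Z unfolding limit_cone_def by blast+
    obtain a where a: "a \<in> Arr E" "Dom E a = Z" "Cod E a = X" "\<And>i. i \<in> I \<Longrightarrow> p i \<cdot> a = z i"
      using univX[OF \<open>Z \<in> Q\<close> cZ] by (metis mem_hom_iff sub_simps(2-4))
    obtain b where b: "b \<in> Arr E" "Dom E b = X" "Cod E b = Z" "\<And>i. i \<in> I \<Longrightarrow> z i \<cdot> b = p i"
      using univZ[OF cX] by (metis mem_hom_iff)
    have "p i \<cdot> (a \<cdot> b) = p i" if "i \<in> I" for i
      using comp_eq_extend[OF a(4), of i b] a b p[OF that] that by simp
    moreover have "a \<cdot> b \<in> hom sub X X" "Idn E X \<in> hom sub X X" "\<forall>i\<in>I. p i \<cdot> Idn E X = p i"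
      using a b X p by auto
    ultimately have "a \<cdot> b = Idn E X"
      using univX[OF X cX] by metis
    have ex: "\<exists>!u. u \<in> hom E Y X \<and> (\<forall>i\<in>I. p i \<cdot> u = q i)" if q: "cone E I D K Y q" for Y q
    proof -
      obtain u where u: "u \<in> Arr E" "Dom E u = Y" "Cod E u = Z" "\<And>i. i \<in> I \<Longrightarrow> z i \<cdot> u = q i"
        and uniq: "\<And>u'. u' \<in> hom E Y Z \<Longrightarrow> (\<forall>i\<in>I. z i \<cdot> u' = q i) \<Longrightarrow> u' = u"
        using univZ[OF q] by (metis mem_hom_iff)
      show ?thesis
      proof (rule ex1I[of _ "a \<cdot> u"])
        have "p i \<cdot> (a \<cdot> u) = q i" if "i \<in> I" for i
          using comp_eq_extend[OF a(4), of i u] a u p[OF that] that by simp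
        then show "a \<cdot> u \<in> hom E Y X \<and> (\<forall>i\<in>I. p i \<cdot> (a \<cdot> u) = q i)"
          using a u by auto
      next
        fix v assume v: "v \<in> hom E Y X \<and> (\<forall>i\<in>I. p i \<cdot> v = q i)"
        have "z i \<cdot> (b \<cdot> v) = q i" if "i \<in> I" for i
          using comp_eq_extend[OF b(4), of i v] v b z[OF that] that by simp
        then have "b \<cdot> v = u" using v b by (intro uniq) auto
        then have "a \<cdot> u = (a \<cdot> b) \<cdot> v" using a(1-3) b(1-3) v by auto
        then show "v = a \<cdot> u" using \<open>a \<cdot> b = _\<close> v by simp
      qed
    qed
    then show ?thesis using cX unfolding limit_cone_def by blast
  qed
  then show "limit_cone sub I D K X p \<longleftrightarrow> limit_cone E I D K X p"
    using down by blast
qed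

lemma sub_finite_limits: "has_finite_limits sub"
  unfolding has_finite_limits_def using sub_limit_iff(2) by blast

lemma sub_finite_products: "finite_products sub P"
  unfolding finite_products_def
proof (intro conjI ballI)
  show "terminal sub (One P)"
    using terminal_One unfolding terminal_def by (simp del: mem_hom_iff add: sub_hom)
  fix X Y assume "X \<in> Obj sub" "Y \<in> Obj sub"
  then have XY: "X \<in> Q" "Y \<in> Q" by auto
  show "is_product sub X Y (Prod P X Y) (Pr1 P X Y) (Pr2 P X Y)"
    unfolding is_product_def
  proof (intro conjI allI ballI)
    fix Z f g assume fg: "f \<in> hom sub Z X" "g \<in> hom sub Z Y"
    then have "Z \<in> Q" and "f \<in> hom E Z X" "g \<in> hom E Z Y" by auto
    then show "\<exists>!u. u \<in> hom sub Z (Prod P X Y) \<and> Comp sub (Pr1 P X Y) u = f \<and>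
        Comp sub (Pr2 P X Y) u = g"
      using product[of X Y] XY unfolding is_product_def
      by (simp del: mem_hom_iff add: sub_hom)
  qed (use XY in auto)
qed

lemma sub_pair:
  assumes "f \<in> Arr sub" "g \<in> Arr sub" "Dom E g = Dom E f"
  shows "pair sub P f g = pair E P f g"
  using assms unfolding pair_def by (simp del: mem_hom_iff add: sub_hom)

text \<open>The exponential is the coreflection of the exponential of \<open>E\<close>: arrows into either from an object of
\<open>Q\<close> are the same.\<close>

lemma sub_cartesian_closed: "cartesian_closed sub"
  unfolding cartesian_closed_def
proof (intro exI[of _ P] conjI ballI sub_finite_products)
  fix A B assume "A \<in> Obj sub" "B \<in> Obj sub"
  then have A: "A \<in> Q" and B: "B \<in> Q" by auto
  obtain V ev where V: "V \<in> Obj E" and ev: "ev \<in> hom E (Prod P V A) B"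
    and univ: "\<And>Z f. Z \<in> Obj E \<Longrightarrow> f \<in> hom E (Prod P Z A) B \<Longrightarrow>
      \<exists>!g. g \<in> hom E Z V \<and> ev \<cdot> pair E P (g \<cdot> Pr1 P Z A) (Pr2 P Z A) = f"
    using exponential_exists[of A B] A B Q_obj by blast
  let ?V = "Dom E (counit V)"
  let ?ev = "ev \<cdot> pair E P (counit V \<cdot> Pr1 P ?V A) (Pr2 P ?V A)"
  have "\<exists>!g. g \<in> hom sub Z ?V \<and> ?ev \<cdot> prod_map sub P g (Idn sub A) = f"
    if Z: "Z \<in> Q" and f: "f \<in> hom sub (Prod P Z A) B" for Z f
  proof -
    have eq: "?ev \<cdot> prod_map sub P g (Idn sub A) =
        ev \<cdot> pair E P ((counit V \<cdot> g) \<cdot> Pr1 P Z A) (Pr2 P Z A)" if "g \<in> hom sub Z ?V" for g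
    proof -
      have "prod_map sub P g (Idn sub A) = pair E P (g \<cdot> Pr1 P Z A) (Pr2 P Z A)"
        using that A Z V unfolding prod_map_def by (simp add: sub_pair)
      then show ?thesis using that A Z V ev by simp
    qed
    obtain g where g: "g \<in> hom E Z V" "ev \<cdot> pair E P (g \<cdot> Pr1 P Z A) (Pr2 P Z A) = f"
      and uniq: "\<And>g'. g' \<in> hom E Z V \<Longrightarrow>
        ev \<cdot> pair E P (g' \<cdot> Pr1 P Z A) (Pr2 P Z A) = f \<Longrightarrow> g' = g"
      using univ[of Z f] Z f by (metis mem_hom_iff sub_simps(2-4) Q_obj)
    show ?thesis
    proof (rule ex1I[of _ "lift g"])
      have l: "lift g \<in> hom sub Z ?V" using g Z V by auto
      have "counit V \<cdot> lift g = g" using g Z V by auto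
      then show "lift g \<in> hom sub Z ?V \<and> ?ev \<cdot> prod_map sub P (lift g) (Idn sub A) = f"
        using l eq[OF l] g(2) Z V by simp
    next
      fix k assume k: "k \<in> hom sub Z ?V \<and> ?ev \<cdot> prod_map sub P k (Idn sub A) = f"
      then have "counit V \<cdot> k = g"
        using eq[of k] V by (intro uniq) auto
      then show "k = lift g"
        using k V Z by (intro lift_unique[symmetric]) auto
    qed
  qed
  moreover have "?V \<in> Obj sub" "?ev \<in> hom sub (Prod P ?V A) B"
    using V ev A B by auto
  ultimately show "\<exists>V\<in>Obj sub. \<exists>ev\<in>hom sub (Prod P V A) B.
      \<forall>Z\<in>Obj sub. \<forall>f\<in>hom sub (Prod P Z A) B.
        \<exists>!g. g \<in> hom sub Z V \<and> Comp sub ev (prod_map sub P g (Idn sub A)) = f"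
    unfolding sub_simps by blast
qed

text \<open>Kernel pairs of arrows in the subcategory stay in the subcategory.\<close>

lemma sub_monic:
  assumes "monic sub m"
  shows "monic E m"
proof -
  have m: "m \<in> Arr E" "Dom E m \<in> Q" "Cod E m \<in> Q" using assms unfolding monic_def by auto
  show ?thesis
  proof (rule monic_if_kernel_pair_trivial[OF m(1) refl])
    let ?Y = "Dom E m"
    fix e
    assume e: "monic E e" "Cod E e = Prod P ?Y ?Y"
      and eq: "m \<cdot> (Pr1 P ?Y ?Y \<cdot> e) = m \<cdot> (Pr2 P ?Y ?Y \<cdot> e)"
    then show "Pr1 P ?Y ?Y \<cdot> e = Pr2 P ?Y ?Y \<cdot> e"
      using m Q_sub[of e] by - (rule sub.monicD[OF assms], auto)
  qed
qed

lemma sub_factors_through: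
  "f \<in> Arr sub \<Longrightarrow> m \<in> Arr sub \<Longrightarrow> factors_through sub f m \<longleftrightarrow> factors_through E f m"
  unfolding factors_through_def by (simp del: mem_hom_iff add: sub_hom)

text \<open>Composing with the monic coreflection of \<open>\<Omega>\<close> turns truth in the subcategory into truth in \<open>E\<close>.\<close>

lemma sub_classifies_iff:
  assumes c: "c \<in> hom sub (Cod E m) (Dom E (counit Om))" and m: "monic sub m"
  shows "classifies sub (One P) (lift tr) c m \<longleftrightarrow>
    (\<forall>v\<in>Arr sub. Cod E v = Cod E m \<longrightarrow>
      counit Om \<cdot> (c \<cdot> v) = true_at (Dom E v) \<longleftrightarrow> factors_through E v m)"
proof -
  have ltr: "lift tr \<in> hom sub (One P) (Dom E (counit Om))" by auto
  have m': "m \<in> Arr sub" using m unfolding monic_def by blast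
  have "(\<exists>t\<in>hom sub (Dom E v) (One P). c \<cdot> v = lift tr \<cdot> t) \<longleftrightarrow>
      counit Om \<cdot> (c \<cdot> v) = true_at (Dom E v)"
    if v: "v \<in> Arr sub" "Cod E v = Cod E m" for v
  proof
    assume "\<exists>t\<in>hom sub (Dom E v) (One P). c \<cdot> v = lift tr \<cdot> t"
    then show "counit Om \<cdot> (c \<cdot> v) = true_at (Dom E v)"
      by (auto simp: tr_comp)
  next
    assume *: "counit Om \<cdot> (c \<cdot> v) = true_at (Dom E v)"
    have "c \<cdot> v = lift tr \<cdot> bang E P (Dom E v)"
      by (rule monicD[of "counit Om"]) (use * c v in \<open>auto simp: tr_comp\<close>)
    then show "\<exists>t\<in>hom sub (Dom E v) (One P). c \<cdot> v = lift tr \<cdot> t"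
      using v by (intro bexI[of _ "bang E P (Dom E v)"]) auto
  qed
  then show ?thesis
    using sub.classifies_iff[of "One P" "lift tr" "Dom E (counit Om)" c m] ltr m m' c
      sub_factors_through sub_finite_products
    unfolding finite_products_def sub_simps(3-6) by (metis sub_simps(4))
qed

text \<open>The classifier is the coreflection of \<open>\<Omega>\<close>. For uniqueness, truth of a candidate \<open>c\<close> is known only at
elements with domain in \<open>Q\<close>; this suffices because the subobject that \<open>c\<close> classifies in \<open>E\<close> is a subobject of
an object of \<open>Q\<close> and so is one of these elements.\<close>

lemma sub_classifier: "subobject_classifier sub (One P) (Dom E (counit Om)) (lift tr)"
  unfolding subobject_classifier_def
proof (intro conjI allI impI)
  show "terminal sub (One P)"
    using sub_finite_products unfolding finite_products_def by blast
  fix m assume m: "monic sub m"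
  then have mE: "monic E m" by (rule sub_monic)
  have m': "m \<in> Arr E" "Dom E m \<in> Q" "Cod E m \<in> Q" using m unfolding monic_def by auto
  show "\<exists>!c. c \<in> hom sub (Cod sub m) (Dom E (counit Om)) \<and> classifies sub (One P) (lift tr) c m"
  proof (rule ex1I[of _ "lift (chi m)"])
    have l: "lift (chi m) \<in> hom sub (Cod E m) (Dom E (counit Om))"
      using mE m' by auto
    moreover have "counit Om \<cdot> (lift (chi m) \<cdot> v) = chi m \<cdot> v" if "v \<in> Arr E" "Cod E v = Cod E m" for v
      using mE m' that by auto
    ultimately show "lift (chi m) \<in> hom sub (Cod sub m) (Dom E (counit Om)) \<and>
        classifies sub (One P) (lift tr) (lift (chi m)) m"
      unfolding sub_classifies_iff[OF l m] using chi_true_iff[OF mE] by auto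
  next
    fix c
    assume "c \<in> hom sub (Cod sub m) (Dom E (counit Om)) \<and> classifies sub (One P) (lift tr) c m"
    then have c: "c \<in> hom sub (Cod E m) (Dom E (counit Om))"
      and iff: "\<And>v. v \<in> Arr sub \<Longrightarrow> Cod E v = Cod E m \<Longrightarrow>
        counit Om \<cdot> (c \<cdot> v) = true_at (Dom E v) \<longleftrightarrow> factors_through E v m"
      using sub_classifies_iff[of c m] m by auto
    have cE: "c \<in> Arr E" "Dom E c = Cod E m" "Cod E c = Dom E (counit Om)" using c by auto
    obtain n where n: "monic E n" "Cod E n = Dom E (counit Om \<cdot> c)"
      "classifies E (One P) tr (counit Om \<cdot> c) n"
      by (rule comprehension[of "counit Om \<cdot> c"]) (use cE in auto)
    have n': "n \<in> Arr E" "Cod E n = Cod E m" "Dom E n \<in> Q"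
      using n cE m' Q_sub[OF n(1)] by auto
    have nv: "counit Om \<cdot> (c \<cdot> v) = true_at (Dom E v) \<longleftrightarrow> factors_through E v n"
      if "v \<in> Arr E" "Cod E v = Cod E m" for v
    proof -
      have "(counit Om \<cdot> c) \<cdot> v = true_at (Dom E v) \<longleftrightarrow> factors_through E v n"
        using n(3) that n' unfolding classifies_true_iff by metis
      then show ?thesis using that cE by simp
    qed
    have nm: "factors_through E n m" "factors_through E m n"
      using iff[of n] nv[of n] iff[of m] nv[of m] n' m'
        factors_through_self[of m] factors_through_self[of n] by auto
    have "factors_through E v m \<longleftrightarrow> factors_through E v n" if v: "v \<in> Arr E" for v
      using factors_through_trans nm m' n' by metis
    then have "counit Om \<cdot> c = chi m"
      using mE cE m' nv chi_true_iff[OF mE] by (intro omega_ext) auto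
    then show "c = lift (chi m)"
      using cE m' by (intro lift_unique[symmetric]) auto
  qed
qed auto

lemma sub_topos: "topos sub"
  unfolding topos_def
  using sub.category sub_finite_limits sub_cartesian_closed sub_classifier by blast

definition coreflector :: "('a, 'b, 'a, 'b) cfunctor" where
  "coreflector = \<lparr>fobj = (\<lambda>X. Dom E (counit X)), fmap = (\<lambda>f. lift (f \<cdot> counit (Dom E f)))\<rparr>"

lemma coreflector_functor: "cfunctor E sub coreflector"
  unfolding cfunctor_def coreflector_def
proof (simp, intro conjI allI impI ballI)
  fix X assume "X \<in> Obj E"
  then show "lift (counit X) = Idn E (Dom E (counit X))"
    by (intro lift_unique[of X]) auto
next
  fix f g assume "f \<in> Arr E \<and> g \<in> Arr E \<and> Dom E g = Cod E f"
  then show "lift (g \<cdot> (f \<cdot> counit (Dom E f))) =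
      lift (g \<cdot> counit (Cod E f)) \<cdot> lift (f \<cdot> counit (Dom E f))"
    by (intro lift_unique[of "Cod E g"]) auto
qed

lemma coreflector_adjoint: "left_adjoint sub E inclusion coreflector"
  unfolding left_adjoint_def
proof (intro conjI exI[of _ "\<lambda>X Y. lift"] ballI)
  show "cfunctor sub E inclusion" unfolding cfunctor_def by auto
  show "cfunctor E sub coreflector" by (rule coreflector_functor)
next
  fix X Y assume "X \<in> Obj sub" "Y \<in> Obj E"
  then have X: "X \<in> Q" and Y: "Y \<in> Obj E" by auto
  have "bij_betw lift (hom E X Y) (hom sub X (Dom E (counit Y)))"
  proof (rule bij_betw_byWitness[where f' = "\<lambda>u. counit Y \<cdot> u"])
    show "\<forall>g\<in>hom E X Y. counit Y \<cdot> lift g = g" using X by auto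
    show "\<forall>u\<in>hom sub X (Dom E (counit Y)). lift (counit Y \<cdot> u) = u"
      using X Y by (auto intro!: lift_unique[of Y])
  qed (use X Y in auto)
  then show "bij_betw lift (hom E (fobj inclusion X) Y) (hom sub X (fobj coreflector Y))"
    by (simp add: coreflector_def)
next
  fix X X' Y Y' a b g
  assume "X \<in> Obj sub" "X' \<in> Obj sub" "Y \<in> Obj E" "Y' \<in> Obj E" "a \<in> hom sub X' X"
    "b \<in> hom E Y Y'" "g \<in> hom E (fobj inclusion X) Y"
  then show "lift (b \<cdot> g \<cdot> fmap inclusion a) =
      Comp sub (Comp sub (fmap coreflector b) (lift g)) a"
    by (intro lift_unique[of Y']) (auto simp: coreflector_def)
qed

definition quotient :: "('a, 'b, 'a, 'b) geometric" where
  "quotient = \<lparr>target = sub, inverse_image = inclusion, direct_image = coreflector\<rparr>"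

lemma quotient_is_quotient: "is_quotient E quotient"
proof -
  have "preserves_finite_limits sub E inclusion"
    unfolding preserves_finite_limits_def using sub_limit_iff(1)
    by (auto simp: case_prod_unfold)
  moreover have "fully_faithful sub E inclusion"
    unfolding fully_faithful_def
    by (simp del: mem_hom_iff add: sub_hom bij_betw_def)
  ultimately show ?thesis
    unfolding is_quotient_def geometric_morphism_def quotient_def
    using sub_topos coreflector_adjoint by simp
qed

text \<open>An isomorphism is monic, so closure under subobjects makes \<open>Q\<close> closed under isomorphism.\<close>

lemma quotient_image_eq: "quotient_image E quotient = Q"
proof
  have "isomorphic E X X" if "X \<in> Q" for X
    unfolding isomorphic_def using that
    by (intro bexI[of _ "Idn E X"] conjI) auto
  then show "Q \<subseteq> quotient_image E quotient"
    unfolding quotient_image_def essential_image_def quotient_def by auto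
  show "quotient_image E quotient \<subseteq> Q"
  proof
    fix Y assume "Y \<in> quotient_image E quotient"
    then obtain X f g where X: "X \<in> Q" and fg: "f \<in> hom E X Y" "g \<in> hom E Y X"
      "g \<cdot> f = Idn E X" "f \<cdot> g = Idn E Y"
      unfolding quotient_image_def essential_image_def quotient_def isomorphic_def by auto
    then have "monic E g" by (intro monic_split[of f g]) auto
    then show "Y \<in> Q" using Q_sub[of g] fg X by auto
  qed
qed

end

section \<open>The local state classifier as an internal semilattice\<close>

context topos_cat
begin

text \<open>The functor \<open>- \<times> B\<close> is a left adjoint: transposing to arrows into an exponential reduces joint
epimorphy of the \<open>c i \<times> B\<close> to that of the \<open>c i\<close>.\<close>

lemma jointly_epic_times:
  assumes B: "B \<in> Obj E" and A: "A \<in> Obj E"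
    and c: "\<And>i. i \<in> I \<Longrightarrow> c i \<in> Arr E \<and> Cod E (c i) = A"
    and epi: "\<And>f g. f \<in> Arr E \<Longrightarrow> g \<in> Arr E \<Longrightarrow> Dom E f = A \<Longrightarrow> Dom E g = A \<Longrightarrow>
      Cod E f = Cod E g \<Longrightarrow> (\<And>i. i \<in> I \<Longrightarrow> f \<cdot> c i = g \<cdot> c i) \<Longrightarrow> f = g"
    and fg: "f \<in> Arr E" "g \<in> Arr E" "Dom E f = Prod P A B" "Dom E g = Prod P A B" "Cod E f = Cod E g"
    and eq: "\<And>i. i \<in> I \<Longrightarrow>
      f \<cdot> pair E P (c i \<cdot> Pr1 P (Dom E (c i)) B) (Pr2 P (Dom E (c i)) B) =
      g \<cdot> pair E P (c i \<cdot> Pr1 P (Dom E (c i)) B) (Pr2 P (Dom E (c i)) B)"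
  shows "f = g"
proof -
  obtain V ev where V: "V \<in> Obj E" and ev: "ev \<in> Arr E" "Dom E ev = Prod P V B" "Cod E ev = Cod E f"
    and univ: "\<And>Z f'. Z \<in> Obj E \<Longrightarrow> f' \<in> hom E (Prod P Z B) (Cod E f) \<Longrightarrow>
      \<exists>!g. g \<in> hom E Z V \<and> ev \<cdot> pair E P (g \<cdot> Pr1 P Z B) (Pr2 P Z B) = f'"
    using exponential_exists[OF B, of "Cod E f"] fg by (metis cod_obj mem_hom_iff)
  obtain a where a: "a \<in> Arr E" "Dom E a = A" "Cod E a = V"
    "ev \<cdot> pair E P (a \<cdot> Pr1 P A B) (Pr2 P A B) = f"
    using univ[OF A, of f] fg by (metis mem_hom_iff)
  obtain b where b: "b \<in> Arr E" "Dom E b = A" "Cod E b = V"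
    "ev \<cdot> pair E P (b \<cdot> Pr1 P A B) (Pr2 P A B) = g"
    using univ[OF A, of g] fg by (metis mem_hom_iff)
  have "a \<cdot> c i = b \<cdot> c i" if i: "i \<in> I" for i
  proof -
    let ?Z = "Dom E (c i)"
    let ?ci = "pair E P (c i \<cdot> Pr1 P ?Z B) (Pr2 P ?Z B)"
    have ci: "c i \<in> Arr E" "Cod E (c i) = A" "?Z \<in> Obj E" using c[OF i] by auto
    have 1: "ev \<cdot> pair E P ((a \<cdot> c i) \<cdot> Pr1 P ?Z B) (Pr2 P ?Z B) =
        (ev \<cdot> pair E P (a \<cdot> Pr1 P A B) (Pr2 P A B)) \<cdot> ?ci"
      using ci a(1-3) A B ev V by simp
    have 2: "ev \<cdot> pair E P ((b \<cdot> c i) \<cdot> Pr1 P ?Z B) (Pr2 P ?Z B) =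
        (ev \<cdot> pair E P (b \<cdot> Pr1 P A B) (Pr2 P A B)) \<cdot> ?ci"
      using ci b(1-3) A B ev V by simp
    have 3: "f \<cdot> ?ci \<in> hom E (Prod P ?Z B) (Cod E f)" using ci A B fg by auto
    have 4: "a \<cdot> c i \<in> hom E ?Z V" "b \<cdot> c i \<in> hom E ?Z V" using a b ci by auto
    show ?thesis
      using univ[OF ci(3) 3] 1 2 4 eq[OF i] a(4) b(4) by metis
  qed
  then have "a = b" using a(1-3) b(1-3) by - (rule epi, auto)
  then show "f = g" using a(4) b(4) by simp
qed

end

locale lsc = topos_cat +
  fixes Xi and xi
  assumes lsc: "local_state_classifier E Xi xi"
begin

lemma Xi_obj [simp]: "Xi \<in> Obj E"
  and xi_typing [simp]: "X \<in> Obj E \<Longrightarrow> xi X \<in> Arr E" "X \<in> Obj E \<Longrightarrow> Dom E (xi X) = X"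
    "X \<in> Obj E \<Longrightarrow> Cod E (xi X) = Xi"
  and xi_monic: "monic E m \<Longrightarrow> xi (Cod E m) \<cdot> m = xi (Dom E m)"
  using lsc unfolding local_state_classifier_def colimit_cocone_def cocone_def mono_subcategory_def
  by (auto simp: hom_def)

lemma xi_factor:
  assumes "\<And>X. X \<in> Obj E \<Longrightarrow> d X \<in> hom E X Y" "Y \<in> Obj E"
    and "\<And>m. monic E m \<Longrightarrow> d (Cod E m) \<cdot> m = d (Dom E m)"
  shows "\<exists>!u. u \<in> hom E Xi Y \<and> (\<forall>X\<in>Obj E. u \<cdot> xi X = d X)"
proof -
  have "cocone (mono_subcategory E) E \<lparr>fobj = (\<lambda>X. X), fmap = (\<lambda>m. m)\<rparr> Y d"
    unfolding cocone_def mono_subcategory_def using assms by (auto simp: hom_def)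
  then show ?thesis
    using lsc unfolding local_state_classifier_def colimit_cocone_def
    by (simp add: mono_subcategory_def)
qed

lemma xi_epic:
  assumes fg: "f \<in> Arr E" "g \<in> Arr E" "Dom E f = Xi" "Dom E g = Xi" "Cod E f = Cod E g"
    and "\<And>X. X \<in> Obj E \<Longrightarrow> f \<cdot> xi X = g \<cdot> xi X"
  shows "f = g"
proof -
  have "\<exists>!u. u \<in> hom E Xi (Cod E f) \<and> (\<forall>X\<in>Obj E. u \<cdot> xi X = f \<cdot> xi X)"
    by (rule xi_factor) (use fg xi_monic in auto)
  then show ?thesis using assms by (metis mem_hom_iff)
qed

lemma xi_times_epic:
  assumes "B \<in> Obj E"
    and "f \<in> Arr E" "g \<in> Arr E" "Dom E f = Prod P Xi B" "Dom E g = Prod P Xi B" "Cod E f = Cod E g"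
    and "\<And>X. X \<in> Obj E \<Longrightarrow> f \<cdot> pair E P (xi X \<cdot> Pr1 P X B) (Pr2 P X B) =
      g \<cdot> pair E P (xi X \<cdot> Pr1 P X B) (Pr2 P X B)"
  shows "f = g"
  by (rule jointly_epic_times[of B Xi "Obj E" xi]) (use assms xi_epic in auto)

text \<open>For the same reason \<open>\<Xi> \<times> B\<close> is the colimit of the objects \<open>X \<times> B\<close>: the transposes of a compatible
family form a cocone on \<open>\<Xi>\<close>.\<close>

lemma xi_times_factor:
  assumes B: "B \<in> Obj E" and d: "\<And>X. X \<in> Obj E \<Longrightarrow> d X \<in> hom E (Prod P X B) Y"
    and nat: "\<And>m. monic E m \<Longrightarrow>
      d (Cod E m) \<cdot> pair E P (m \<cdot> Pr1 P (Dom E m) B) (Pr2 P (Dom E m) B) = d (Dom E m)"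
  obtains u where "u \<in> hom E (Prod P Xi B) Y"
    "\<And>X. X \<in> Obj E \<Longrightarrow> u \<cdot> pair E P (xi X \<cdot> Pr1 P X B) (Pr2 P X B) = d X"
proof -
  have Y: "Y \<in> Obj E" using d[of "One P"] by auto
  obtain V ev where V: "V \<in> Obj E" and ev: "ev \<in> Arr E" "Dom E ev = Prod P V B" "Cod E ev = Y"
    and univ: "\<And>Z f'. Z \<in> Obj E \<Longrightarrow> f' \<in> hom E (Prod P Z B) Y \<Longrightarrow>
      \<exists>!g. g \<in> hom E Z V \<and> ev \<cdot> pair E P (g \<cdot> Pr1 P Z B) (Pr2 P Z B) = f'"
    using exponential_exists[OF B Y] by (metis mem_hom_iff)
  have "\<forall>X\<in>Obj E. \<exists>g. g \<in> hom E X V \<and> ev \<cdot> pair E P (g \<cdot> Pr1 P X B) (Pr2 P X B) = d X"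
    using univ d by blast
  then obtain k where k: "\<And>X. X \<in> Obj E \<Longrightarrow> k X \<in> hom E X V"
    "\<And>X. X \<in> Obj E \<Longrightarrow> ev \<cdot> pair E P (k X \<cdot> Pr1 P X B) (Pr2 P X B) = d X"
    by metis
  have k': "k X \<in> Arr E" "Dom E (k X) = X" "Cod E (k X) = V" if "X \<in> Obj E" for X
    using k(1)[OF that] by auto
  have "k (Cod E m) \<cdot> m = k (Dom E m)" if m: "monic E m" for m
  proof -
    let ?Z = "Dom E m"
    have m': "m \<in> Arr E" using m by simp
    have "(ev \<cdot> pair E P (k (Cod E m) \<cdot> Pr1 P (Cod E m) B) (Pr2 P (Cod E m) B)) \<cdot>
        pair E P (m \<cdot> Pr1 P ?Z B) (Pr2 P ?Z B) = d ?Z"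
      using k(2) nat[OF m] m' by simp
    then have "ev \<cdot> pair E P ((k (Cod E m) \<cdot> m) \<cdot> Pr1 P ?Z B) (Pr2 P ?Z B) = d ?Z"
      using k' m' B ev V by simp
    moreover have "k (Cod E m) \<cdot> m \<in> hom E ?Z V" using k' m' by auto
    ultimately show ?thesis
      using univ[of ?Z "d ?Z"] d[of ?Z] k[of ?Z] m' by (metis dom_obj)
  qed
  then obtain u where u: "u \<in> Arr E" "Dom E u = Xi" "Cod E u = V"
    "\<And>X. X \<in> Obj E \<Longrightarrow> u \<cdot> xi X = k X"
    using xi_factor[of k V] k(1) V by (metis mem_hom_iff)
  let ?u = "ev \<cdot> pair E P (u \<cdot> Pr1 P Xi B) (Pr2 P Xi B)"
  show ?thesis
  proof (rule that[of ?u])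
    show "?u \<in> hom E (Prod P Xi B) Y" using u(1-3) ev B V by auto
    fix X assume X: "X \<in> Obj E"
    have "?u \<cdot> pair E P (xi X \<cdot> Pr1 P X B) (Pr2 P X B) =
        ev \<cdot> pair E P ((u \<cdot> xi X) \<cdot> Pr1 P X B) (Pr2 P X B)"
      using u(1-3) ev B V X by simp
    also have "\<dots> = d X" using u(4) k(2) X by simp
    finally show "?u \<cdot> pair E P (xi X \<cdot> Pr1 P X B) (Pr2 P X B) = d X" .
  qed
qed

text \<open>The product of two jointly epic families, one being the colimit cocone, is jointly epic. It is
obtained by varying one factor at a time, with a swap of the factors in between.\<close>

lemma jointly_epic_times_xi:
  assumes A: "A \<in> Obj E"
    and c: "\<And>i. i \<in> I \<Longrightarrow> c i \<in> Arr E \<and> Cod E (c i) = A"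
    and epi: "\<And>f g. f \<in> Arr E \<Longrightarrow> g \<in> Arr E \<Longrightarrow> Dom E f = A \<Longrightarrow> Dom E g = A \<Longrightarrow>
      Cod E f = Cod E g \<Longrightarrow> (\<And>i. i \<in> I \<Longrightarrow> f \<cdot> c i = g \<cdot> c i) \<Longrightarrow> f = g"
    and fg: "f \<in> Arr E" "g \<in> Arr E" "Dom E f = Prod P A Xi" "Dom E g = Prod P A Xi" "Cod E f = Cod E g"
    and eq: "\<And>i Z. i \<in> I \<Longrightarrow> Z \<in> Obj E \<Longrightarrow>
      f \<cdot> pair E P (c i \<cdot> Pr1 P (Dom E (c i)) Z) (xi Z \<cdot> Pr2 P (Dom E (c i)) Z) =
      g \<cdot> pair E P (c i \<cdot> Pr1 P (Dom E (c i)) Z) (xi Z \<cdot> Pr2 P (Dom E (c i)) Z)"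
  shows "f = g"
proof (rule jointly_epic_times[OF Xi_obj A c epi fg])
  fix i assume i: "i \<in> I"
  define X where "X = Dom E (c i)"
  have ci: "c i \<in> Arr E" "Dom E (c i) = X" "Cod E (c i) = A" and X: "X \<in> Obj E"
    using c[OF i] X_def by auto
  let ?x = "pair E P (c i \<cdot> Pr1 P X Xi) (Pr2 P X Xi)"
  let ?s = "pair E P (Pr2 P Xi X) (Pr1 P Xi X)"
  have "(f \<cdot> ?x) \<cdot> ?s = (g \<cdot> ?x) \<cdot> ?s"
  proof (rule xi_times_epic[of X])
    fix Z assume Z: "Z \<in> Obj E"
    let ?t = "pair E P (Pr2 P Z X) (Pr1 P Z X)"
    have "(f \<cdot> pair E P (c i \<cdot> Pr1 P X Z) (xi Z \<cdot> Pr2 P X Z)) \<cdot> ?t =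
        (g \<cdot> pair E P (c i \<cdot> Pr1 P X Z) (xi Z \<cdot> Pr2 P X Z)) \<cdot> ?t"
      using eq[OF i Z] ci by simp
    then show "((f \<cdot> ?x) \<cdot> ?s) \<cdot> pair E P (xi Z \<cdot> Pr1 P Z X) (Pr2 P Z X) =
        ((g \<cdot> ?x) \<cdot> ?s) \<cdot> pair E P (xi Z \<cdot> Pr1 P Z X) (Pr2 P Z X)"
      using fg ci X Z by simp
  qed (use fg ci X in auto)
  then have "((f \<cdot> ?x) \<cdot> ?s) \<cdot> pair E P (Pr2 P X Xi) (Pr1 P X Xi) =
      ((g \<cdot> ?x) \<cdot> ?s) \<cdot> pair E P (Pr2 P X Xi) (Pr1 P X Xi)" by simp
  then show "f \<cdot> pair E P (c i \<cdot> Pr1 P (Dom E (c i)) Xi) (Pr2 P (Dom E (c i)) Xi) =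
      g \<cdot> pair E P (c i \<cdot> Pr1 P (Dom E (c i)) Xi) (Pr2 P (Dom E (c i)) Xi)"
    using fg ci X by simp
qed

lemma xi_prod_epic:
  assumes fg: "f \<in> Arr E" "g \<in> Arr E" "Dom E f = Prod P Xi Xi" "Dom E g = Prod P Xi Xi"
    "Cod E f = Cod E g"
    and eq: "\<And>X Y. X \<in> Obj E \<Longrightarrow> Y \<in> Obj E \<Longrightarrow>
      f \<cdot> pair E P (xi X \<cdot> Pr1 P X Y) (xi Y \<cdot> Pr2 P X Y) =
      g \<cdot> pair E P (xi X \<cdot> Pr1 P X Y) (xi Y \<cdot> Pr2 P X Y)"
  shows "f = g"
  by (rule jointly_epic_times_xi[of Xi "Obj E" xi]) (use assms xi_epic in auto)

lemma xi_triple_epic: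
  assumes fg: "f \<in> Arr E" "g \<in> Arr E" "Dom E f = Prod P (Prod P Xi Xi) Xi"
    "Dom E g = Prod P (Prod P Xi Xi) Xi" "Cod E f = Cod E g"
    and eq: "\<And>X Y Z. X \<in> Obj E \<Longrightarrow> Y \<in> Obj E \<Longrightarrow> Z \<in> Obj E \<Longrightarrow>
      f \<cdot> pair E P (pair E P (xi X \<cdot> (Pr1 P X Y \<cdot> Pr1 P (Prod P X Y) Z))
        (xi Y \<cdot> (Pr2 P X Y \<cdot> Pr1 P (Prod P X Y) Z))) (xi Z \<cdot> Pr2 P (Prod P X Y) Z) =
      g \<cdot> pair E P (pair E P (xi X \<cdot> (Pr1 P X Y \<cdot> Pr1 P (Prod P X Y) Z))
        (xi Y \<cdot> (Pr2 P X Y \<cdot> Pr1 P (Prod P X Y) Z))) (xi Z \<cdot> Pr2 P (Prod P X Y) Z)"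
  shows "f = g"
proof (rule jointly_epic_times_xi[of "Prod P Xi Xi" "Obj E \<times> Obj E"
      "\<lambda>(X, Y). pair E P (xi X \<cdot> Pr1 P X Y) (xi Y \<cdot> Pr2 P X Y)"])
  fix f g
  assume "f \<in> Arr E" "g \<in> Arr E" "Dom E f = Prod P Xi Xi" "Dom E g = Prod P Xi Xi"
    "Cod E f = Cod E g"
    "\<And>i. i \<in> Obj E \<times> Obj E \<Longrightarrow>
      f \<cdot> (case i of (X, Y) \<Rightarrow> pair E P (xi X \<cdot> Pr1 P X Y) (xi Y \<cdot> Pr2 P X Y)) =
      g \<cdot> (case i of (X, Y) \<Rightarrow> pair E P (xi X \<cdot> Pr1 P X Y) (xi Y \<cdot> Pr2 P X Y))"
  then show "f = g" by - (rule xi_prod_epic, auto)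
qed (use fg eq in auto)

abbreviation lmeet :: "'b" where
  "lmeet \<equiv> lsc_meet E P Xi xi"

text \<open>The arrow out of \<open>\<Xi> \<times> \<Xi>\<close> is glued in two steps. For fixed \<open>B\<close> the arrows \<open>\<xi>\<close> at \<open>X \<times> B\<close> glue to
\<open>e B: \<Xi> \<times> B \<rightarrow> \<Xi>\<close>; these are again compatible with monomorphisms in \<open>B\<close> and glue after swapping the
factors.\<close>

lemma lsc_meet_exists:
  obtains w where "w \<in> hom E (Prod P Xi Xi) Xi"
    "\<And>X Y. X \<in> Obj E \<Longrightarrow> Y \<in> Obj E \<Longrightarrow>
      w \<cdot> pair E P (xi X \<cdot> Pr1 P X Y) (xi Y \<cdot> Pr2 P X Y) = xi (Prod P X Y)"
proof -
  have "\<forall>B\<in>Obj E. \<exists>e. e \<in> hom E (Prod P Xi B) Xi \<and>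
    (\<forall>X\<in>Obj E. e \<cdot> pair E P (xi X \<cdot> Pr1 P X B) (Pr2 P X B) = xi (Prod P X B))"
  proof
    fix B assume B: "B \<in> Obj E"
    obtain e where "e \<in> hom E (Prod P Xi B) Xi"
      "\<And>X. X \<in> Obj E \<Longrightarrow> e \<cdot> pair E P (xi X \<cdot> Pr1 P X B) (Pr2 P X B) = xi (Prod P X B)"
    proof (rule xi_times_factor[OF B, of "\<lambda>X. xi (Prod P X B)" Xi])
      fix m assume m: "monic E m"
      then have m': "m \<in> Arr E" by simp
      have "monic E (pair E P (m \<cdot> Pr1 P (Dom E m) B) (Idn E B \<cdot> Pr2 P (Dom E m) B))"
        using monic_prod[OF m monic_idn[OF B]] B by simp
      from xi_monic[OF this]
      show "xi (Prod P (Cod E m) B) \<cdot> pair E P (m \<cdot> Pr1 P (Dom E m) B) (Pr2 P (Dom E m) B) =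
          xi (Prod P (Dom E m) B)"
        using m' B by simp
    qed (use B in auto)
    then show "\<exists>e. e \<in> hom E (Prod P Xi B) Xi \<and>
      (\<forall>X\<in>Obj E. e \<cdot> pair E P (xi X \<cdot> Pr1 P X B) (Pr2 P X B) = xi (Prod P X B))" by blast
  qed
  then obtain e where e: "\<And>B. B \<in> Obj E \<Longrightarrow> e B \<in> hom E (Prod P Xi B) Xi"
    "\<And>B X. B \<in> Obj E \<Longrightarrow> X \<in> Obj E \<Longrightarrow>
      e B \<cdot> pair E P (xi X \<cdot> Pr1 P X B) (Pr2 P X B) = xi (Prod P X B)"
    by metis
  have e': "e B \<in> Arr E" "Dom E (e B) = Prod P Xi B" "Cod E (e B) = Xi" if "B \<in> Obj E" for B
    using e(1)[OF that] by auto
  have natural: "e (Cod E n) \<cdot> pair E P (Pr1 P Xi (Dom E n)) (n \<cdot> Pr2 P Xi (Dom E n)) = e (Dom E n)"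
    if n: "monic E n" for n
  proof (rule xi_times_epic[of "Dom E n"])
    have n': "n \<in> Arr E" using n by simp
    fix X assume X: "X \<in> Obj E"
    let ?B = "Dom E n"
    have "monic E (pair E P (Idn E X \<cdot> Pr1 P X ?B) (n \<cdot> Pr2 P X ?B))"
      using monic_prod[OF monic_idn[OF X] n] X by simp
    from xi_monic[OF this]
    have x: "xi (Prod P X (Cod E n)) \<cdot> pair E P (Pr1 P X ?B) (n \<cdot> Pr2 P X ?B) = xi (Prod P X ?B)"
      using X n' by simp
    have "(e (Cod E n) \<cdot> pair E P (Pr1 P Xi ?B) (n \<cdot> Pr2 P Xi ?B)) \<cdot>
          pair E P (xi X \<cdot> Pr1 P X ?B) (Pr2 P X ?B) =
        (e (Cod E n) \<cdot> pair E P (xi X \<cdot> Pr1 P X (Cod E n)) (Pr2 P X (Cod E n))) \<cdot>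
          pair E P (Pr1 P X ?B) (n \<cdot> Pr2 P X ?B)"
      using X n' e' by simp
    also have "\<dots> = xi (Prod P X ?B)" using e(2)[of "Cod E n" X] X n' x by simp
    finally show "(e (Cod E n) \<cdot> pair E P (Pr1 P Xi ?B) (n \<cdot> Pr2 P Xi ?B)) \<cdot>
          pair E P (xi X \<cdot> Pr1 P X ?B) (Pr2 P X ?B) =
        e ?B \<cdot> pair E P (xi X \<cdot> Pr1 P X ?B) (Pr2 P X ?B)"
      using e(2)[of ?B X] X n' by simp
  qed (use e' n in auto)
  obtain u where u: "u \<in> hom E (Prod P Xi Xi) Xi"
    "\<And>B. B \<in> Obj E \<Longrightarrow> u \<cdot> pair E P (xi B \<cdot> Pr1 P B Xi) (Pr2 P B Xi) =
      e B \<cdot> pair E P (Pr2 P B Xi) (Pr1 P B Xi)"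
  proof (rule xi_times_factor[of Xi "\<lambda>B. e B \<cdot> pair E P (Pr2 P B Xi) (Pr1 P B Xi)" Xi])
    fix n assume n: "monic E n"
    let ?B = "Dom E n" and ?C = "Cod E n"
    have n': "n \<in> Arr E" using n by simp
    have "(e ?C \<cdot> pair E P (Pr2 P ?C Xi) (Pr1 P ?C Xi)) \<cdot>
        pair E P (n \<cdot> Pr1 P ?B Xi) (Pr2 P ?B Xi) =
      (e ?C \<cdot> pair E P (Pr1 P Xi ?B) (n \<cdot> Pr2 P Xi ?B)) \<cdot> pair E P (Pr2 P ?B Xi) (Pr1 P ?B Xi)"
      using n' e' by simp
    then show "(e ?C \<cdot> pair E P (Pr2 P ?C Xi) (Pr1 P ?C Xi)) \<cdot>
        pair E P (n \<cdot> Pr1 P ?B Xi) (Pr2 P ?B Xi) = e ?B \<cdot> pair E P (Pr2 P ?B Xi) (Pr1 P ?B Xi)"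
      using natural[OF n] by simp
  qed (use e' in auto)
  let ?w = "u \<cdot> pair E P (Pr2 P Xi Xi) (Pr1 P Xi Xi)"
  show ?thesis
  proof (rule that[of ?w])
    show "?w \<in> hom E (Prod P Xi Xi) Xi" using u(1) by auto
    fix X Y assume X: "X \<in> Obj E" and Y: "Y \<in> Obj E"
    have "?w \<cdot> pair E P (xi X \<cdot> Pr1 P X Y) (xi Y \<cdot> Pr2 P X Y) =
        (u \<cdot> pair E P (xi Y \<cdot> Pr1 P Y Xi) (Pr2 P Y Xi)) \<cdot> pair E P (Pr2 P X Y) (xi X \<cdot> Pr1 P X Y)"
      using u(1) X Y by simp
    also have "\<dots> = (e Y \<cdot> pair E P (Pr2 P Y Xi) (Pr1 P Y Xi)) \<cdot> pair E P (Pr2 P X Y) (xi X \<cdot> Pr1 P X Y)"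
      using u(2) Y by simp
    also have "\<dots> = e Y \<cdot> pair E P (xi X \<cdot> Pr1 P X Y) (Pr2 P X Y)"
      using e' X Y by simp
    finally show "?w \<cdot> pair E P (xi X \<cdot> Pr1 P X Y) (xi Y \<cdot> Pr2 P X Y) = xi (Prod P X Y)"
      using e(2) X Y by simp
  qed
qed

lemma lmeet_typing [simp]: "lmeet \<in> Arr E" "Dom E lmeet = Prod P Xi Xi" "Cod E lmeet = Xi"
  and lmeet_xi: "X \<in> Obj E \<Longrightarrow> Y \<in> Obj E \<Longrightarrow>
      lmeet \<cdot> pair E P (xi X \<cdot> Pr1 P X Y) (xi Y \<cdot> Pr2 P X Y) = xi (Prod P X Y)"
proof -
  let ?R = "\<lambda>w. w \<in> hom E (Prod P Xi Xi) Xi \<and>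
     (\<forall>X\<in>Obj E. \<forall>Y\<in>Obj E. w \<cdot> prod_map E P (xi X) (xi Y) = xi (Prod P X Y))"
  obtain w where w: "w \<in> hom E (Prod P Xi Xi) Xi"
    "\<And>X Y. X \<in> Obj E \<Longrightarrow> Y \<in> Obj E \<Longrightarrow>
      w \<cdot> pair E P (xi X \<cdot> Pr1 P X Y) (xi Y \<cdot> Pr2 P X Y) = xi (Prod P X Y)"
    using lsc_meet_exists by blast
  have "\<exists>!w. ?R w"
  proof (rule ex1I[of _ w])
    show "?R w" using w by (auto simp: prod_map_def)
    fix v assume "?R v"
    then have v: "v \<in> hom E (Prod P Xi Xi) Xi" and
      "\<And>X Y. X \<in> Obj E \<Longrightarrow> Y \<in> Obj E \<Longrightarrow>
        v \<cdot> pair E P (xi X \<cdot> Pr1 P X Y) (xi Y \<cdot> Pr2 P X Y) = xi (Prod P X Y)"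
      by (auto simp: prod_map_def)
    then show "v = w" using w by - (rule xi_prod_epic, auto)
  qed
  from theI'[OF this] have R: "?R lmeet" unfolding lsc_meet_def .
  then show "lmeet \<in> Arr E" "Dom E lmeet = Prod P Xi Xi" "Cod E lmeet = Xi" by auto
  show "lmeet \<cdot> pair E P (xi X \<cdot> Pr1 P X Y) (xi Y \<cdot> Pr2 P X Y) = xi (Prod P X Y)"
    if "X \<in> Obj E" "Y \<in> Obj E" for X Y
    using R that by (auto simp: prod_map_def)
qed

lemma lmeet_pair:
  assumes a: "a \<in> Arr E" "Cod E a = X" and b: "b \<in> Arr E" "Cod E b = Y" "Dom E b = Dom E a"
  shows "lmeet \<cdot> pair E P (xi X \<cdot> a) (xi Y \<cdot> b) = xi (Prod P X Y) \<cdot> pair E P a b"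
proof -
  have XY: "X \<in> Obj E" "Y \<in> Obj E" using a b by auto
  have "(lmeet \<cdot> pair E P (xi X \<cdot> Pr1 P X Y) (xi Y \<cdot> Pr2 P X Y)) \<cdot> pair E P a b =
      lmeet \<cdot> pair E P (xi X \<cdot> a) (xi Y \<cdot> b)"
    using a b XY by simp
  then show ?thesis using lmeet_xi[OF XY] by simp
qed

text \<open>The semilattice laws for \<open>\<Xi>\<close> are instances of this: each one compares meets taken along monic
tuples of arrows with the same domain, and such a meet depends on that domain alone.\<close>

lemma lmeet_pair_monic:
  assumes "a \<in> Arr E" "Cod E a = X" "b \<in> Arr E" "Cod E b = Y" "Dom E b = Dom E a"
    and "monic E (pair E P a b)"
  shows "lmeet \<cdot> pair E P (xi X \<cdot> a) (xi Y \<cdot> b) = xi (Dom E a)"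
  using lmeet_pair[OF assms(1-5)] xi_monic[OF assms(6)] assms(1-5) by simp

lemma lsc_semilattice: "internal_semilattice E P Xi (xi (One P)) lmeet"
proof -
  have 1: "lmeet \<cdot> pair E P (Idn E Xi) (xi (One P) \<cdot> bang E P Xi) = Idn E Xi"
  proof (rule xi_epic)
    fix X assume X: "X \<in> Obj E"
    have "lmeet \<cdot> pair E P (xi X \<cdot> Idn E X) (xi (One P) \<cdot> bang E P X) = xi X"
      using lmeet_pair_monic[of "Idn E X" X "bang E P X" "One P"] X
      by (simp add: monic_pair1 monic_idn)
    then show "(lmeet \<cdot> pair E P (Idn E Xi) (xi (One P) \<cdot> bang E P Xi)) \<cdot> xi X = Idn E Xi \<cdot> xi X"
      using X by simp
  qed auto
  have 4: "lmeet \<cdot> pair E P (Pr2 P Xi Xi) (Pr1 P Xi Xi) = lmeet"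
  proof (rule xi_prod_epic)
    fix X Y assume X: "X \<in> Obj E" and Y: "Y \<in> Obj E"
    have "monic E (pair E P (Pr2 P X Y) (Pr1 P X Y))"
      by (rule monic_split[of "pair E P (Pr2 P Y X) (Pr1 P Y X)"]) (use X Y in auto)
    then have "lmeet \<cdot> pair E P (xi Y \<cdot> Pr2 P X Y) (xi X \<cdot> Pr1 P X Y) = xi (Prod P X Y)"
      using lmeet_pair_monic[of "Pr2 P X Y" Y "Pr1 P X Y" X] X Y by simp
    then show "(lmeet \<cdot> pair E P (Pr2 P Xi Xi) (Pr1 P Xi Xi)) \<cdot>
        pair E P (xi X \<cdot> Pr1 P X Y) (xi Y \<cdot> Pr2 P X Y) =
        lmeet \<cdot> pair E P (xi X \<cdot> Pr1 P X Y) (xi Y \<cdot> Pr2 P X Y)"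
      using X Y lmeet_xi by simp
  qed auto
  have 2: "lmeet \<cdot> pair E P (xi (One P) \<cdot> bang E P Xi) (Idn E Xi) = Idn E Xi"
  proof -
    have "lmeet \<cdot> pair E P (xi (One P) \<cdot> bang E P Xi) (Idn E Xi) =
      (lmeet \<cdot> pair E P (Pr2 P Xi Xi) (Pr1 P Xi Xi)) \<cdot> pair E P (Idn E Xi) (xi (One P) \<cdot> bang E P Xi)"
      by simp
    then show ?thesis using 1 4 by simp
  qed
  have 5: "lmeet \<cdot> pair E P (Idn E Xi) (Idn E Xi) = Idn E Xi"
  proof (rule xi_epic)
    fix X assume X: "X \<in> Obj E"
    have "lmeet \<cdot> pair E P (xi X \<cdot> Idn E X) (xi X \<cdot> Idn E X) = xi X"
      using lmeet_pair_monic[of "Idn E X" X "Idn E X" X] X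
      by (simp add: monic_pair1 monic_idn)
    then show "(lmeet \<cdot> pair E P (Idn E Xi) (Idn E Xi)) \<cdot> xi X = Idn E Xi \<cdot> xi X"
      using X by simp
  qed auto
  let ?a = "pair E P (Pr1 P Xi Xi \<cdot> Pr1 P (Prod P Xi Xi) Xi)
           (pair E P (Pr2 P Xi Xi \<cdot> Pr1 P (Prod P Xi Xi) Xi) (Pr2 P (Prod P Xi Xi) Xi))"
  have 3: "lmeet \<cdot> prod_map E P lmeet (Idn E Xi) = lmeet \<cdot> prod_map E P (Idn E Xi) lmeet \<cdot> ?a"
  proof (rule xi_triple_epic)
    fix X Y Z assume X: "X \<in> Obj E" and Y: "Y \<in> Obj E" and Z: "Z \<in> Obj E"
    let ?T = "Prod P (Prod P X Y) Z"
    let ?p = "Pr1 P X Y \<cdot> Pr1 P (Prod P X Y) Z" and ?q = "Pr2 P X Y \<cdot> Pr1 P (Prod P X Y) Z"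
      and ?r = "Pr2 P (Prod P X Y) Z"
    let ?x = "pair E P (pair E P (xi X \<cdot> ?p) (xi Y \<cdot> ?q)) (xi Z \<cdot> ?r)"
    note objs = X Y Z
    have pq: "lmeet \<cdot> pair E P (xi X \<cdot> ?p) (xi Y \<cdot> ?q) = xi (Prod P X Y) \<cdot> Pr1 P (Prod P X Y) Z"
      using lmeet_pair[of ?p X ?q Y] objs by simp
    have qr: "lmeet \<cdot> pair E P (xi Y \<cdot> ?q) (xi Z \<cdot> ?r) = xi (Prod P Y Z) \<cdot> pair E P ?q ?r"
      using lmeet_pair[of ?q Y ?r Z] objs by simp
    have "(lmeet \<cdot> prod_map E P lmeet (Idn E Xi)) \<cdot> ?x =
        lmeet \<cdot> pair E P (lmeet \<cdot> pair E P (xi X \<cdot> ?p) (xi Y \<cdot> ?q)) (xi Z \<cdot> ?r)"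
      using objs by (simp add: prod_map_def)
    also have "\<dots> = xi ?T"
      unfolding pq using lmeet_pair_monic[of "Pr1 P (Prod P X Y) Z" "Prod P X Y" ?r Z] objs
      by (simp add: monic_idn)
    finally have l: "(lmeet \<cdot> prod_map E P lmeet (Idn E Xi)) \<cdot> ?x = xi ?T" .
    let ?b = "pair E P (pair E P (Pr1 P X (Prod P Y Z)) (Pr1 P Y Z \<cdot> Pr2 P X (Prod P Y Z)))
      (Pr2 P Y Z \<cdot> Pr2 P X (Prod P Y Z))"
    \<comment> \<open>The associativity isomorphism, with inverse \<open>?b\<close>.\<close>
    have assoc: "monic E (pair E P ?p (pair E P ?q ?r))"
      by (rule monic_split[of ?b]) (use objs in auto)
    have "(lmeet \<cdot> prod_map E P (Idn E Xi) lmeet \<cdot> ?a) \<cdot> ?x =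
        lmeet \<cdot> pair E P (xi X \<cdot> ?p) (lmeet \<cdot> pair E P (xi Y \<cdot> ?q) (xi Z \<cdot> ?r))"
      using objs by (simp add: prod_map_def)
    also have "\<dots> = xi ?T"
      unfolding qr using lmeet_pair_monic[of ?p X "pair E P ?q ?r" "Prod P Y Z"] assoc objs
      by simp
    finally show "(lmeet \<cdot> prod_map E P lmeet (Idn E Xi)) \<cdot> ?x =
        (lmeet \<cdot> prod_map E P (Idn E Xi) lmeet \<cdot> ?a) \<cdot> ?x"
      using l by simp
  qed (auto simp: prod_map_def)
  show ?thesis
    unfolding internal_semilattice_def using 1 2 3 4 5 by simp
qed

end

section \<open>Semilattice homomorphisms and hyperconnected classes\<close>

context lsc
begin

abbreviation homs :: "'b set" where
  "homs \<equiv> lsc_homs E P Om tr Xi xi"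

abbreviation objects :: "'b \<Rightarrow> 'a set" where
  "objects \<equiv> classified_objects E (One P) tr xi"

lemma mem_homs_iff:
  "h \<in> homs \<longleftrightarrow> h \<in> hom E Xi Om \<and> h \<cdot> xi (One P) = tr \<and>
    h \<cdot> lmeet = meet \<cdot> pair E P (h \<cdot> Pr1 P Xi Xi) (h \<cdot> Pr2 P Xi Xi)"
  unfolding lsc_homs_def semilattice_hom_def
  using omega_semilattice lsc_semilattice by (auto simp: prod_map_def)

lemma mem_objects_iff:
  assumes h: "h \<in> Arr E" "Dom E h = Xi" "Cod E h = Om"
  shows "X \<in> objects h \<longleftrightarrow> X \<in> Obj E \<and> h \<cdot> xi X = true_at X"
proof -
  obtain k where k: "monic E k" "Cod E k = Dom E h" "classifies E (One P) tr h k"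
    using comprehension h by blast
  have *: "h \<cdot> xi X = true_at X \<longleftrightarrow> factors_through E (xi X) k"
    if "X \<in> Obj E" "classifies E (One P) tr h k" for k
    using classifiesD(5)[OF that(2), of "xi X"] that(1) h by simp
  show ?thesis
    unfolding classified_objects_def using * k(3) by blast
qed

lemma hom_xi_prod:
  assumes "h \<in> homs" "X \<in> Obj E" "Y \<in> Obj E"
  shows "h \<cdot> xi (Prod P X Y) =
    meet \<cdot> pair E P (h \<cdot> (xi X \<cdot> Pr1 P X Y)) (h \<cdot> (xi Y \<cdot> Pr2 P X Y))"
proof -
  let ?x = "pair E P (xi X \<cdot> Pr1 P X Y) (xi Y \<cdot> Pr2 P X Y)"
  have h: "h \<in> Arr E" "Dom E h = Xi" "Cod E h = Om"
    "h \<cdot> lmeet = meet \<cdot> pair E P (h \<cdot> Pr1 P Xi Xi) (h \<cdot> Pr2 P Xi Xi)"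
    using assms(1) unfolding mem_homs_iff by auto
  have "h \<cdot> xi (Prod P X Y) = (h \<cdot> lmeet) \<cdot> ?x"
    using h(1-3) lmeet_xi assms(2,3) by simp
  also have "\<dots> = (meet \<cdot> pair E P (h \<cdot> Pr1 P Xi Xi) (h \<cdot> Pr2 P Xi Xi)) \<cdot> ?x"
    using h(4) by simp
  finally show ?thesis using h(1-3) assms(2,3) by simp
qed

text \<open>The graph of \<open>g\<close> is a monomorphism into \<open>Y \<times> X\<close>, hence \<open>\<xi>\<close> at \<open>Y\<close> is the meet of \<open>\<xi>\<close> at \<open>Y\<close> and of
\<open>\<xi>\<close> at \<open>X\<close> composed with \<open>g\<close>. Since \<open>h\<close> preserves meets, truth at \<open>Y\<close> forces truth along \<open>g\<close>.\<close>

lemma hom_xi_mono: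
  assumes h: "h \<in> homs" and g: "g \<in> Arr E" "Dom E g = Y" "Cod E g = X"
    and true: "h \<cdot> xi Y = true_at Y"
  shows "h \<cdot> (xi X \<cdot> g) = true_at Y"
proof -
  have XY: "X \<in> Obj E" "Y \<in> Obj E" using g by auto
  have h': "h \<in> Arr E" "Dom E h = Xi" "Cod E h = Om" using h unfolding mem_homs_iff by auto
  let ?g = "pair E P (Idn E Y) g"
  have "monic E ?g" using g XY by (intro monic_pair1 monic_idn) auto
  from xi_monic[OF this] have xi: "xi (Prod P Y X) \<cdot> ?g = xi Y" using g XY by simp
  have "h \<cdot> xi Y = (h \<cdot> xi (Prod P Y X)) \<cdot> ?g"
    using xi h' g XY by simp
  also have "\<dots> = meet \<cdot> pair E P (h \<cdot> xi Y) (h \<cdot> (xi X \<cdot> g))"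
    unfolding hom_xi_prod[OF h XY(2,1)] using h' g XY by simp
  finally have "meet \<cdot> pair E P (h \<cdot> xi Y) (h \<cdot> (xi X \<cdot> g)) = true_at Y" using true by simp
  then show ?thesis using h' g XY by simp
qed

text \<open>By \<open>hom_xi_mono\<close>, every arrow to \<open>X\<close> from an object of the class factors through the subobject where
\<open>h \<cdot> \<xi>\<close> is true; and this subobject is in the class by naturality of \<open>\<xi>\<close> in monomorphisms.\<close>

lemma hom_classifies_coreflection:
  assumes h: "h \<in> homs" and X: "X \<in> Obj E" and r: "classifies E (One P) tr (h \<cdot> xi X) r"
  shows "coreflection E (objects h) X r"
proof -
  have h': "h \<in> Arr E" "Dom E h = Xi" "Cod E h = Om" using h unfolding mem_homs_iff by auto
  have mono: "monic E r" and cod: "Cod E r = X"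
    and iff: "\<And>v. v \<in> Arr E \<Longrightarrow> Cod E v = X \<Longrightarrow> (h \<cdot> xi X) \<cdot> v = true_at (Dom E v) \<longleftrightarrow> factors_through E v r"
    using classifiesD[OF r] h' X by auto
  have r': "r \<in> Arr E" using mono by simp
  have "(h \<cdot> xi X) \<cdot> r = true_at (Dom E r)"
    using iff[OF r' cod] factors_through_self[OF r'] by blast
  then have "h \<cdot> xi (Dom E r) = true_at (Dom E r)"
    using xi_monic[OF mono] h' X r' cod by simp
  then have "Dom E r \<in> objects h" using mem_objects_iff[OF h'] r' by simp
  moreover have "\<exists>!u. u \<in> hom E (Dom E g) (Dom E r) \<and> r \<cdot> u = g"
    if g: "g \<in> Arr E" "Dom E g \<in> objects h" "Cod E g = X" for g
  proof -
    have "h \<cdot> (xi X \<cdot> g) = true_at (Dom E g)"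
      using hom_xi_mono[OF h g(1) refl g(3)] g(2) mem_objects_iff[OF h'] by simp
    then have "factors_through E g r" using iff[OF g(1,3)] h' g X by simp
    then obtain u where "u \<in> Arr E" "Dom E u = Dom E g" "Cod E u = Dom E r" "r \<cdot> u = g"
      by (rule factors_throughE)
    then show ?thesis
      using monicD[OF mono] by (intro ex1I[of _ u]) auto
  qed
  ultimately show ?thesis using r' cod unfolding coreflection_def by blast
qed

lemma hyperconnected_objects:
  assumes h: "h \<in> homs"
  shows "hyperconnected_class E P (objects h)"
  unfolding hyperconnected_class_def
proof (intro conjI allI ballI impI subsetI)
  have h': "h \<in> Arr E" "Dom E h = Xi" "Cod E h = Om" "h \<cdot> xi (One P) = tr"
    using h unfolding mem_homs_iff by auto
  note mem = mem_objects_iff[OF h'(1-3)]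
  show "One P \<in> objects h" unfolding mem using h' by (simp add: true_at_One)
  show "X \<in> Obj E" if "X \<in> objects h" for X using that unfolding mem by blast
  show "Prod P X Y \<in> objects h" if "X \<in> objects h" "Y \<in> objects h" for X Y
  proof -
    have XY: "X \<in> Obj E" "Y \<in> Obj E" and t: "h \<cdot> xi X = true_at X" "h \<cdot> xi Y = true_at Y"
      using that unfolding mem by auto
    have "h \<cdot> (xi X \<cdot> Pr1 P X Y) = true_at (Prod P X Y)"
      using comp_eq_extend[OF t(1), of "Pr1 P X Y"] h' XY by simp
    moreover have "h \<cdot> (xi Y \<cdot> Pr2 P X Y) = true_at (Prod P X Y)"
      using comp_eq_extend[OF t(2), of "Pr2 P X Y"] h' XY by simp
    ultimately show ?thesis
      unfolding mem using hom_xi_prod[OF h XY] XY by simp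
  qed
  show "Dom E m \<in> objects h" if m: "monic E m" "Cod E m \<in> objects h" for m
  proof -
    have t: "h \<cdot> xi (Cod E m) = true_at (Cod E m)" using m(2) unfolding mem by blast
    have "h \<cdot> (xi (Cod E m) \<cdot> m) = true_at (Cod E m) \<cdot> m"
      by (rule comp_eq_extend[OF t]) (use m h' in auto)
    then show ?thesis unfolding mem using xi_monic[OF m(1)] m(1) by simp
  qed
  show "\<exists>r. coreflection E (objects h) X r" if X: "X \<in> Obj E" for X
  proof -
    obtain r where "classifies E (One P) tr (h \<cdot> xi X) r"
      using comprehension[of "h \<cdot> xi X"] h' X by auto
    then show ?thesis using hom_classifies_coreflection[OF h X] by blast
  qed
qed

text \<open>The class determines the coreflection of each \<open>X\<close>, which in turn is classified by \<open>h \<cdot> \<xi>\<close> at \<open>X\<close>.\<close>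

lemma objects_inject:
  assumes h: "h \<in> homs" and k: "k \<in> homs" and eq: "objects h = objects k"
  shows "h = k"
proof (rule xi_epic)
  have h': "h \<in> Arr E" "Dom E h = Xi" "Cod E h = Om" using h unfolding mem_homs_iff by auto
  have k': "k \<in> Arr E" "Dom E k = Xi" "Cod E k = Om" using k unfolding mem_homs_iff by auto
  show "h \<in> Arr E" "k \<in> Arr E" "Dom E h = Xi" "Dom E k = Xi" "Cod E h = Cod E k"
    using h' k' by auto
  fix X assume X: "X \<in> Obj E"
  obtain r where r: "classifies E (One P) tr (h \<cdot> xi X) r"
    using comprehension[of "h \<cdot> xi X"] h' X by auto
  obtain s where s: "classifies E (One P) tr (k \<cdot> xi X) s"
    using comprehension[of "k \<cdot> xi X"] k' X by auto
  have cr: "coreflection E (objects h) X r" by (rule hom_classifies_coreflection[OF h X r])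
  have cs: "coreflection E (objects h) X s"
    using hom_classifies_coreflection[OF k X s] eq by simp
  have rs: "factors_through E r s" "factors_through E s r" "r \<in> Arr E" "s \<in> Arr E"
    using coreflection_factors[OF cr] coreflection_factors[OF cs] cr cs
    unfolding coreflection_def by auto
  show "h \<cdot> xi X = k \<cdot> xi X"
  proof (rule omega_ext)
    fix v assume v: "v \<in> Arr E" "Cod E v = Dom E (h \<cdot> xi X)"
    have "factors_through E v r \<longleftrightarrow> factors_through E v s"
      using rs factors_through_trans by blast
    then show "(h \<cdot> xi X) \<cdot> v = true_at (Dom E v) \<longleftrightarrow> (k \<cdot> xi X) \<cdot> v = true_at (Dom E v)"
      using classifiesD(5)[OF r, of v] classifiesD(5)[OF s, of v] v h' k' X by simp
  qed (use h' k' X in auto)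
qed

text \<open>The homomorphism is glued from the characteristic morphisms of the coreflections. Compatibility
with monomorphisms, and preservation of meets, say that the coreflection of a subobject is its
intersection with the coreflection of the whole, and that the coreflection of a product is the product of the
coreflections.\<close>

lemma hyperconnected_class_has_hom:
  assumes "hyperconnected_class E P Q"
  obtains h where "h \<in> homs" "objects h = Q"
proof -
  interpret Q: hyperconnected E P Om tr Q
    by unfold_locales (rule assms)
  let ?d = "\<lambda>X. chi (Q.counit X)"
  have counit_iff: "?d X \<cdot> v = true_at (Dom E v) \<longleftrightarrow> factors_through E v (Q.counit X)"
    if "X \<in> Obj E" "v \<in> Arr E" "Cod E v = X" for X v
    using chi_true_iff[of "Q.counit X" v] that by simp
  have fac: "factors_through E g (Q.counit X)"
    if "g \<in> Arr E" "Dom E g \<in> Q" "Cod E g = X" for g X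
    using coreflection_factors[OF Q.counit] that by auto
  have natural: "?d (Cod E m) \<cdot> m = ?d (Dom E m)" if m: "monic E m" for m
  proof (rule omega_ext)
    have m': "m \<in> Arr E" using m by simp
    fix v assume "v \<in> Arr E" "Cod E v = Dom E (?d (Cod E m) \<cdot> m)"
    then have v: "v \<in> Arr E" "Cod E v = Dom E m" using m' by auto
    let ?s = "Q.counit (Cod E m)" and ?r = "Q.counit (Dom E m)"
    have "factors_through E (m \<cdot> v) ?s \<longleftrightarrow> factors_through E v ?r"
    proof
      assume "factors_through E (m \<cdot> v) ?s"
      then obtain u where u: "u \<in> Arr E" "Dom E u = Dom E (m \<cdot> v)" "Cod E u = Dom E ?s"
        "?s \<cdot> u = m \<cdot> v"
        by (rule factors_throughE)
      \<comment> \<open>The intersection \<open>q\<close> of \<open>m\<close> with the coreflection \<open>?s\<close> is a subobject of an object of \<open>Q\<close>.\<close>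
      obtain q where q: "monic E q" "Cod E q = Dom E (chi m \<cdot> ?s)"
        "classifies E (One P) tr (chi m \<cdot> ?s) q"
        by (rule comprehension[of "chi m \<cdot> ?s"]) (use m in auto)
      have q': "q \<in> Arr E" "Cod E q = Dom E ?s" "Dom E q \<in> Q"
        using q m m' Q.Q_sub[OF q(1)] by auto
      have q_iff: "chi m \<cdot> (?s \<cdot> w) = true_at (Dom E w) \<longleftrightarrow> factors_through E w q"
        if "w \<in> Arr E" "Cod E w = Dom E ?s" for w
      proof -
        have "(chi m \<cdot> ?s) \<cdot> w = true_at (Dom E w) \<longleftrightarrow> factors_through E w q"
          using classifiesD(5)[OF q(3), of w] that m m' by simp
        then show ?thesis using that m m' by simp
      qed
      have "chi m \<cdot> (m \<cdot> v) = true_at (Dom E (m \<cdot> v))"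
        using chi_true_iff[OF m, of "m \<cdot> v"] v m' by (auto intro: factors_throughI)
      then have "factors_through E u q"
        using q_iff[of u] u v m' by simp
      then obtain w where w: "w \<in> Arr E" "Dom E w = Dom E u" "Cod E w = Dom E q" "q \<cdot> w = u"
        by (rule factors_throughE)
      have "chi m \<cdot> (?s \<cdot> q) = true_at (Dom E (?s \<cdot> q))"
        using q_iff[of q] q' m' factors_through_self[of q] by simp
      then have "factors_through E (?s \<cdot> q) m"
        using chi_true_iff[OF m, of "?s \<cdot> q"] q' m' by simp
      then obtain p where p: "p \<in> Arr E" "Dom E p = Dom E q" "Cod E p = Dom E m" "m \<cdot> p = ?s \<cdot> q"
        using q' m' by (elim factors_throughE) auto
      have "m \<cdot> (p \<cdot> w) = m \<cdot> v"
      proof -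
        have "m \<cdot> (p \<cdot> w) = (?s \<cdot> q) \<cdot> w"
          by (rule comp_eq_extend[OF p(4)]) (use p w m' in auto)
        also have "\<dots> = ?s \<cdot> (q \<cdot> w)" using q' w m' by simp
        finally show ?thesis using w u by simp
      qed
      then have "p \<cdot> w = v"
        by (rule monicD[OF m]) (use p w v u m' in auto)
      moreover have "factors_through E p ?r" using p q' by (intro fac) auto
      then have "factors_through E (p \<cdot> w) ?r"
        by (rule factors_through_comp) (use p w m' in auto)
      ultimately show "factors_through E v ?r" by simp
    next
      assume "factors_through E v ?r"
      then obtain u where u: "u \<in> Arr E" "Dom E u = Dom E v" "Cod E u = Dom E ?r" "?r \<cdot> u = v"
        by (rule factors_throughE)
      have "factors_through E (m \<cdot> ?r) ?s" using m' by (intro fac) auto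
      then have "factors_through E ((m \<cdot> ?r) \<cdot> u) ?s"
        by (rule factors_through_comp) (use m' u in auto)
      then show "factors_through E (m \<cdot> v) ?s" using u m' by simp
    qed
    then show "(?d (Cod E m) \<cdot> m) \<cdot> v = true_at (Dom E v) \<longleftrightarrow>
        ?d (Dom E m) \<cdot> v = true_at (Dom E v)"
      using counit_iff[of "Cod E m" "m \<cdot> v"] counit_iff[of "Dom E m" v] v m' by simp
  qed (use m in auto)
  have "\<exists>!h. h \<in> hom E Xi Om \<and> (\<forall>X\<in>Obj E. h \<cdot> xi X = ?d X)"
    by (rule xi_factor[OF _ _ natural]) auto
  then obtain h where h: "h \<in> Arr E" "Dom E h = Xi" "Cod E h = Om"
    and hxi: "\<And>X. X \<in> Obj E \<Longrightarrow> h \<cdot> xi X = ?d X"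
    by (metis mem_hom_iff)
  have factors_iff: "h \<cdot> xi X = true_at X \<longleftrightarrow> X \<in> Q" if X: "X \<in> Obj E" for X
  proof -
    have "h \<cdot> xi X = true_at X \<longleftrightarrow> factors_through E (Idn E X) (Q.counit X)"
      using counit_iff[OF X, of "Idn E X"] hxi[OF X] X by simp
    also have "\<dots> \<longleftrightarrow> X \<in> Q"
    proof
      assume "factors_through E (Idn E X) (Q.counit X)"
      then obtain u where u: "u \<in> Arr E" "Dom E u = X" "Cod E u = Dom E (Q.counit X)"
        "Q.counit X \<cdot> u = Idn E X"
        using X by (elim factors_throughE) auto
      then have "monic E u" using X by (intro monic_split[of "Q.counit X"]) auto
      then show "X \<in> Q" using Q.Q_sub[of u] u X by simp
    qed (use X in \<open>auto intro: fac\<close>)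
    finally show ?thesis .
  qed
  have objs: "objects h = Q"
    using mem_objects_iff[OF h] factors_iff Q.Q_obj by blast
  have "h \<cdot> lmeet = meet \<cdot> pair E P (h \<cdot> Pr1 P Xi Xi) (h \<cdot> Pr2 P Xi Xi)"
  proof (rule xi_prod_epic)
    fix X Y assume X: "X \<in> Obj E" and Y: "Y \<in> Obj E"
    let ?x = "pair E P (xi X \<cdot> Pr1 P X Y) (xi Y \<cdot> Pr2 P X Y)"
    have "(h \<cdot> lmeet) \<cdot> ?x = ?d (Prod P X Y)"
      using h X Y lmeet_xi hxi by simp
    also have "\<dots> = meet \<cdot> pair E P (?d X \<cdot> Pr1 P X Y) (?d Y \<cdot> Pr2 P X Y)"
    proof (rule omega_ext)
      fix v assume "v \<in> Arr E" "Cod E v = Dom E (?d (Prod P X Y))"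
      then have v: "v \<in> Arr E" "Cod E v = Prod P X Y" using X Y by auto
      let ?r = "Q.counit (Prod P X Y)"
      have "factors_through E v ?r \<longleftrightarrow>
        factors_through E (Pr1 P X Y \<cdot> v) (Q.counit X) \<and> factors_through E (Pr2 P X Y \<cdot> v) (Q.counit Y)"
        (is "_ \<longleftrightarrow> ?R")
      proof
        assume "factors_through E v ?r"
        then obtain u where u: "u \<in> Arr E" "Dom E u = Dom E v" "Cod E u = Dom E ?r" "?r \<cdot> u = v"
          by (rule factors_throughE)
        have "factors_through E (Pr1 P X Y \<cdot> ?r) (Q.counit X)" "factors_through E (Pr2 P X Y \<cdot> ?r) (Q.counit Y)"
          using X Y by (auto intro!: fac)
        then have "factors_through E ((Pr1 P X Y \<cdot> ?r) \<cdot> u) (Q.counit X)"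
          "factors_through E ((Pr2 P X Y \<cdot> ?r) \<cdot> u) (Q.counit Y)"
          using factors_through_comp[of "Pr1 P X Y \<cdot> ?r" "Q.counit X" u]
            factors_through_comp[of "Pr2 P X Y \<cdot> ?r" "Q.counit Y" u] u X Y by auto
        then show ?R using u X Y by simp
      next
        assume ?R
        then obtain a b where a: "a \<in> Arr E" "Dom E a = Dom E v" "Cod E a = Dom E (Q.counit X)"
            "Q.counit X \<cdot> a = Pr1 P X Y \<cdot> v"
          and b: "b \<in> Arr E" "Dom E b = Dom E v" "Cod E b = Dom E (Q.counit Y)"
            "Q.counit Y \<cdot> b = Pr2 P X Y \<cdot> v"
          using v X Y by (elim conjE factors_throughE) auto
        let ?A = "Dom E (Q.counit X)" and ?B = "Dom E (Q.counit Y)"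
        let ?rr = "pair E P (Q.counit X \<cdot> Pr1 P ?A ?B) (Q.counit Y \<cdot> Pr2 P ?A ?B)"
        have "factors_through E ?rr ?r" using X Y by (intro fac) auto
        then have "factors_through E (?rr \<cdot> pair E P a b) ?r"
          by (rule factors_through_comp) (use X Y a b in auto)
        moreover have "?rr \<cdot> pair E P a b = v" using X Y a b v by simp
        ultimately show "factors_through E v ?r" by simp
      qed
      then show "?d (Prod P X Y) \<cdot> v = true_at (Dom E v) \<longleftrightarrow>
          (meet \<cdot> pair E P (?d X \<cdot> Pr1 P X Y) (?d Y \<cdot> Pr2 P X Y)) \<cdot> v = true_at (Dom E v)"
        using counit_iff[of "Prod P X Y" v] counit_iff[of X "Pr1 P X Y \<cdot> v"]
          counit_iff[of Y "Pr2 P X Y \<cdot> v"] v X Y by simp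
    qed (use X Y in auto)
    also have "\<dots> = meet \<cdot> pair E P ((h \<cdot> xi X) \<cdot> Pr1 P X Y) ((h \<cdot> xi Y) \<cdot> Pr2 P X Y)"
      using hxi X Y by simp
    also have "\<dots> = (meet \<cdot> pair E P (h \<cdot> Pr1 P Xi Xi) (h \<cdot> Pr2 P Xi Xi)) \<cdot> ?x"
      using h X Y by simp
    finally show "(h \<cdot> lmeet) \<cdot> ?x = (meet \<cdot> pair E P (h \<cdot> Pr1 P Xi Xi) (h \<cdot> Pr2 P Xi Xi)) \<cdot> ?x" .
  qed (use h in auto)
  moreover have "h \<cdot> xi (One P) = tr"
    using factors_iff[of "One P"] by (simp add: true_at_One)
  ultimately have "h \<in> homs" unfolding mem_homs_iff using h by simp
  then show ?thesis using that objs by blast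
qed

end

section \<open>Boolean toposes: the subobject classifier is a coproduct of two points\<close>

locale boolean_topos = topos_cat +
  assumes boolean: "boolean E"
begin

text \<open>Stages at which all truth values agree; they are the stages that admit an arrow to an initial
object.\<close>

definition degenerate :: "'a \<Rightarrow> bool" where
  "degenerate V \<longleftrightarrow> (\<forall>a\<in>hom E V Om. \<forall>b\<in>hom E V Om. a = b)"

lemma degenerateD:
  "degenerate V \<Longrightarrow> a \<in> Arr E \<Longrightarrow> b \<in> Arr E \<Longrightarrow> Dom E a = V \<Longrightarrow> Dom E b = V \<Longrightarrow>
    Cod E a = Om \<Longrightarrow> Cod E b = Om \<Longrightarrow> a = b"
  unfolding degenerate_def by simp

text \<open>The subterminal object of those stages at which every truth value is true: the equalizer of the
names \<open>1 \<rightarrow> \<Omega>\<^sup>\<Omega>\<close> of the constant truth function and of the identity.\<close>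

lemma zero_exists:
  "\<exists>z. monic E z \<and> Cod E z = One P \<and> (\<forall>v\<in>Arr E. Cod E v = Dom E z \<longrightarrow> degenerate (Dom E v))"
proof -
  obtain V ev where V: "V \<in> Obj E" and ev: "ev \<in> Arr E" "Dom E ev = Prod P V Om" "Cod E ev = Om"
    and univ: "\<And>Z f. Z \<in> Obj E \<Longrightarrow> f \<in> hom E (Prod P Z Om) Om \<Longrightarrow>
      \<exists>!g. g \<in> hom E Z V \<and> ev \<cdot> pair E P (g \<cdot> Pr1 P Z Om) (Pr2 P Z Om) = f"
    using exponential_exists[OF Om_obj Om_obj] by (metis mem_hom_iff)
  obtain k where k: "k \<in> Arr E" "Dom E k = One P" "Cod E k = V"
    "ev \<cdot> pair E P (k \<cdot> Pr1 P (One P) Om) (Pr2 P (One P) Om) = true_at (Prod P (One P) Om)"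
    using univ[of "One P" "true_at (Prod P (One P) Om)"] by auto
  obtain l where l: "l \<in> Arr E" "Dom E l = One P" "Cod E l = V"
    "ev \<cdot> pair E P (l \<cdot> Pr1 P (One P) Om) (Pr2 P (One P) Om) = Pr2 P (One P) Om"
    using univ[of "One P" "Pr2 P (One P) Om"] by auto
  obtain z where z: "monic E z" "Cod E z = Dom E k" "k \<cdot> z = l \<cdot> z"
    by (rule equalizer_exists[of k l]) (use k l in auto)
  have z': "z \<in> Arr E" "Cod E z = One P" using z k by auto
  have "a = true_at (Dom E v)"
    if v: "v \<in> Arr E" "Cod E v = Dom E z" and a: "a \<in> Arr E" "Dom E a = Dom E v" "Cod E a = Om" for v a
  proof -
    let ?w = "pair E P (z \<cdot> v) a"
    have "k \<cdot> (z \<cdot> v) = l \<cdot> (z \<cdot> v)"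
      using comp_eq_extend[OF z(3), of v] v z' k l by simp
    moreover have "(ev \<cdot> pair E P (k \<cdot> Pr1 P (One P) Om) (Pr2 P (One P) Om)) \<cdot> ?w =
        ev \<cdot> pair E P (k \<cdot> (z \<cdot> v)) a"
      using k(1-3) ev V v a z' by simp
    moreover have "(ev \<cdot> pair E P (l \<cdot> Pr1 P (One P) Om) (Pr2 P (One P) Om)) \<cdot> ?w =
        ev \<cdot> pair E P (l \<cdot> (z \<cdot> v)) a"
      using l(1-3) ev V v a z' by simp
    ultimately have "true_at (Prod P (One P) Om) \<cdot> ?w = Pr2 P (One P) Om \<cdot> ?w"
      using k(4) l(4) by simp
    then show ?thesis using v a z' by simp
  qed
  then have "degenerate (Dom E v)" if "v \<in> Arr E" "Cod E v = Dom E z" for v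
    using that unfolding degenerate_def by (metis mem_hom_iff)
  then show ?thesis using z z' by blast
qed

definition zero :: 'b where
  "zero = (SOME z. monic E z \<and> Cod E z = One P \<and>
     (\<forall>v\<in>Arr E. Cod E v = Dom E z \<longrightarrow> degenerate (Dom E v)))"

lemma zero [simp]: "monic E zero" "Cod E zero = One P"
  and into_zero_degenerate: "v \<in> Arr E \<Longrightarrow> Cod E v = Dom E zero \<Longrightarrow> degenerate (Dom E v)"
  using someI_ex[OF zero_exists] unfolding zero_def by auto

text \<open>The truth value false.\<close>

definition ff :: 'b where
  "ff = chi zero"

lemma ff_typing [simp]: "ff \<in> Arr E" "Dom E ff = One P" "Cod E ff = Om"
  unfolding ff_def by auto

lemma monic_from_One:
  assumes "x \<in> Arr E" "Dom E x = One P"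
  shows "monic E x"
  by (rule monicI) (use assms in \<open>auto intro: to_One_eq\<close>)

lemma chi_point:
  assumes x: "x \<in> Arr E" "Dom E x = One P" and w: "w \<in> Arr E" "Cod E w = Cod E x" "Dom E w = W"
  shows "chi x \<cdot> w = true_at W \<longleftrightarrow> w = x \<cdot> bang E P W"
proof -
  have W: "W \<in> Obj E" using w by auto
  have "factors_through E w x \<longleftrightarrow> w = x \<cdot> bang E P W"
  proof
    assume "factors_through E w x"
    then obtain u where u: "u \<in> Arr E" "Dom E u = Dom E w" "Cod E u = Dom E x" "x \<cdot> u = w"
      by (rule factors_throughE)
    then have "u = bang E P W" using w x by (intro to_One_eq) auto
    then show "w = x \<cdot> bang E P W" using u by simp
  next
    assume "w = x \<cdot> bang E P W"
    then show "factors_through E w x"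
      by (intro factors_throughI[of x "bang E P W"]) (use x W in auto)
  qed
  then show ?thesis using chi_true_iff[OF monic_from_One[OF x] w(1,2)] w(3) by simp
qed

lemma false_true_degenerate:
  assumes "V \<in> Obj E" "ff \<cdot> bang E P V = true_at V"
  shows "degenerate V"
proof -
  have "factors_through E (bang E P V) zero"
    using chi_true_iff[of zero "bang E P V"] assms unfolding ff_def by simp
  then obtain u where "u \<in> Arr E" "Dom E u = Dom E (bang E P V)" "Cod E u = Dom E zero"
    by (rule factors_throughE)
  then show ?thesis using into_zero_degenerate[of u] assms(1) by simp
qed

text \<open>Equality of arrows from a stage is itself a truth value at that stage.\<close>

lemma degenerate_points_eq:
  assumes V: "degenerate V" and f: "f \<in> Arr E" "Dom E f = V" "Cod E f = X"
    and y: "y \<in> Arr E" "Dom E y = One P" "Cod E y = X"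
  shows "f = y \<cdot> bang E P V"
proof -
  have "V \<in> Obj E" using f by auto
  then have "chi y \<cdot> f = true_at V"
    using f y monic_from_One[of y] by (intro degenerateD[OF V]) auto
  then show ?thesis using chi_point[of y f V] f y by simp
qed

text \<open>Let \<open>m\<close> be the part of \<open>W\<close> where \<open>a\<close> is true and \<open>n\<close> a complement of \<open>m\<close>. The intersection of
\<open>m\<close> and \<open>n\<close> is the least subobject of \<open>W\<close>, hence degenerate, so \<open>a\<close> is false on \<open>n\<close>. Thus \<open>c\<close> contains \<open>m\<close>
and \<open>n\<close>, and so everything.\<close>

lemma true_false_cover:
  assumes a: "a \<in> Arr E" "Dom E a = W" "Cod E a = Om"
    and c: "monic E c" "Cod E c = W"
    and cov: "\<And>u. u \<in> Arr E \<Longrightarrow> Cod E u = W \<Longrightarrow>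
      a \<cdot> u = true_at (Dom E u) \<or> a \<cdot> u = ff \<cdot> bang E P (Dom E u) \<Longrightarrow> factors_through E u c"
  shows "factors_through E (Idn E W) c"
proof -
  have W: "W \<in> Obj E" using a by auto
  obtain m where m: "monic E m" "Cod E m = W" "classifies E (One P) tr a m"
    using comprehension[of a] a by metis
  have m': "m \<in> Arr E" using m by simp
  obtain n where n: "monic E n" "Cod E n = W" and comp: "complements E W m n"
    using boolean W m unfolding boolean_def subobjects_def by blast
  have n': "n \<in> Arr E" using n by simp
  have am: "a \<cdot> v = true_at (Dom E v) \<longleftrightarrow> factors_through E v m" if "v \<in> Arr E" "Cod E v = W" for v
    using classifiesD(5)[OF m(3), of v] a that by simp
  have "factors_through E m c"
    using cov[of m] am[of m] m m' factors_through_self[of m] by simp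
  moreover have "a \<cdot> n = ff \<cdot> bang E P (Dom E n)"
  proof (rule omega_ext)
    fix v assume "v \<in> Arr E" "Cod E v = Dom E (a \<cdot> n)"
    then have v: "v \<in> Arr E" "Cod E v = Dom E n" using a n n' by auto
    have nv: "(a \<cdot> n) \<cdot> v = a \<cdot> (n \<cdot> v)" using a n n' v by simp
    have fv: "(ff \<cdot> bang E P (Dom E n)) \<cdot> v = ff \<cdot> bang E P (Dom E v)" using v n' by simp
    have "degenerate (Dom E v)" if anv: "a \<cdot> (n \<cdot> v) = true_at (Dom E v)"
    proof -
      obtain p where p: "monic E p" "Cod E p = Dom E (a \<cdot> n)" "classifies E (One P) tr (a \<cdot> n) p"
        by (rule comprehension[of "a \<cdot> n"]) (use a n n' in auto)
      have p': "p \<in> Arr E" "Cod E p = Dom E n" using p a n n' by auto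
      have anp: "(a \<cdot> n) \<cdot> w = true_at (Dom E w) \<longleftrightarrow> factors_through E w p"
        if "w \<in> Arr E" "Cod E w = Dom E n" for w
        using classifiesD(5)[OF p(3), of w] a n n' that by simp
      obtain w where w: "w \<in> Arr E" "Dom E w = Dom E v" "Cod E w = Dom E p"
        using anp[OF v] nv anv by (auto elim: factors_throughE)
      let ?a = "n \<cdot> p"
      have "a \<cdot> (n \<cdot> p) = true_at (Dom E p)"
        using anp[of p] p' factors_through_self[of p] a n n' by simp
      then have "factors_through E ?a m" using am[of ?a] n n' p' by simp
      moreover have "factors_through E ?a n"
        by (rule factors_throughI[of n p]) (use n' p' in auto)
      moreover have "?a \<in> subobjects E W"
        unfolding subobjects_def using n n' p p' monic_comp[of p n] by simp
      \<comment> \<open>The product with \<open>zero\<close> is a subobject of \<open>W\<close> with only degenerate elements.\<close>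
      moreover let ?b = "Pr2 P (Dom E zero) W"
      have z': "zero \<in> Arr E" by simp
      have "monic E ?b"
      proof (rule monicI)
        fix f g
        assume fg: "f \<in> Arr E" "g \<in> Arr E" "Dom E f = Dom E g" "Cod E f = Dom E ?b"
          "Cod E g = Dom E ?b" "?b \<cdot> f = ?b \<cdot> g"
        have "zero \<cdot> (Pr1 P (Dom E zero) W \<cdot> f) = zero \<cdot> (Pr1 P (Dom E zero) W \<cdot> g)"
          using fg z' W by (intro to_One_eq) auto
        then have "Pr1 P (Dom E zero) W \<cdot> f = Pr1 P (Dom E zero) W \<cdot> g"
          by (rule monicD[OF zero(1)]) (use fg z' W in auto)
        then show "f = g"
          using fg z' W by - (rule pair_eqI[of f g "Dom E zero" W], auto)
      qed (use z' W in auto)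
      then have "?b \<in> subobjects E W" unfolding subobjects_def using W z' by simp
      ultimately have "factors_through E ?a ?b"
        using comp unfolding complements_def by blast
      then obtain l where l: "l \<in> Arr E" "Dom E l = Dom E ?a" "Cod E l = Dom E ?b"
        by (rule factors_throughE)
      have "degenerate (Dom E (Pr1 P (Dom E zero) W \<cdot> (l \<cdot> w)))"
        by (rule into_zero_degenerate) (use l w z' W n' p' in auto)
      then show ?thesis using l w z' W n' p' by simp
    qed
    moreover have "a \<cdot> (n \<cdot> v) = true_at (Dom E v) \<and> ff \<cdot> bang E P (Dom E v) = true_at (Dom E v)"
      if "degenerate (Dom E v)"
      using a n n' v by (intro conjI degenerateD[OF that]) auto
    ultimately show "(a \<cdot> n) \<cdot> v = true_at (Dom E v) \<longleftrightarrow>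
        (ff \<cdot> bang E P (Dom E n)) \<cdot> v = true_at (Dom E v)"
      unfolding nv fv using false_true_degenerate[of "Dom E v"] dom_obj[OF v(1)] by blast
  qed (use a n n' in auto)
  then have "factors_through E n c" using cov[of n] n n' by simp
  moreover have "c \<in> subobjects E W" "Idn E W \<in> subobjects E W"
    unfolding subobjects_def using c W monic_idn by auto
  ultimately show ?thesis
    using comp unfolding complements_def by blast
qed

text \<open>The equalizer of \<open>f\<close> and \<open>g\<close> covers \<open>W\<close> by \<open>true_false_cover\<close>. In particular, true and false are
jointly epic points of \<open>\<Omega>\<close>.\<close>

lemma eq_by_cases:
  assumes a: "a \<in> Arr E" "Dom E a = W" "Cod E a = Om"
    and fg: "f \<in> Arr E" "g \<in> Arr E" "Dom E f = W" "Dom E g = W" "Cod E f = Cod E g"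
    and cov: "\<And>u. u \<in> Arr E \<Longrightarrow> Cod E u = W \<Longrightarrow>
      a \<cdot> u = true_at (Dom E u) \<or> a \<cdot> u = ff \<cdot> bang E P (Dom E u) \<Longrightarrow> f \<cdot> u = g \<cdot> u"
  shows "f = g"
proof -
  have W: "W \<in> Obj E" using a by auto
  obtain e where e: "monic E e" "Cod E e = Dom E f" "f \<cdot> e = g \<cdot> e"
    and fac: "\<And>v. v \<in> Arr E \<Longrightarrow> Cod E v = Dom E f \<Longrightarrow> f \<cdot> v = g \<cdot> v \<Longrightarrow> factors_through E v e"
    by (rule equalizer_exists[of f g]) (use fg in auto)
  have "factors_through E (Idn E W) e"
    by (rule true_false_cover[OF a e(1)]) (use e fg cov in \<open>auto intro!: fac\<close>)
  then obtain t where t: "t \<in> Arr E" "Dom E t = Dom E (Idn E W)" "Cod E t = Dom E e" "e \<cdot> t = Idn E W"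
    by (rule factors_throughE)
  have "f \<cdot> (e \<cdot> t) = (g \<cdot> e) \<cdot> t"
    by (rule comp_eq_extend[OF e(3)]) (use e t fg in auto)
  also have "\<dots> = g \<cdot> (e \<cdot> t)" using e t fg by simp
  finally show "f = g" using t(4) fg W by simp
qed

text \<open>The order \<open>a \<le> b\<close> of truth values, expressed by an equation between arrows and hence representable
by an equalizer.\<close>

lemma meet_eq_left_iff:
  assumes ab: "a \<in> Arr E" "b \<in> Arr E" "Dom E a = V" "Dom E b = V" "Cod E a = Om" "Cod E b = Om"
  shows "meet \<cdot> pair E P a b = a \<longleftrightarrow>
    (\<forall>u\<in>Arr E. Cod E u = V \<longrightarrow> a \<cdot> u = true_at (Dom E u) \<longrightarrow> b \<cdot> u = true_at (Dom E u))"
proof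
  assume eq: "meet \<cdot> pair E P a b = a"
  show "\<forall>u\<in>Arr E. Cod E u = V \<longrightarrow> a \<cdot> u = true_at (Dom E u) \<longrightarrow> b \<cdot> u = true_at (Dom E u)"
  proof (intro ballI impI)
    fix u assume u: "u \<in> Arr E" "Cod E u = V" "a \<cdot> u = true_at (Dom E u)"
    have "(meet \<cdot> pair E P a b) \<cdot> u = true_at (Dom E u)" using eq u by simp
    then show "b \<cdot> u = true_at (Dom E u)" using u ab by simp
  qed
next
  assume *: "\<forall>u\<in>Arr E. Cod E u = V \<longrightarrow> a \<cdot> u = true_at (Dom E u) \<longrightarrow> b \<cdot> u = true_at (Dom E u)"
  show "meet \<cdot> pair E P a b = a"
    by (rule omega_ext) (use ab * in auto)
qed

text \<open>The graph of the copairing is the subobject \<open>e\<close> of \<open>\<Omega> \<times> X\<close> consisting of the pairs \<open>(w, z)\<close> with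
\<open>z = x\<close> where \<open>w\<close> is true and \<open>z = y\<close> where \<open>w\<close> is false. By \<open>eq_by_cases\<close>, \<open>z\<close> is determined by \<open>w\<close>, so the
projection of the graph to \<open>\<Omega>\<close> is monic. It contains the points true and false, and therefore
is invertible by \<open>true_false_cover\<close>.\<close>

lemma copairing:
  assumes x: "x \<in> Arr E" "Dom E x = One P" "Cod E x = X"
    and y: "y \<in> Arr E" "Dom E y = One P" "Cod E y = X"
  obtains s where "s \<in> hom E Om X" "s \<cdot> tr = x" "s \<cdot> ff = y"
proof -
  have X: "X \<in> Obj E" using x by auto
  have mono: "monic E x" "monic E y" "monic E ff"
    using x y by (auto intro: monic_from_One)
  let ?w = "Pr1 P Om X" and ?z = "Pr2 P Om X"
  \<comment> \<open>The two implications are \<open>w \<le> (z = x)\<close> and \<open>\<not> w \<le> (z = y)\<close>; \<open>chi x\<close>, \<open>chi y\<close>, \<open>chi ff\<close> denote equality with these points.\<close>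
  let ?f = "pair E P (meet \<cdot> pair E P ?w (chi x \<cdot> ?z)) (meet \<cdot> pair E P (chi ff \<cdot> ?w) (chi y \<cdot> ?z))"
  let ?g = "pair E P ?w (chi ff \<cdot> ?w)"
  define graph where "graph w z \<longleftrightarrow> (\<forall>u\<in>Arr E. Cod E u = Dom E w \<longrightarrow>
      (w \<cdot> u = true_at (Dom E u) \<longrightarrow> z \<cdot> u = x \<cdot> bang E P (Dom E u)) \<and>
      (w \<cdot> u = ff \<cdot> bang E P (Dom E u) \<longrightarrow> z \<cdot> u = y \<cdot> bang E P (Dom E u)))" for w z
  have graph_iff: "?f \<cdot> pair E P w z = ?g \<cdot> pair E P w z \<longleftrightarrow> graph w z"
    if w: "w \<in> Arr E" "Cod E w = Om" and z: "z \<in> Arr E" "Cod E z = X" "Dom E z = Dom E w" for w z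
  proof -
    have "?f \<cdot> pair E P w z = pair E P (meet \<cdot> pair E P w (chi x \<cdot> z)) (meet \<cdot> pair E P (chi ff \<cdot> w) (chi y \<cdot> z))"
      "?g \<cdot> pair E P w z = pair E P w (chi ff \<cdot> w)"
      using w z mono x y X by simp_all
    moreover have "pair E P (meet \<cdot> pair E P w (chi x \<cdot> z)) (meet \<cdot> pair E P (chi ff \<cdot> w) (chi y \<cdot> z)) =
        pair E P w (chi ff \<cdot> w) \<longleftrightarrow> meet \<cdot> pair E P w (chi x \<cdot> z) = w \<and>
        meet \<cdot> pair E P (chi ff \<cdot> w) (chi y \<cdot> z) = chi ff \<cdot> w" (is "?l = ?r \<longleftrightarrow> ?c")
    proof
      assume eq: "?l = ?r"
      show ?c
        using pair_inject[OF eq] w z mono x y by simp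
    qed simp
    moreover have "meet \<cdot> pair E P w (chi x \<cdot> z) = w \<longleftrightarrow> (\<forall>u\<in>Arr E. Cod E u = Dom E w \<longrightarrow>
        w \<cdot> u = true_at (Dom E u) \<longrightarrow> z \<cdot> u = x \<cdot> bang E P (Dom E u))"
      using meet_eq_left_iff[of w "chi x \<cdot> z" "Dom E w"] w z mono x chi_point[OF x(1,2)] by simp
    moreover have "meet \<cdot> pair E P (chi ff \<cdot> w) (chi y \<cdot> z) = chi ff \<cdot> w \<longleftrightarrow>
        (\<forall>u\<in>Arr E. Cod E u = Dom E w \<longrightarrow>
          w \<cdot> u = ff \<cdot> bang E P (Dom E u) \<longrightarrow> z \<cdot> u = y \<cdot> bang E P (Dom E u))"
      using meet_eq_left_iff[of "chi ff \<cdot> w" "chi y \<cdot> z" "Dom E w"] w z mono y chi_point[OF y(1,2)]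
        chi_point[OF ff_typing(1,2)] by simp
    ultimately show ?thesis unfolding graph_def by metis
  qed
  obtain e where e: "monic E e" "Cod E e = Dom E ?f" "?f \<cdot> e = ?g \<cdot> e"
    and fac: "\<And>v. v \<in> Arr E \<Longrightarrow> Cod E v = Dom E ?f \<Longrightarrow> ?f \<cdot> v = ?g \<cdot> v \<Longrightarrow> factors_through E v e"
    by (rule equalizer_exists[of ?f ?g]) (use mono x y X in auto)
  have e': "e \<in> Arr E" "Cod E e = Prod P Om X" using e mono x y X by auto
  let ?c = "?w \<cdot> e"
  have c: "?c \<in> Arr E" "Dom E ?c = Dom E e" "Cod E ?c = Om" using e' X by auto
  have point: "\<exists>k. k \<in> hom E (One P) (Dom E e) \<and> e \<cdot> k = pair E P t p"
    if t: "t \<in> Arr E" "Dom E t = One P" "Cod E t = Om" and p: "p \<in> Arr E" "Dom E p = One P" "Cod E p = X"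
      and "graph t p" for t p
  proof -
    have "factors_through E (pair E P t p) e"
      using graph_iff[of t p] that mono x y X by (intro fac) auto
    then show ?thesis using t p by (elim factors_throughE) auto
  qed
  have "graph tr x"
    unfolding graph_def
  proof (intro ballI impI conjI)
    fix u assume u: "u \<in> Arr E" "Cod E u = Dom E tr"
    then have "u = bang E P (Dom E u)" by (intro to_One_eq) auto
    then show "x \<cdot> u = x \<cdot> bang E P (Dom E u)" by metis
    assume "tr \<cdot> u = ff \<cdot> bang E P (Dom E u)"
    then have "degenerate (Dom E u)"
      using false_true_degenerate[of "Dom E u"] tr_comp[of u] u by simp
    then show "x \<cdot> u = y \<cdot> bang E P (Dom E u)"
      by (rule degenerate_points_eq) (use u x y in auto)
  qed
  then obtain k where k: "k \<in> Arr E" "Dom E k = One P" "Cod E k = Dom E e" "e \<cdot> k = pair E P tr x"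
    using point[of tr x] x by auto
  have "graph ff y"
    unfolding graph_def
  proof (intro ballI impI conjI)
    fix u assume u: "u \<in> Arr E" "Cod E u = Dom E ff"
    then have ub: "u = bang E P (Dom E u)" by (intro to_One_eq) auto
    then show "y \<cdot> u = y \<cdot> bang E P (Dom E u)" by metis
    assume "ff \<cdot> u = true_at (Dom E u)"
    then have "degenerate (Dom E u)"
      using false_true_degenerate[of "Dom E u"] u ub by simp
    then show "y \<cdot> u = x \<cdot> bang E P (Dom E u)"
      by (rule degenerate_points_eq) (use u x y in auto)
  qed
  then obtain l where l: "l \<in> Arr E" "Dom E l = One P" "Cod E l = Dom E e" "e \<cdot> l = pair E P ff y"
    using point[of ff y] y by auto
  have ck: "?c \<cdot> k = tr" "?z \<cdot> (e \<cdot> k) = x" and cl: "?c \<cdot> l = ff" "?z \<cdot> (e \<cdot> l) = y"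
    using k l e' X x y by auto
  have monic_c: "monic E ?c"
  proof (rule monicI)
    fix f g
    assume "f \<in> Arr E" "g \<in> Arr E" "Dom E f = Dom E g" "Cod E f = Dom E ?c"
      "Cod E g = Dom E ?c" "?c \<cdot> f = ?c \<cdot> g"
    then have fg: "f \<in> Arr E" "g \<in> Arr E" "Dom E f = Dom E g" "Cod E f = Dom E e"
      "Cod E g = Dom E e" and wfg: "?w \<cdot> (e \<cdot> f) = ?w \<cdot> (e \<cdot> g)"
      using e' X by auto
    have gr: "graph (?w \<cdot> (e \<cdot> h)) (?z \<cdot> (e \<cdot> h))" if h: "h \<in> Arr E" "Cod E h = Dom E e" for h
    proof -
      have "?f \<cdot> (e \<cdot> h) = (?g \<cdot> e) \<cdot> h"
        by (rule comp_eq_extend[OF e(3)]) (use e' h mono x y X in auto)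
      also have "\<dots> = ?g \<cdot> (e \<cdot> h)"
        by (rule comp_assoc) (use e' h mono x y X in auto)
      finally have "?f \<cdot> pair E P (?w \<cdot> (e \<cdot> h)) (?z \<cdot> (e \<cdot> h)) = ?g \<cdot> pair E P (?w \<cdot> (e \<cdot> h)) (?z \<cdot> (e \<cdot> h))"
        using pair_Pr[of "e \<cdot> h" Om X] e' h X by simp
      then show ?thesis
        using graph_iff[of "?w \<cdot> (e \<cdot> h)" "?z \<cdot> (e \<cdot> h)"] e' h X by simp
    qed
    have "?z \<cdot> (e \<cdot> f) = ?z \<cdot> (e \<cdot> g)"
    proof (rule eq_by_cases[of "?w \<cdot> (e \<cdot> f)" "Dom E f"])
      fix u assume u: "u \<in> Arr E" "Cod E u = Dom E f"
        "(?w \<cdot> (e \<cdot> f)) \<cdot> u = true_at (Dom E u) \<or> (?w \<cdot> (e \<cdot> f)) \<cdot> u = ff \<cdot> bang E P (Dom E u)"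
      have du: "Cod E u = Dom E (?w \<cdot> (e \<cdot> f))" "Cod E u = Dom E (?w \<cdot> (e \<cdot> g))"
        using u fg e' X by auto
      show "(?z \<cdot> (e \<cdot> f)) \<cdot> u = (?z \<cdot> (e \<cdot> g)) \<cdot> u"
        using gr[OF fg(1,4)] gr[OF fg(2,5)] u(1,3) du wfg unfolding graph_def by metis
    qed (use fg e' X in auto)
    then have "e \<cdot> f = e \<cdot> g"
      using wfg fg e' X by - (rule pair_eqI[of _ _ Om X], auto)
    then show "f = g"
      by (rule monicD[OF e(1)]) (use fg in auto)
  qed (rule c(1))
  have "factors_through E (Idn E Om) ?c"
  proof (rule true_false_cover[OF _ _ _ monic_c c(3)])
    fix u assume u: "u \<in> Arr E" "Cod E u = Om"
      "Idn E Om \<cdot> u = true_at (Dom E u) \<or> Idn E Om \<cdot> u = ff \<cdot> bang E P (Dom E u)"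
    have V: "Dom E u \<in> Obj E" using u by simp
    have "?c \<cdot> (k \<cdot> bang E P (Dom E u)) = tr \<cdot> bang E P (Dom E u)"
      by (rule comp_eq_extend[OF ck(1)]) (use k c V in auto)
    moreover have "?c \<cdot> (l \<cdot> bang E P (Dom E u)) = ff \<cdot> bang E P (Dom E u)"
      by (rule comp_eq_extend[OF cl(1)]) (use l c V in auto)
    moreover have "u = tr \<cdot> bang E P (Dom E u) \<or> u = ff \<cdot> bang E P (Dom E u)"
      using u by (simp add: true_at_def)
    ultimately obtain j where "?c \<cdot> j = u" "j \<in> Arr E" "Cod E j = Dom E ?c"
      using k l c V comp_typing by (metis bang_typing)
    then show "factors_through E u ?c" using c by (intro factors_throughI) auto
  qed auto
  then obtain t where t: "t \<in> Arr E" "Dom E t = Dom E (Idn E Om)" "Cod E t = Dom E ?c" "?c \<cdot> t = Idn E Om"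
    by (rule factors_throughE)
  have t': "Dom E t = Om" "Cod E t = Dom E e" using t c by auto
  have "?c \<cdot> (t \<cdot> tr) = ?c \<cdot> k"
    using comp_eq_extend[OF t(4), of tr] t(1) t' c ck by simp
  then have "t \<cdot> tr = k"
    by (rule monicD[OF monic_c]) (use t(1) t' k c in auto)
  moreover have "?c \<cdot> (t \<cdot> ff) = ?c \<cdot> l"
    using comp_eq_extend[OF t(4), of ff] t(1) t' c cl by simp
  then have "t \<cdot> ff = l"
    by (rule monicD[OF monic_c]) (use t(1) t' l c in auto)
  ultimately have "(?z \<cdot> (e \<cdot> t)) \<cdot> tr = x" "(?z \<cdot> (e \<cdot> t)) \<cdot> ff = y"
    using t(1) t' e' X ck(2) cl(2) by simp_all
  moreover have "?z \<cdot> (e \<cdot> t) \<in> hom E Om X" using t(1) t' e' X by auto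
  ultimately show ?thesis using that by blast
qed

end

section \<open>Quotients of a Boolean topos\<close>

context boolean_topos
begin

text \<open>The only closure property that does not follow from limits at once is the one under subobjects. A
subobject is the equalizer of its characteristic morphism and truth, so it suffices that \<open>\<Omega>\<close> is in \<open>Q\<close>.
The points true and false lift to the coreflection \<open>r\<close> of \<open>\<Omega>\<close>, and the copairing \<open>s\<close> of the lifts
satisfies \<open>r \<cdot> s = 1\<close>, as both sides agree on the two points; then \<open>s \<cdot> r = 1\<close> by universality.\<close>

lemma hyperconnectedI:
  assumes Q: "Q \<subseteq> Obj E"
    and lim: "\<And>I D K X p. finite_diagram E I D K \<Longrightarrow> (\<And>i. i \<in> I \<Longrightarrow> D i \<in> Q) \<Longrightarrow>
      limit_cone E I D K X p \<Longrightarrow> X \<in> Q"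
    and coref: "\<And>X. X \<in> Obj E \<Longrightarrow> \<exists>r. coreflection E Q X r"
  shows "hyperconnected_class E P Q"
proof -
  have One: "One P \<in> Q"
  proof (rule lim[of "{}" "\<lambda>_. One P" "{}"])
    show "limit_cone E {} (\<lambda>_. One P) {} (One P) (\<lambda>_. tr)"
      unfolding limit_cone_def cone_def
      using terminal_One unfolding terminal_def by auto
  qed (auto simp: finite_diagram_def)
  have Prod: "Prod P X Y \<in> Q" if X: "X \<in> Q" and Y: "Y \<in> Q" for X Y
  proof (rule lim[of "{0, 1}" "\<lambda>i. if i = 0 then X else Y" "{}"])
    have XY: "X \<in> Obj E" "Y \<in> Obj E" using X Y Q by auto
    show "limit_cone E {0, 1} (\<lambda>i. if i = 0 then X else Y) {} (Prod P X Y)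
        (\<lambda>i. if i = 0 then Pr1 P X Y else Pr2 P X Y)"
      unfolding limit_cone_def
    proof (intro conjI allI impI)
      show "cone E {0, 1} (\<lambda>i. if i = 0 then X else Y) {} (Prod P X Y)
        (\<lambda>i. if i = 0 then Pr1 P X Y else Pr2 P X Y)"
        unfolding cone_def using XY by auto
      fix Z q assume "cone E {0, 1} (\<lambda>i. if i = 0 then X else Y) {} Z q"
      then have q: "q 0 \<in> hom E Z X" "q 1 \<in> hom E Z Y" unfolding cone_def by auto
      show "\<exists>!u. u \<in> hom E Z (Prod P X Y) \<and>
          (\<forall>i\<in>{0, 1}. (if i = 0 then Pr1 P X Y else Pr2 P X Y) \<cdot> u = q i)"
        using product[OF XY] q unfolding is_product_def by simp
    qed
  qed (use X Y Q in \<open>auto simp: finite_diagram_def\<close>)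
  \<comment> \<open>Isomorphic copies are limits of diagrams with one vertex.\<close>
  have iso: "Y \<in> Q" if r: "r \<in> hom E Y X" "s \<in> hom E X Y" "r \<cdot> s = Idn E X" "s \<cdot> r = Idn E Y"
    and X: "X \<in> Q" for r s X Y
  proof (rule lim[of "{0}" "\<lambda>_. X" "{}"])
    show "limit_cone E {0} (\<lambda>_. X) {} Y (\<lambda>_. r)"
      unfolding limit_cone_def
    proof (intro conjI allI impI)
      show "cone E {0} (\<lambda>_. X) {} Y (\<lambda>_. r)" unfolding cone_def using r by auto
      fix Z q assume "cone E {0} (\<lambda>_. X) {} Z q"
      then have q: "q 0 \<in> Arr E" "Dom E (q 0) = Z" "Cod E (q 0) = X" unfolding cone_def by auto
      show "\<exists>!u. u \<in> hom E Z Y \<and> (\<forall>i\<in>{0}. r \<cdot> u = q i)"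
      proof (rule ex1I[of _ "s \<cdot> q 0"])
        show "s \<cdot> q 0 \<in> hom E Z Y \<and> (\<forall>i\<in>{0}. r \<cdot> (s \<cdot> q 0) = q i)"
          using comp_eq_extend[OF r(3), of "q 0"] r q by simp
        fix u assume u: "u \<in> hom E Z Y \<and> (\<forall>i\<in>{0}. r \<cdot> u = q i)"
        then have "s \<cdot> (r \<cdot> u) = Idn E Y \<cdot> u"
          using r by (intro comp_eq_extend[OF r(4)]) auto
        then show "u = s \<cdot> q 0" using u by simp
      qed
    qed
  qed (use X Q in \<open>auto simp: finite_diagram_def\<close>)
  have Om: "Om \<in> Q"
  proof -
    obtain r where cr: "coreflection E Q Om r" using coref[OF Om_obj] by blast
    then have r: "r \<in> Arr E" "Cod E r = Om" "Dom E r \<in> Q"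
      and univ: "\<And>g. g \<in> Arr E \<Longrightarrow> Dom E g \<in> Q \<Longrightarrow> Cod E g = Om \<Longrightarrow>
        \<exists>!u. u \<in> hom E (Dom E g) (Dom E r) \<and> r \<cdot> u = g"
      unfolding coreflection_def by auto
    obtain t where t: "t \<in> Arr E" "Dom E t = One P" "Cod E t = Dom E r" "r \<cdot> t = tr"
      using univ[of tr] One by auto
    obtain f where f: "f \<in> Arr E" "Dom E f = One P" "Cod E f = Dom E r" "r \<cdot> f = ff"
      using univ[of ff] One by auto
    obtain s where s: "s \<in> hom E Om (Dom E r)" "s \<cdot> tr = t" "s \<cdot> ff = f"
      using copairing[OF t(1-3) f(1-3)] by blast
    have s': "s \<in> Arr E" "Dom E s = Om" "Cod E s = Dom E r" using s by auto
    have rs_tr: "(r \<cdot> s) \<cdot> tr = tr" and rs_ff: "(r \<cdot> s) \<cdot> ff = ff"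
      using s(2,3) s' r t f by simp_all
    have rs: "r \<cdot> s = Idn E Om"
    proof (rule eq_by_cases[of "Idn E Om" Om])
      fix u assume u: "u \<in> Arr E" "Cod E u = Om"
        "Idn E Om \<cdot> u = true_at (Dom E u) \<or> Idn E Om \<cdot> u = ff \<cdot> bang E P (Dom E u)"
      have "(r \<cdot> s) \<cdot> (tr \<cdot> bang E P (Dom E u)) = tr \<cdot> bang E P (Dom E u)"
        by (rule comp_eq_extend[OF rs_tr]) (use u s' r in auto)
      moreover have "(r \<cdot> s) \<cdot> (ff \<cdot> bang E P (Dom E u)) = ff \<cdot> bang E P (Dom E u)"
        by (rule comp_eq_extend[OF rs_ff]) (use u s' r in auto)
      moreover have "u = tr \<cdot> bang E P (Dom E u) \<or> u = ff \<cdot> bang E P (Dom E u)"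
        using u by (simp add: true_at_def)
      ultimately have "(r \<cdot> s) \<cdot> u = u" by metis
      then show "(r \<cdot> s) \<cdot> u = Idn E Om \<cdot> u" using u by simp
    qed (use s' r in auto)
    have "\<exists>!u. u \<in> hom E (Dom E r) (Dom E r) \<and> r \<cdot> u = r"
      using univ[of r] r by simp
    moreover have "s \<cdot> r \<in> hom E (Dom E r) (Dom E r)" "Idn E (Dom E r) \<in> hom E (Dom E r) (Dom E r)"
      using s' r by auto
    moreover have "r \<cdot> (s \<cdot> r) = r" using comp_eq_extend[OF rs, of r] s' r by simp
    moreover have "r \<cdot> Idn E (Dom E r) = r" using r by simp
    ultimately have "s \<cdot> r = Idn E (Dom E r)" by metis
    then show ?thesis
      using iso[of s Om "Dom E r" r] rs s' r by simp
  qed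
  have "Dom E m \<in> Q" if m: "monic E m" "Cod E m \<in> Q" for m
  proof -
    have m': "m \<in> Arr E" using m by simp
    let ?Y = "Cod E m"
    let ?D = "\<lambda>i::nat. if i = 0 then ?Y else Om"
    let ?K = "{(0::nat, chi m, 1::nat), (0, true_at ?Y, 1)}"
    show ?thesis
    proof (rule lim[of "{0, 1}" ?D ?K])
      show "finite_diagram E {0, 1} ?D ?K"
        unfolding finite_diagram_def using m m' by auto
      show "?D i \<in> Q" if "i \<in> {0, 1}" for i using m Om by auto
      show "limit_cone E {0, 1} ?D ?K (Dom E m) (\<lambda>i. if i = 0 then m else true_at (Dom E m))"
        unfolding limit_cone_def
      proof (intro conjI allI impI)
        show "cone E {0, 1} ?D ?K (Dom E m) (\<lambda>i. if i = 0 then m else true_at (Dom E m))"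
          unfolding cone_def using m m' chi_self by auto
        fix Z q assume "cone E {0, 1} ?D ?K Z q"
        then have q: "q 0 \<in> Arr E" "Dom E (q 0) = Z" "Cod E (q 0) = ?Y"
          "chi m \<cdot> q 0 = q 1" "true_at ?Y \<cdot> q 0 = q 1"
          unfolding cone_def by auto
        then have q1: "q 1 = true_at Z" by simp
        then have "factors_through E (q 0) m"
          using chi_true_iff[OF m(1), of "q 0"] q by simp
        then obtain u where u: "u \<in> Arr E" "Dom E u = Dom E (q 0)" "Cod E u = Dom E m" "m \<cdot> u = q 0"
          by (rule factors_throughE)
        show "\<exists>!u. u \<in> hom E Z (Dom E m) \<and>
            (\<forall>i\<in>{0, 1}. (if i = 0 then m else true_at (Dom E m)) \<cdot> u = q i)"
        proof (rule ex1I[of _ u])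
          show "u \<in> hom E Z (Dom E m) \<and>
            (\<forall>i\<in>{0, 1}. (if i = 0 then m else true_at (Dom E m)) \<cdot> u = q i)"
            using u q(2) q1 by simp
          fix v assume v: "v \<in> hom E Z (Dom E m) \<and>
            (\<forall>i\<in>{0, 1}. (if i = 0 then m else true_at (Dom E m)) \<cdot> v = q i)"
          then have "m \<cdot> v = q 0" by (metis insertI1)
          then show "v = u"
            by (intro monicD[OF m(1), of v u]) (use u q(2) v in auto)
        qed
      qed
    qed
  qed
  then show ?thesis
    unfolding hyperconnected_class_def using Q One Prod coref by blast
qed

end

text \<open>The codomain of the quotient may live on other types than \<open>E\<close>.\<close>

locale quotient_of = cat E for E :: "('o, 'm) category" (structure) +
  fixes f :: "('o, 'm, 'p, 'n) geometric"
  assumes quotient: "is_quotient E f"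
begin

abbreviation "F \<equiv> target f"
abbreviation "L \<equiv> inverse_image f"
abbreviation "R \<equiv> direct_image f"

sublocale F: cat F
  using quotient unfolding is_quotient_def geometric_morphism_def topos_def by unfold_locales blast

lemma inverse_image_functor: "cfunctor F E L"
  and direct_image_functor: "cfunctor E F R"
  using quotient unfolding is_quotient_def geometric_morphism_def left_adjoint_def by auto

lemma L_obj [simp]: "x \<in> Obj F \<Longrightarrow> fobj L x \<in> Obj E"
  and L_hom: "a \<in> hom F x y \<Longrightarrow> fmap L a \<in> hom E (fobj L x) (fobj L y)"
  and R_obj [simp]: "X \<in> Obj E \<Longrightarrow> fobj R X \<in> Obj F"
  and R_idn: "X \<in> Obj E \<Longrightarrow> fmap R (Idn E X) = Idn F (fobj R X)"
  using inverse_image_functor direct_image_functor unfolding cfunctor_def by blast+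

lemma full:
  assumes "x \<in> Obj F" "y \<in> Obj F" "g \<in> hom E (fobj L x) (fobj L y)"
  obtains a where "a \<in> hom F x y" "fmap L a = g"
proof -
  have "bij_betw (fmap L) (hom F x y) (hom E (fobj L x) (fobj L y))"
    using quotient assms unfolding is_quotient_def fully_faithful_def by blast
  then have "g \<in> fmap L ` hom F x y" using assms(3) unfolding bij_betw_def by blast
  then show ?thesis using that by blast
qed

lemma mem_image:
  assumes "X \<in> quotient_image E f"
  obtains x i j where "x \<in> Obj F" "i \<in> hom E (fobj L x) X" "j \<in> hom E X (fobj L x)"
    "j \<cdot> i = Idn E (fobj L x)" "i \<cdot> j = Idn E X"
  using assms unfolding quotient_image_def essential_image_def isomorphic_def by blast

lemma image_memI:
  assumes "x \<in> Obj F" "i \<in> hom E (fobj L x) X" "j \<in> hom E X (fobj L x)"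
    "j \<cdot> i = Idn E (fobj L x)" "i \<cdot> j = Idn E X" "X \<in> Obj E"
  shows "X \<in> quotient_image E f"
  using assms unfolding quotient_image_def essential_image_def isomorphic_def by blast

lemma L_mem_image: "x \<in> Obj F \<Longrightarrow> fobj L x \<in> quotient_image E f"
  by (rule image_memI[of x "Idn E (fobj L x)" _ "Idn E (fobj L x)"]) auto

text \<open>The coreflection of \<open>X\<close> is the counit \<open>r\<close> of the adjunction. Its universal property concerns
arbitrary arrows from objects \<open>L z\<close>, whereas the image also contains isomorphic copies, and uniqueness has
to range over all arrows into \<open>L (R X)\<close>; fullness of \<open>L\<close> makes these arrows images under \<open>L\<close>.\<close>

lemma image_coreflection:
  assumes X: "X \<in> Obj E"
  shows "\<exists>r. coreflection E (quotient_image E f) X r"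
proof -
  obtain \<phi> where bij: "\<And>x Y. x \<in> Obj F \<Longrightarrow> Y \<in> Obj E \<Longrightarrow>
      bij_betw (\<phi> x Y) (hom E (fobj L x) Y) (hom F x (fobj R Y))"
    and nat: "\<forall>x\<in>Obj F. \<forall>x'\<in>Obj F. \<forall>Y\<in>Obj E. \<forall>Y'\<in>Obj E.
       \<forall>a\<in>hom F x' x. \<forall>b\<in>hom E Y Y'. \<forall>g\<in>hom E (fobj L x) Y.
         \<phi> x' Y' (b \<cdot> g \<cdot> fmap L a) = Comp F (Comp F (fmap R b) (\<phi> x Y g)) a"
    using quotient unfolding is_quotient_def geometric_morphism_def left_adjoint_def by metis
  let ?x = "fobj R X"
  have x: "?x \<in> Obj F" using X by simp
  obtain r where rh: "r \<in> hom E (fobj L ?x) X" and phi_r: "\<phi> ?x X r = Idn F ?x"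
  proof -
    have "Idn F ?x \<in> \<phi> ?x X ` hom E (fobj L ?x) X"
      using bij[OF x X] x unfolding bij_betw_def by auto
    then show ?thesis using that by auto
  qed
  have r: "r \<in> Arr E" "Dom E r = fobj L ?x" "Cod E r = X" using rh by auto
  have phi_La: "\<phi> z X (r \<cdot> fmap L a) = a" if z: "z \<in> Obj F" and a: "a \<in> hom F z ?x" for z a
  proof -
    have La: "fmap L a \<in> Arr E" "Dom E (fmap L a) = fobj L z" "Cod E (fmap L a) = fobj L ?x"
      using L_hom[OF a] by auto
    have "\<phi> z X (Idn E X \<cdot> r \<cdot> fmap L a) = Comp F (Comp F (fmap R (Idn E X)) (\<phi> ?x X r)) a"
      using nat x z X a rh idn_typing[OF X] by (metis mem_hom_iff)
    then show ?thesis
      using r La R_idn[OF X] phi_r x a by simp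
  qed
  have univ: "\<exists>!u. u \<in> hom E (Dom E g) (Dom E r) \<and> r \<cdot> u = g"
    if g: "g \<in> Arr E" "Dom E g \<in> quotient_image E f" "Cod E g = X" for g
  proof -
    obtain z i j where z: "z \<in> Obj F" and ih: "i \<in> hom E (fobj L z) (Dom E g)"
      and jh: "j \<in> hom E (Dom E g) (fobj L z)"
      and ji: "j \<cdot> i = Idn E (fobj L z)" and ij: "i \<cdot> j = Idn E (Dom E g)"
      by (rule mem_image[OF g(2)])
    have i: "i \<in> Arr E" "Dom E i = fobj L z" "Cod E i = Dom E g"
      and j: "j \<in> Arr E" "Dom E j = Dom E g" "Cod E j = fobj L z" using ih jh by auto
    define a where "a = \<phi> z X (g \<cdot> i)"
    have gi: "g \<cdot> i \<in> hom E (fobj L z) X" using g i by auto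
    have a: "a \<in> hom F z ?x"
      using bij[OF z X] gi unfolding a_def bij_betw_def by blast
    have La: "fmap L a \<in> Arr E" "Dom E (fmap L a) = fobj L z" "Cod E (fmap L a) = fobj L ?x"
      using L_hom[OF a] by auto
    have "\<phi> z X (r \<cdot> fmap L a) = \<phi> z X (g \<cdot> i)" using phi_La[OF z a] a_def by simp
    moreover have "r \<cdot> fmap L a \<in> hom E (fobj L z) X" using r La by auto
    ultimately have rLa: "r \<cdot> fmap L a = g \<cdot> i"
      using bij[OF z X] gi unfolding bij_betw_def by (meson inj_onD)
    show ?thesis
    proof (rule ex1I[of _ "fmap L a \<cdot> j"])
      have "r \<cdot> (fmap L a \<cdot> j) = (g \<cdot> i) \<cdot> j"
        by (rule comp_eq_extend[OF rLa]) (use r La j in auto)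
      then show "fmap L a \<cdot> j \<in> hom E (Dom E g) (Dom E r) \<and> r \<cdot> (fmap L a \<cdot> j) = g"
        using g i j La r ij by simp
    next
      fix u assume "u \<in> hom E (Dom E g) (Dom E r) \<and> r \<cdot> u = g"
      then have u: "u \<in> Arr E" "Dom E u = Dom E g" "Cod E u = fobj L ?x" and ru: "r \<cdot> u = g"
        using r by auto
      have ui: "u \<cdot> i \<in> hom E (fobj L z) (fobj L ?x)" using u(1-3) i by auto
      obtain b where b: "b \<in> hom F z ?x" "fmap L b = u \<cdot> i"
        by (rule full[OF z x ui])
      have "r \<cdot> (u \<cdot> i) = g \<cdot> i"
        by (rule comp_eq_extend[OF ru]) (use u i r in auto)
      then have "b = a" using phi_La[OF z b(1)] b(2) a_def by simp
      then have "fmap L a \<cdot> j = (u \<cdot> i) \<cdot> j" using b by simp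
      then show "u = fmap L a \<cdot> j" using u i j ij by simp
    qed
  qed
  have "Dom E r \<in> quotient_image E f" using L_mem_image[OF x] r(2) by simp
  then have "coreflection E (quotient_image E f) X r"
    unfolding coreflection_def by (intro conjI ballI impI univ r)
  then show ?thesis by blast
qed

text \<open>Each object \<open>D k\<close> is isomorphic to some \<open>L (x k)\<close> through \<open>\<alpha> k\<close>, with inverse \<open>\<beta> k\<close>. By fullness, the conjugated
edges of the diagram come from a diagram of the \<open>x k\<close>, whose limit \<open>y\<close> is preserved by \<open>L\<close>.
Then \<open>X\<close> and \<open>L y\<close> are limits of isomorphic diagrams.\<close>

lemma image_limit:
  assumes diag: "finite_diagram E I D K" and D: "\<And>i. i \<in> I \<Longrightarrow> D i \<in> quotient_image E f"
    and lim: "limit_cone E I D K X p"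
  shows "X \<in> quotient_image E f"
proof -
  have "\<forall>k\<in>I. \<exists>x i j. x \<in> Obj F \<and> i \<in> hom E (fobj L x) (D k) \<and> j \<in> hom E (D k) (fobj L x) \<and>
    j \<cdot> i = Idn E (fobj L x) \<and> i \<cdot> j = Idn E (D k)"
  proof
    fix k assume "k \<in> I"
    from D[OF this] show "\<exists>x i j. x \<in> Obj F \<and> i \<in> hom E (fobj L x) (D k) \<and>
        j \<in> hom E (D k) (fobj L x) \<and> j \<cdot> i = Idn E (fobj L x) \<and> i \<cdot> j = Idn E (D k)"
      by (rule mem_image) blast
  qed
  then obtain x \<alpha> \<beta> where xab: "\<forall>k\<in>I. x k \<in> Obj F \<and> \<alpha> k \<in> hom E (fobj L (x k)) (D k) \<and>
    \<beta> k \<in> hom E (D k) (fobj L (x k)) \<and> \<beta> k \<cdot> \<alpha> k = Idn E (fobj L (x k)) \<and>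
    \<alpha> k \<cdot> \<beta> k = Idn E (D k)"
    by metis
  have x: "x k \<in> Obj F" and al: "\<alpha> k \<in> Arr E" "Dom E (\<alpha> k) = fobj L (x k)" "Cod E (\<alpha> k) = D k"
    and be: "\<beta> k \<in> Arr E" "Dom E (\<beta> k) = D k" "Cod E (\<beta> k) = fobj L (x k)"
    and ba: "\<beta> k \<cdot> \<alpha> k = Idn E (fobj L (x k))" and ab: "\<alpha> k \<cdot> \<beta> k = Idn E (D k)"
    if "k \<in> I" for k
    using xab that by auto
  have fin: "finite I" "finite K" and K: "\<And>i a j. (i, a, j) \<in> K \<Longrightarrow>
      i \<in> I \<and> j \<in> I \<and> a \<in> Arr E \<and> Dom E a = D i \<and> Cod E a = D j"
    using diag unfolding finite_diagram_def by (auto split: prod.splits)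
  define pre where "pre = (\<lambda>(i, a, j). SOME b. b \<in> hom F (x i) (x j) \<and> fmap L b = \<beta> j \<cdot> (a \<cdot> \<alpha> i))"
  have pre: "pre (i, a, j) \<in> hom F (x i) (x j) \<and> fmap L (pre (i, a, j)) = \<beta> j \<cdot> (a \<cdot> \<alpha> i)"
    if e: "(i, a, j) \<in> K" for i a j
  proof -
    have ij: "i \<in> I" "j \<in> I" and a: "a \<in> Arr E" "Dom E a = D i" "Cod E a = D j"
      using K[OF e] by auto
    have "\<beta> j \<cdot> (a \<cdot> \<alpha> i) \<in> hom E (fobj L (x i)) (fobj L (x j))"
      using a al[OF ij(1)] be[OF ij(2)] by auto
    then have "\<exists>b. b \<in> hom F (x i) (x j) \<and> fmap L b = \<beta> j \<cdot> (a \<cdot> \<alpha> i)"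
      using full[OF x[OF ij(1)] x[OF ij(2)]] by metis
    from someI_ex[OF this] show ?thesis unfolding pre_def by simp
  qed
  let ?K = "(\<lambda>(i, a, j). (i, pre (i, a, j), j)) ` K"
  have diagF: "finite_diagram F I x ?K"
    unfolding finite_diagram_def
  proof (intro conjI ballI)
    fix e assume "e \<in> ?K"
    then obtain i a j where e: "(i, a, j) \<in> K" "e = (i, pre (i, a, j), j)" by auto
    then show "case e of (i, a, j) \<Rightarrow> i \<in> I \<and> j \<in> I \<and> a \<in> hom F (x i) (x j)"
      using K[OF e(1)] pre[OF e(1)] by simp
  qed (use fin x in auto)
  have "has_finite_limits F"
    using quotient unfolding is_quotient_def geometric_morphism_def topos_def by blast
  then have "\<exists>y p'. limit_cone F I x ?K y p'"
    using diagF unfolding has_finite_limits_def by blast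
  then obtain y p' where limF: "limit_cone F I x ?K y p'" by (elim exE)
  have "preserves_finite_limits F E L"
    using quotient unfolding is_quotient_def geometric_morphism_def by blast
  then have limE: "limit_cone E I (\<lambda>i. fobj L (x i)) ((\<lambda>(i, a, j). (i, fmap L a, j)) ` ?K)
      (fobj L y) (\<lambda>i. fmap L (p' i))"
    unfolding preserves_finite_limits_def using diagF limF by (elim allE impE) (rule conjI)
  let ?Y = "fobj L y" and ?p = "\<lambda>i. fmap L (p' i)"
  let ?D = "\<lambda>i. fobj L (x i)" and ?LK = "(\<lambda>(i, a, j). (i, fmap L a, j)) ` ?K"
  have y: "y \<in> Obj F" using limF unfolding limit_cone_def cone_def by blast
  have coneE_iff: "cone E I ?D ?LK Z q \<longleftrightarrow> Z \<in> Obj E \<and> (\<forall>i\<in>I. q i \<in> hom E Z (?D i)) \<and>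
      (\<forall>(i, a, j)\<in>K. (\<beta> j \<cdot> (a \<cdot> \<alpha> i)) \<cdot> q i = q j)" for Z q
    unfolding cone_def using pre by (auto split: prod.splits simp: image_image)
  have univE: "\<And>Z q. cone E I ?D ?LK Z q \<Longrightarrow> \<exists>!u. u \<in> hom E Z ?Y \<and> (\<forall>i\<in>I. ?p i \<cdot> u = q i)"
    and cE: "cone E I ?D ?LK ?Y ?p"
    using limE unfolding limit_cone_def by blast+
  have univ: "\<And>Z q. cone E I D K Z q \<Longrightarrow> \<exists>!u. u \<in> hom E Z X \<and> (\<forall>i\<in>I. p i \<cdot> u = q i)"
    and c: "cone E I D K X p"
    using lim unfolding limit_cone_def by blast+
  have X: "X \<in> Obj E" and p: "\<And>i. i \<in> I \<Longrightarrow> p i \<in> Arr E \<and> Dom E (p i) = X \<and> Cod E (p i) = D i"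
    and edge: "\<And>i a j. (i, a, j) \<in> K \<Longrightarrow> a \<cdot> p i = p j"
    using c unfolding cone_def by auto
  have Y: "?Y \<in> Obj E" and p': "\<And>i. i \<in> I \<Longrightarrow> ?p i \<in> Arr E \<and> Dom E (?p i) = ?Y \<and> Cod E (?p i) = ?D i"
    and edge': "\<And>i a j. (i, a, j) \<in> K \<Longrightarrow> (\<beta> j \<cdot> (a \<cdot> \<alpha> i)) \<cdot> ?p i = ?p j"
    using cE unfolding coneE_iff by auto
  have "cone E I ?D ?LK X (\<lambda>i. \<beta> i \<cdot> p i)"
    unfolding coneE_iff
  proof (intro conjI ballI)
    fix e assume "e \<in> K"
    then obtain i a j where e: "e = (i, a, j)" "(i, a, j) \<in> K" by (cases e) auto
    have ij: "i \<in> I" "j \<in> I" and a: "a \<in> Arr E" "Dom E a = D i" "Cod E a = D j" using K[OF e(2)] by auto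
    have "\<alpha> i \<cdot> (\<beta> i \<cdot> p i) = Idn E (D i) \<cdot> p i"
      by (rule comp_eq_extend[OF ab[OF ij(1)]]) (use p[OF ij(1)] al[OF ij(1)] be[OF ij(1)] in auto)
    then have "\<alpha> i \<cdot> (\<beta> i \<cdot> p i) = p i" using p[OF ij(1)] by simp
    then have "(\<beta> j \<cdot> (a \<cdot> \<alpha> i)) \<cdot> (\<beta> i \<cdot> p i) = \<beta> j \<cdot> p j"
      using a al[OF ij(1)] be[OF ij(1)] be[OF ij(2)] p[OF ij(1)] edge[OF e(2)] by simp
    then show "case e of (i, a, j) \<Rightarrow> (\<beta> j \<cdot> (a \<cdot> \<alpha> i)) \<cdot> (\<beta> i \<cdot> p i) = \<beta> j \<cdot> p j"
      unfolding e(1) by simp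
  qed (use X p be in auto)
  from univE[OF this] obtain u where u: "u \<in> Arr E" "Dom E u = X" "Cod E u = ?Y"
    and pu: "\<And>i. i \<in> I \<Longrightarrow> ?p i \<cdot> u = \<beta> i \<cdot> p i" by (metis mem_hom_iff)
  have "cone E I D K ?Y (\<lambda>i. \<alpha> i \<cdot> ?p i)"
    unfolding cone_def
  proof (intro conjI ballI)
    fix e assume "e \<in> K"
    then obtain i a j where e: "e = (i, a, j)" "(i, a, j) \<in> K" by (cases e) auto
    have ij: "i \<in> I" "j \<in> I" and a: "a \<in> Arr E" "Dom E a = D i" "Cod E a = D j" using K[OF e(2)] by auto
    note t = a al[OF ij(1)] al[OF ij(2)] be[OF ij(2)] p'[OF ij(1)]
    have "\<alpha> j \<cdot> ?p j = \<alpha> j \<cdot> (\<beta> j \<cdot> (a \<cdot> (\<alpha> i \<cdot> ?p i)))"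
      unfolding edge'[OF e(2), symmetric] using t by simp
    also have "\<dots> = Idn E (D j) \<cdot> (a \<cdot> (\<alpha> i \<cdot> ?p i))"
      by (rule comp_eq_extend[OF ab[OF ij(2)]]) (use t in auto)
    also have "\<dots> = a \<cdot> (\<alpha> i \<cdot> ?p i)" using t by simp
    finally show "case e of (i, a, j) \<Rightarrow> a \<cdot> (\<alpha> i \<cdot> ?p i) = \<alpha> j \<cdot> ?p j"
      unfolding e(1) by simp
  qed (use Y p' al in auto)
  from univ[OF this] obtain v where v: "v \<in> Arr E" "Dom E v = ?Y" "Cod E v = X"
    and pv: "\<And>i. i \<in> I \<Longrightarrow> p i \<cdot> v = \<alpha> i \<cdot> ?p i" by (metis mem_hom_iff)
  have "p i \<cdot> (v \<cdot> u) = p i" if i: "i \<in> I" for i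
  proof -
    note t = u v al[OF i] be[OF i] p[OF i] p'[OF i]
    have "p i \<cdot> (v \<cdot> u) = (\<alpha> i \<cdot> ?p i) \<cdot> u"
      by (rule comp_eq_extend[OF pv[OF i]]) (use t in auto)
    also have "\<dots> = \<alpha> i \<cdot> (\<beta> i \<cdot> p i)" using t pu[OF i] by simp
    also have "\<dots> = Idn E (D i) \<cdot> p i"
      by (rule comp_eq_extend[OF ab[OF i]]) (use t in auto)
    finally show ?thesis using t by simp
  qed
  moreover have "v \<cdot> u \<in> hom E X X" "Idn E X \<in> hom E X X" "\<forall>i\<in>I. p i \<cdot> Idn E X = p i"
    using u v X p by auto
  ultimately have vu: "v \<cdot> u = Idn E X" using univ[OF c] by metis
  have "?p i \<cdot> (u \<cdot> v) = ?p i" if i: "i \<in> I" for i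
  proof -
    note t = u v al[OF i] be[OF i] p[OF i] p'[OF i]
    have "?p i \<cdot> (u \<cdot> v) = (\<beta> i \<cdot> p i) \<cdot> v"
      by (rule comp_eq_extend[OF pu[OF i]]) (use t in auto)
    also have "\<dots> = \<beta> i \<cdot> (\<alpha> i \<cdot> ?p i)" using t pv[OF i] by simp
    also have "\<dots> = Idn E (?D i) \<cdot> ?p i"
      by (rule comp_eq_extend[OF ba[OF i]]) (use t in auto)
    finally show ?thesis using t by simp
  qed
  moreover have "u \<cdot> v \<in> hom E ?Y ?Y" "Idn E ?Y \<in> hom E ?Y ?Y" "\<forall>i\<in>I. ?p i \<cdot> Idn E ?Y = ?p i"
    using u v Y p' by auto
  ultimately have uv: "u \<cdot> v = Idn E ?Y" using univE[OF cE] by metis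
  show ?thesis
    by (rule image_memI[OF y, of v _ u]) (use u v uv vu X in auto)
qed

end

lemma (in boolean_topos) quotient_image_hyperconnected:
  assumes f: "is_quotient E f"
  shows "hyperconnected_class E P (quotient_image E f)"
proof -
  interpret q: quotient_of E f by unfold_locales (rule f)
  show ?thesis
  proof (rule hyperconnectedI)
    show "quotient_image E f \<subseteq> Obj E"
      unfolding quotient_image_def essential_image_def by blast
  qed (use q.image_limit q.image_coreflection in auto)
qed

theorem corollary5p5:
  fixes U :: "'u set set"
    and E :: "('o, 'm) category"
    and P :: "('o, 'm) products"
    and Om :: 'o and tr :: 'm
    and Xi :: 'o and xi :: "'o \<Rightarrow> 'm"
  assumes "subset_closed U"
    and "topos E"
    and "locally_small U E"
    and "boolean E"
    and "finite_products E P"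
    and "subobject_classifier E (One P) Om tr"
    and "local_state_classifier E Xi xi"
  shows "bij_betw (corresponding_quotient E (One P) tr xi)
           (lsc_homs E P Om tr Xi xi) (quotients E) \<and>
         (\<forall>f :: ('o, 'm, 'p, 'n) geometric. is_quotient E f \<longrightarrow>
           (\<exists>!h. h \<in> lsc_homs E P Om tr Xi xi \<and>
                 quotient_image E f = classified_objects E (One P) tr xi h)) \<and>
         small U (quotients E)"
proof -
  have cat: "category E" using assms(2) unfolding topos_def by blast
  interpret boolean_topos E P Om tr
    using assms cat by unfold_locales auto
  interpret lsc E P Om tr Xi xi
    using assms by unfold_locales auto
  let ?H = "lsc_homs E P Om tr Xi xi" and ?O = "classified_objects E (One P) tr xi"
  let ?c = "corresponding_quotient E (One P) tr xi"
  have unique: "\<exists>!h. h \<in> ?H \<and> quotient_image E f = ?O h" if "is_quotient E f"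
    for f :: "('o, 'm, 'r, 's) geometric"
  proof -
    have "hyperconnected_class E P (quotient_image E f)"
      by (rule quotient_image_hyperconnected[OF that])
    then obtain h where "h \<in> ?H" "?O h = quotient_image E f"
      by (rule hyperconnected_class_has_hom)
    then show ?thesis using objects_inject by (intro ex1I[of _ h]) auto
  qed
  have realized: "\<exists>f :: ('o, 'm, 'o, 'm) geometric. is_quotient E f \<and> quotient_image E f = ?O h"
    if "h \<in> ?H" for h
  proof -
    interpret Q: hyperconnected E P Om tr "?O h"
      by unfold_locales (rule hyperconnected_objects[OF that])
    show ?thesis using Q.quotient_is_quotient Q.quotient_image_eq by blast
  qed
  have class_eq: "same_quotient E `` {f} = ?c h"
    if "is_quotient E f" "quotient_image E f = ?O h" for f h
    using that unfolding same_quotient_def corresponding_quotient_def by auto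
  have bij: "bij_betw ?c ?H (quotients E)"
    unfolding bij_betw_def
  proof
    show "inj_on ?c ?H"
    proof (rule inj_onI)
      fix h k assume h: "h \<in> ?H" and k: "k \<in> ?H" and eq: "?c h = ?c k"
      obtain f :: "('o, 'm, 'o, 'm) geometric"
        where f: "is_quotient E f" "quotient_image E f = ?O h" using realized[OF h] by blast
      then have "f \<in> ?c k" using eq unfolding corresponding_quotient_def by blast
      then have "?O h = ?O k" using f unfolding corresponding_quotient_def by simp
      then show "h = k" by (rule objects_inject[OF h k])
    qed
    show "?c ` ?H = quotients E"
    proof
      show "?c ` ?H \<subseteq> quotients E"
      proof
        fix q assume "q \<in> ?c ` ?H"
        then obtain h where h: "h \<in> ?H" "q = ?c h" by blast
        obtain f :: "('o, 'm, 'o, 'm) geometric"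
          where f: "is_quotient E f" "quotient_image E f = ?O h" using realized[OF h(1)] by blast
        then have "q = same_quotient E `` {f}" using class_eq h(2) by simp
        then show "q \<in> quotients E"
          unfolding quotients_def using f(1) by (simp add: quotientI)
      qed
      show "quotients E \<subseteq> ?c ` ?H"
      proof
        fix q assume "q \<in> quotients E"
        then obtain f where f: "is_quotient E f" "q = same_quotient E `` {f}"
          unfolding quotients_def by (auto elim: quotientE)
        obtain h where h: "h \<in> ?H" "quotient_image E f = ?O h"
          using unique[OF f(1)] by blast
        have "q = ?c h" using class_eq[OF f(1) h(2)] f(2) by simp
        then show "q \<in> ?c ` ?H" using h(1) by (rule image_eqI)
      qed
    qed
  qed
  have "small U (quotients E)"
  proof -
    obtain B where B: "B \<in> U" "hom E Xi Om \<approx> B"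
      using assms(3) unfolding locally_small_def small_def by (metis Om_obj Xi_obj)
    then obtain g where g: "bij_betw g (hom E Xi Om) B" unfolding eqpoll_def by blast
    have "?H \<subseteq> hom E Xi Om" using mem_homs_iff by blast
    then have inj: "inj_on g ?H" and "g ` ?H \<subseteq> B"
      using g inj_on_subset unfolding bij_betw_def by blast+
    then have "g ` ?H \<in> U"
      using B(1) assms(1) unfolding subset_closed_def by blast
    moreover have "?H \<approx> g ` ?H"
      unfolding eqpoll_def using inj_on_imp_bij_betw[OF inj] by blast
    moreover have "quotients E \<approx> ?H"
      using bij unfolding eqpoll_def by (meson bij_betw_inv)
    ultimately show ?thesis unfolding small_def by (meson eqpoll_trans)
  qed
  then show ?thesis using bij unique by blast
qed

end
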